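(* The inclusion functors $\mathsf{Profinite}\to\mathsf{CompHaus}$ and $\mathsf{Stonean}\to\mathsf{CompHaus}$ induce (by precomposition) equivalences of categories between the categories of sheaves (of sets) for the coherent topology on $\mathsf{CompHaus}$, on $\mathsf{Profinite}$, and on $\mathsf{Stonean}$.
   Context: $\mathsf{CompHaus}$ is the category of compact Hausdorff spaces and continuous maps. $\mathsf{Profinite}$ is its full subcategory of totally disconnected compact Hausdorff spaces. $\mathsf{Stonean}$ is the full subcategory of extremally disconnected compact Hausdorff spaces (the closure of every open set is open). A family of morphisms $(f_i\colon X_i\to B)_{i\in I}$ in a category is effective epimorphic if for every object $W$ and every family $(e_i\colon X_i\to W)_{i\in I}$ such that $e_i\circ g_i=e_j\circ g_j$ whenever $i,j\in I$, $g_i\colon Z\to X_i$, $g_j\colon Z\to X_j$ satisfy $f_i\circ g_i=f_j\circ g_j$, there is a unique $d\colon B\to W$ with $d\circ f_i=e_i$ for all $i$. A category is precoherent if for every finite effective epimorphic family $(\pi_i\colon X_i\to B)_{i\in I}$ and every morphism $f\colon B'\to B$ there is a finite effective epimorphic family $(\pi'_j\colon X'_j\to B')_{j\in J}$ such that each $f\circ\pi'_j$ factors through some $\pi_i$. The coherent topology on a precoherent category is the smallest Grothendieck topology in which the sieve generated by each finite effective epimorphic family is a covering sieve. The three categories above are precoherent, so they carry a coherent topology. Size convention: "set" is understood relative to a sufficiently large universe. *)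

theory Defs
  imports "HOL-Analysis.Analysis" "HOL-Library.Equipollence"
begin

section \<open>Categories, functors, equivalences\<close>

text \<open>
  Categories are given by hom-sets indexed by objects. Arrows do not carry their domain and codomain
  and the hom-sets need not be disjoint, so identities and composition take the objects as
  arguments: \<open>Comp C X Y Z g f\<close> is the composite of \<open>f : X \<rightarrow> Y\<close> followed by \<open>g : Y \<rightarrow> Z\<close>.
\<close>

record ('o, 'm) cat =
  Ob :: "'o set"
  Hom :: "'o \<Rightarrow> 'o \<Rightarrow> 'm set"
  Ide :: "'o \<Rightarrow> 'm"
  Comp :: "'o \<Rightarrow> 'o \<Rightarrow> 'o \<Rightarrow> 'm \<Rightarrow> 'm \<Rightarrow> 'm"

definition category :: "('o, 'm) cat \<Rightarrow> bool" where
  "category C \<longleftrightarrow>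
     (\<forall>X\<in>Ob C. Ide C X \<in> Hom C X X) \<and>
     (\<forall>X\<in>Ob C. \<forall>Y\<in>Ob C. \<forall>Z\<in>Ob C. \<forall>f\<in>Hom C X Y. \<forall>g\<in>Hom C Y Z. Comp C X Y Z g f \<in> Hom C X Z) \<and>
     (\<forall>X\<in>Ob C. \<forall>Y\<in>Ob C. \<forall>f\<in>Hom C X Y.
        Comp C X X Y f (Ide C X) = f \<and> Comp C X Y Y (Ide C Y) f = f) \<and>
     (\<forall>W\<in>Ob C. \<forall>X\<in>Ob C. \<forall>Y\<in>Ob C. \<forall>Z\<in>Ob C. \<forall>f\<in>Hom C W X. \<forall>g\<in>Hom C X Y. \<forall>h\<in>Hom C Y Z.
        Comp C W X Z (Comp C X Y Z h g) f = Comp C W Y Z h (Comp C W X Y g f))"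

definition op_cat :: "('o, 'm) cat \<Rightarrow> ('o, 'm) cat" where
  "op_cat C = \<lparr>Ob = Ob C, Hom = (\<lambda>X Y. Hom C Y X), Ide = Ide C,
     Comp = (\<lambda>X Y Z g f. Comp C Z Y X f g)\<rparr>"

definition full_subcat :: "('o, 'm) cat \<Rightarrow> ('o \<Rightarrow> bool) \<Rightarrow> ('o, 'm) cat" where
  "full_subcat C P = C\<lparr>Ob := {X \<in> Ob C. P X}\<rparr>"

record ('o1, 'm1, 'o2, 'm2) func =
  FOb :: "'o1 \<Rightarrow> 'o2"
  FHom :: "'o1 \<Rightarrow> 'o1 \<Rightarrow> 'm1 \<Rightarrow> 'm2"

text \<open>
  Functors and natural transformations are required to be \<open>undefined\<close> outside their domain, so that
  equality of functors is equality of their values on the source category.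
\<close>

definition make_func :: "('o1, 'm1) cat \<Rightarrow> ('o1 \<Rightarrow> 'o2) \<Rightarrow> ('o1 \<Rightarrow> 'o1 \<Rightarrow> 'm1 \<Rightarrow> 'm2)
    \<Rightarrow> ('o1, 'm1, 'o2, 'm2) func" where
  "make_func C F0 F1 =
     \<lparr>FOb = (\<lambda>X. if X \<in> Ob C then F0 X else undefined),
      FHom = (\<lambda>X Y f. if X \<in> Ob C \<and> Y \<in> Ob C \<and> f \<in> Hom C X Y then F1 X Y f else undefined)\<rparr>"

definition is_functor :: "('o1, 'm1) cat \<Rightarrow> ('o2, 'm2) cat \<Rightarrow> ('o1, 'm1, 'o2, 'm2) func \<Rightarrow> bool" where
  "is_functor C D F \<longleftrightarrow> category C \<and> category D \<and>
     make_func C (FOb F) (FHom F) = F \<and>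
     (\<forall>X\<in>Ob C. FOb F X \<in> Ob D) \<and>
     (\<forall>X\<in>Ob C. \<forall>Y\<in>Ob C. \<forall>f\<in>Hom C X Y. FHom F X Y f \<in> Hom D (FOb F X) (FOb F Y)) \<and>
     (\<forall>X\<in>Ob C. FHom F X X (Ide C X) = Ide D (FOb F X)) \<and>
     (\<forall>X\<in>Ob C. \<forall>Y\<in>Ob C. \<forall>Z\<in>Ob C. \<forall>f\<in>Hom C X Y. \<forall>g\<in>Hom C Y Z.
        FHom F X Z (Comp C X Y Z g f) =
        Comp D (FOb F X) (FOb F Y) (FOb F Z) (FHom F Y Z g) (FHom F X Y f))"

text \<open>The inclusion of a subcategory \<open>C\<close>; the identity functor is the inclusion of \<open>C\<close> in itself.\<close>

definition inclusion_func :: "('o, 'm) cat \<Rightarrow> ('o, 'm, 'o, 'm) func" where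
  "inclusion_func C = make_func C (\<lambda>X. X) (\<lambda>X Y f. f)"

text \<open>\<open>comp_func C G F\<close> is \<open>G \<circ> F\<close>, where \<open>C\<close> is the source of \<open>F\<close>.\<close>

definition comp_func :: "('o1, 'm1) cat \<Rightarrow> ('o2, 'm2, 'o3, 'm3) func \<Rightarrow> ('o1, 'm1, 'o2, 'm2) func
    \<Rightarrow> ('o1, 'm1, 'o3, 'm3) func" where
  "comp_func C G F = make_func C (\<lambda>X. FOb G (FOb F X))
     (\<lambda>X Y f. FHom G (FOb F X) (FOb F Y) (FHom F X Y f))"

definition op_func :: "('o1, 'm1, 'o2, 'm2) func \<Rightarrow> ('o1, 'm1, 'o2, 'm2) func" where
  "op_func F = \<lparr>FOb = FOb F, FHom = (\<lambda>X Y. FHom F Y X)\<rparr>"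

definition nat_trans :: "('o1, 'm1) cat \<Rightarrow> ('o2, 'm2) cat \<Rightarrow> ('o1, 'm1, 'o2, 'm2) func
    \<Rightarrow> ('o1, 'm1, 'o2, 'm2) func \<Rightarrow> ('o1 \<Rightarrow> 'm2) set" where
  "nat_trans C D F G = {\<alpha> \<in> extensional (Ob C).
     (\<forall>X\<in>Ob C. \<alpha> X \<in> Hom D (FOb F X) (FOb G X)) \<and>
     (\<forall>X\<in>Ob C. \<forall>Y\<in>Ob C. \<forall>f\<in>Hom C X Y.
        Comp D (FOb F X) (FOb F Y) (FOb G Y) (\<alpha> Y) (FHom F X Y f) =
        Comp D (FOb F X) (FOb G X) (FOb G Y) (FHom G X Y f) (\<alpha> X))}"

definition functor_cat :: "('o1, 'm1) cat \<Rightarrow> ('o2, 'm2) cat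
    \<Rightarrow> (('o1, 'm1, 'o2, 'm2) func, 'o1 \<Rightarrow> 'm2) cat" where
  "functor_cat C D =
     \<lparr>Ob = {F. is_functor C D F},
      Hom = nat_trans C D,
      Ide = (\<lambda>F. \<lambda>X\<in>Ob C. Ide D (FOb F X)),
      Comp = (\<lambda>F G H \<beta> \<alpha>. \<lambda>X\<in>Ob C. Comp D (FOb F X) (FOb G X) (FOb H X) (\<beta> X) (\<alpha> X))\<rparr>"

definition isomorphic_in :: "('o, 'm) cat \<Rightarrow> 'o \<Rightarrow> 'o \<Rightarrow> bool" where
  "isomorphic_in C X Y \<longleftrightarrow>
     (\<exists>f\<in>Hom C X Y. \<exists>g\<in>Hom C Y X. Comp C X Y X g f = Ide C X \<and> Comp C Y X Y f g = Ide C Y)"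

definition is_equivalence :: "('o1, 'm1) cat \<Rightarrow> ('o2, 'm2) cat \<Rightarrow> ('o1, 'm1, 'o2, 'm2) func \<Rightarrow> bool" where
  "is_equivalence C D F \<longleftrightarrow> is_functor C D F \<and>
     (\<exists>G. is_functor D C G \<and>
        isomorphic_in (functor_cat C C) (comp_func C G F) (inclusion_func C) \<and>
        isomorphic_in (functor_cat D D) (comp_func D F G) (inclusion_func D))"


section \<open>The coherent topology\<close>

definition effective_epi_family :: "('o, 'm) cat \<Rightarrow> 'o \<Rightarrow> 'i set \<Rightarrow> ('i \<Rightarrow> 'o) \<Rightarrow> ('i \<Rightarrow> 'm) \<Rightarrow> bool" where
  "effective_epi_family C B I X f \<longleftrightarrow>
     B \<in> Ob C \<and> (\<forall>i\<in>I. X i \<in> Ob C \<and> f i \<in> Hom C (X i) B) \<and>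
     (\<forall>W\<in>Ob C. \<forall>e.
        (\<forall>i\<in>I. e i \<in> Hom C (X i) W) \<and>
        (\<forall>i\<in>I. \<forall>j\<in>I. \<forall>Z\<in>Ob C. \<forall>g\<in>Hom C Z (X i). \<forall>h\<in>Hom C Z (X j).
           Comp C Z (X i) B (f i) g = Comp C Z (X j) B (f j) h \<longrightarrow>
           Comp C Z (X i) W (e i) g = Comp C Z (X j) W (e j) h) \<longrightarrow>
        (\<exists>!d. d \<in> Hom C B W \<and> (\<forall>i\<in>I. Comp C (X i) B W d (f i) = e i)))"

text \<open>A sieve on \<open>B\<close> is a set of pairs \<open>(Y, g)\<close> with \<open>g : Y \<rightarrow> B\<close>.\<close>

definition sieve :: "('o, 'm) cat \<Rightarrow> 'o \<Rightarrow> ('o \<times> 'm) set \<Rightarrow> bool" where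
  "sieve C B S \<longleftrightarrow>
     (\<forall>(Y, g)\<in>S. Y \<in> Ob C \<and> g \<in> Hom C Y B) \<and>
     (\<forall>(Y, g)\<in>S. \<forall>Z\<in>Ob C. \<forall>h\<in>Hom C Z Y. (Z, Comp C Z Y B g h) \<in> S)"

definition maximal_sieve :: "('o, 'm) cat \<Rightarrow> 'o \<Rightarrow> ('o \<times> 'm) set" where
  "maximal_sieve C B = {(Y, g). Y \<in> Ob C \<and> g \<in> Hom C Y B}"

definition generated_sieve :: "('o, 'm) cat \<Rightarrow> 'o \<Rightarrow> 'i set \<Rightarrow> ('i \<Rightarrow> 'o) \<Rightarrow> ('i \<Rightarrow> 'm) \<Rightarrow> ('o \<times> 'm) set" where
  "generated_sieve C B I X f =
     {(Z, h). Z \<in> Ob C \<and> (\<exists>i\<in>I. \<exists>g\<in>Hom C Z (X i). h = Comp C Z (X i) B (f i) g)}"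

text \<open>\<open>pullback_sieve C B' B f S\<close> is the pullback of the sieve \<open>S\<close> on \<open>B\<close> along \<open>f : B' \<rightarrow> B\<close>.\<close>

definition pullback_sieve :: "('o, 'm) cat \<Rightarrow> 'o \<Rightarrow> 'o \<Rightarrow> 'm \<Rightarrow> ('o \<times> 'm) set \<Rightarrow> ('o \<times> 'm) set" where
  "pullback_sieve C B' B f S =
     {(Z, g). Z \<in> Ob C \<and> g \<in> Hom C Z B' \<and> (Z, Comp C Z B' B f g) \<in> S}"

definition grothendieck_topology :: "('o, 'm) cat \<Rightarrow> ('o \<Rightarrow> ('o \<times> 'm) set set) \<Rightarrow> bool" where
  "grothendieck_topology C J \<longleftrightarrow> (\<forall>B\<in>Ob C.
     (\<forall>S\<in>J B. sieve C B S) \<and>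
     maximal_sieve C B \<in> J B \<and>
     (\<forall>S\<in>J B. \<forall>B'\<in>Ob C. \<forall>f\<in>Hom C B' B. pullback_sieve C B' B f S \<in> J B') \<and>
     (\<forall>S\<in>J B. \<forall>R. sieve C B R \<and> (\<forall>(Y, g)\<in>S. pullback_sieve C Y B g R \<in> J Y) \<longrightarrow> R \<in> J B))"

text \<open>
  The smallest Grothendieck topology containing the sieves generated by finite effective
  epimorphic families, formed as the intersection of all such topologies. Index sets are finite
  sets of natural numbers, which loses no generality.
\<close>

definition coherent_topology :: "('o, 'm) cat \<Rightarrow> 'o \<Rightarrow> ('o \<times> 'm) set set" where
  "coherent_topology C B = {S. sieve C B S \<and>
     (\<forall>J. grothendieck_topology C J \<and>
          (\<forall>B'. \<forall>I :: nat set. \<forall>X f. finite I \<and> effective_epi_family C B' I X f \<longrightarrow>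
             generated_sieve C B' I X f \<in> J B')
        \<longrightarrow> S \<in> J B)}"


section \<open>Sets and sheaves of sets\<close>

text \<open>
  The sets of the universe attached to a type are, up to bijection, the sets of elements of that
  type of cardinality strictly smaller than the whole type.
\<close>

definition small :: "'a set \<Rightarrow> bool" where
  "small A \<longleftrightarrow> A \<prec> (UNIV :: 'a set)"

text \<open>
  The cardinality of the type is an infinite strong limit cardinal. For an uncountable Grothendieck
  universe the cardinality is moreover uncountable and regular; this is not demanded here. The
  condition provides small covers: if \<open>topspace X\<close> is small, so is the set of ultrafilters on it.
\<close>

definition universe :: "'a itself \<Rightarrow> bool" where
  "universe TYPE('a) \<longleftrightarrow>
     infinite (UNIV :: 'a set) \<and>
     (\<forall>A :: 'a set. small A \<longrightarrow> Pow A \<prec> (UNIV :: 'a set))"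

definition set_cat :: "('v set, 'v \<Rightarrow> 'v) cat" where
  "set_cat = \<lparr>Ob = {A. small A}, Hom = (\<lambda>A B. A \<rightarrow>\<^sub>E B), Ide = (\<lambda>A. \<lambda>x\<in>A. x),
     Comp = (\<lambda>A B C g f. compose A g f)\<rparr>"

type_synonym ('o, 'm, 'v) presheaf = "('o, 'm, 'v set, 'v \<Rightarrow> 'v) func"

type_synonym ('o, 'm, 'v) sheaf_cat = "(('o, 'm, 'v) presheaf, 'o \<Rightarrow> 'v \<Rightarrow> 'v) cat"

text \<open>
  A presheaf is a functor \<open>F : op_cat C \<rightarrow> set_cat\<close>, so restriction along \<open>g : Y \<rightarrow> B\<close> in \<open>C\<close> is
  \<open>FHom F B Y g\<close>. It is a sheaf if every matching family \<open>s\<close> on a covering sieve has a unique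
  amalgamation.
\<close>

definition is_sheaf :: "('o, 'm) cat \<Rightarrow> ('o \<Rightarrow> ('o \<times> 'm) set set) \<Rightarrow> ('o, 'm, 'v) presheaf \<Rightarrow> bool" where
  "is_sheaf C J F \<longleftrightarrow> is_functor (op_cat C) set_cat F \<and>
     (\<forall>B\<in>Ob C. \<forall>S\<in>J B. \<forall>s.
        (\<forall>(Y, g)\<in>S. s Y g \<in> FOb F Y) \<and>
        (\<forall>(Y, g)\<in>S. \<forall>Z\<in>Ob C. \<forall>h\<in>Hom C Z Y. FHom F Y Z h (s Y g) = s Z (Comp C Z Y B g h)) \<longrightarrow>
        (\<exists>!x. x \<in> FOb F B \<and> (\<forall>(Y, g)\<in>S. FHom F B Y g x = s Y g)))"

definition coherent_sheaves :: "('o, 'm) cat \<Rightarrow> ('o, 'm, 'v) sheaf_cat" where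
  "coherent_sheaves C =
     full_subcat (functor_cat (op_cat C) set_cat) (is_sheaf C (coherent_topology C))"

text \<open>For a functor \<open>K : C \<rightarrow> D\<close>, the functor \<open>F \<mapsto> F \<circ> K\<^sup>o\<^sup>p\<close> from sheaves on \<open>D\<close> to sheaves on \<open>C\<close>.\<close>

definition precomp_func :: "('o1, 'm1) cat \<Rightarrow> ('o2, 'm2) cat \<Rightarrow> ('o1, 'm1, 'o2, 'm2) func
    \<Rightarrow> (('o2, 'm2, 'v) presheaf, 'o2 \<Rightarrow> 'v \<Rightarrow> 'v, ('o1, 'm1, 'v) presheaf, 'o1 \<Rightarrow> 'v \<Rightarrow> 'v) func" where
  "precomp_func C D K = make_func (coherent_sheaves D)
     (\<lambda>F. comp_func (op_cat C) F (op_func K))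
     (\<lambda>F G \<alpha>. \<lambda>X\<in>Ob C. \<alpha> (FOb K X))"


section \<open>Compact Hausdorff, profinite and Stonean spaces\<close>

definition totally_disconnected_space :: "'a topology \<Rightarrow> bool" where
  "totally_disconnected_space X \<longleftrightarrow>
     (\<forall>x\<in>topspace X. connected_component_of_set X x = {x})"

definition extremally_disconnected_space :: "'a topology \<Rightarrow> bool" where
  "extremally_disconnected_space X \<longleftrightarrow> (\<forall>U. openin X U \<longrightarrow> openin X (X closure_of U))"

text \<open>
  The underlying set of a space is \<open>topspace X\<close>; continuous maps are normalised to be \<open>undefined\<close>
  outside it.
\<close>

definition CompHaus :: "('u topology, 'u \<Rightarrow> 'u) cat" where
  "CompHaus =
     \<lparr>Ob = {X. compact_space X \<and> Hausdorff_space X \<and> small (topspace X)},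
      Hom = (\<lambda>X Y. {f \<in> extensional (topspace X). continuous_map X Y f}),
      Ide = (\<lambda>X. \<lambda>x\<in>topspace X. x),
      Comp = (\<lambda>X Y Z g f. compose (topspace X) g f)\<rparr>"

definition Profinite :: "('u topology, 'u \<Rightarrow> 'u) cat" where
  "Profinite = full_subcat CompHaus totally_disconnected_space"

definition Stonean :: "('u topology, 'u \<Rightarrow> 'u) cat" where
  "Stonean = full_subcat CompHaus extremally_disconnected_space"

end

theory Submission
  imports Defs
begin

text \<open>
  Both inclusions are instances of one comparison. Let \<open>D\<close> be a full subcategory of compact
  Hausdorff spaces that contains all extremally disconnected ones, and suppose that finite effective
  epimorphic families in \<open>D\<close> are jointly surjective. Conversely, a finite jointly surjective family
  is a quotient map of compact Hausdorff spaces, hence effective epimorphic in \<open>D\<close>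
  (\<open>jointly_surj_imp_effective_epi\<close>). So the coherent topology of \<open>D\<close> has a concrete form: a sieve
  covers if and only if it contains a finite jointly surjective family
  (\<open>coherent_topology_eq_surj_sieves\<close>). That effective epimorphic families are jointly surjective is
  seen in two ways. If \<open>D\<close> is closed under closed subspaces, the image of the family is an object
  through which the family factors, and uniqueness makes the inclusion of the image surjective; this
  covers all compact Hausdorff spaces and the profinite ones. In an extremally disconnected space, a
  point outside the image is separated from it by a clopen set.

  The free compact Hausdorff space on a set \<open>A\<close> is the space of ultrafilters on \<open>A\<close>, the closure of
  the principal ones in a Cantor cube. It is extremally disconnected, and it is projective: a map out
  of it lifts through a continuous map as soon as the images of the points of \<open>A\<close> do. Taking \<open>A\<close> to be the
  set of points of \<open>X\<close> gives a surjection \<open>q X : S X \<rightarrow> X\<close> with \<open>S X\<close> in \<open>D\<close>. Using free spaces on the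
  preimages of the images of a family, one refines the pullback of a covering without forming fibre
  products (\<open>jointly_surj_refine\<close>).

  The rest is a comparison argument in an abstract site (locale \<open>comparison\<close>). A section over \<open>X\<close> of a
  sheaf on the large category is the same as a section over \<open>S X\<close> satisfying the descent condition
  along \<open>q X\<close>. Hence natural transformations and sheaves are determined by their restriction to \<open>D\<close>,
  and a sheaf \<open>H\<close> on \<open>D\<close> extends by taking these sections as the value at \<open>X\<close>; lifts of arrows \<open>X \<rightarrow> Y\<close>
  to arrows \<open>S X \<rightarrow> S Y\<close> make this a functor. The value at \<open>X\<close> is a subset of the value of \<open>H\<close> at
  \<open>S X\<close>, hence small. Restriction is thus fully faithful and essentially surjective, and therefore an
  equivalence.
\<close>

section \<open>Categories and equivalences\<close>

lemma category_rules:
  assumes "category C"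
  shows ide_in: "X \<in> Ob C \<Longrightarrow> Ide C X \<in> Hom C X X"
    and comp_in: "\<lbrakk>X \<in> Ob C; Y \<in> Ob C; Z \<in> Ob C; f \<in> Hom C X Y; g \<in> Hom C Y Z\<rbrakk>
      \<Longrightarrow> Comp C X Y Z g f \<in> Hom C X Z"
    and comp_ide_right: "\<lbrakk>X \<in> Ob C; Y \<in> Ob C; f \<in> Hom C X Y\<rbrakk> \<Longrightarrow> Comp C X X Y f (Ide C X) = f"
    and comp_ide_left: "\<lbrakk>X \<in> Ob C; Y \<in> Ob C; f \<in> Hom C X Y\<rbrakk> \<Longrightarrow> Comp C X Y Y (Ide C Y) f = f"
    and comp_assoc: "\<lbrakk>W \<in> Ob C; X \<in> Ob C; Y \<in> Ob C; Z \<in> Ob C;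
       f \<in> Hom C W X; g \<in> Hom C X Y; h \<in> Hom C Y Z\<rbrakk>
      \<Longrightarrow> Comp C W X Z (Comp C X Y Z h g) f = Comp C W Y Z h (Comp C W X Y g f)"
  using assms unfolding category_def by blast+

lemma categoryI:
  assumes "\<And>X. X \<in> Ob C \<Longrightarrow> Ide C X \<in> Hom C X X"
    and "\<And>X Y Z f g. \<lbrakk>X \<in> Ob C; Y \<in> Ob C; Z \<in> Ob C; f \<in> Hom C X Y; g \<in> Hom C Y Z\<rbrakk>
      \<Longrightarrow> Comp C X Y Z g f \<in> Hom C X Z"
    and "\<And>X Y f. \<lbrakk>X \<in> Ob C; Y \<in> Ob C; f \<in> Hom C X Y\<rbrakk> \<Longrightarrow> Comp C X X Y f (Ide C X) = f"
    and "\<And>X Y f. \<lbrakk>X \<in> Ob C; Y \<in> Ob C; f \<in> Hom C X Y\<rbrakk> \<Longrightarrow> Comp C X Y Y (Ide C Y) f = f"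
    and "\<And>W X Y Z f g h. \<lbrakk>W \<in> Ob C; X \<in> Ob C; Y \<in> Ob C; Z \<in> Ob C;
       f \<in> Hom C W X; g \<in> Hom C X Y; h \<in> Hom C Y Z\<rbrakk>
      \<Longrightarrow> Comp C W X Z (Comp C X Y Z h g) f = Comp C W Y Z h (Comp C W X Y g f)"
  shows "category C"
  unfolding category_def by (intro conjI ballI) (rule assms; assumption)+

lemma category_op: "category C \<Longrightarrow> category (op_cat C)"
  by (rule categoryI) (simp_all add: op_cat_def category_rules)

lemma op_cat_sel [simp]:
  "Ob (op_cat C) = Ob C" "Hom (op_cat C) X Y = Hom C Y X" "Ide (op_cat C) = Ide C"
  "Comp (op_cat C) X Y Z g f = Comp C Z Y X f g"
  by (simp_all add: op_cat_def)

lemma full_subcat_sel [simp]: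
  "Ob (full_subcat C P) = {X \<in> Ob C. P X}" "Hom (full_subcat C P) = Hom C"
  "Ide (full_subcat C P) = Ide C" "Comp (full_subcat C P) = Comp C"
  by (simp_all add: full_subcat_def)

lemma category_full_subcat: "category C \<Longrightarrow> category (full_subcat C P)"
  by (rule categoryI) (simp_all add: category_rules)

lemma small_subset: "small A \<Longrightarrow> B \<subseteq> A \<Longrightarrow> small B"
  unfolding small_def by (meson lesspoll_trans1 subset_imp_lepoll)

lemma set_cat_sel [simp]:
  "Ob set_cat = {A. small A}" "Hom set_cat A B = A \<rightarrow>\<^sub>E B" "Ide set_cat A = (\<lambda>x\<in>A. x)"
  "Comp set_cat A B C' g f = compose A g f"
  by (simp_all add: set_cat_def)

lemma category_set_cat: "category set_cat"
  by (rule categoryI)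
    (auto simp: compose_def PiE_iff restrict_def extensional_def fun_eq_iff)

lemma functor_cat_sel [simp]:
  "Ob (functor_cat C D) = {F. is_functor C D F}" "Hom (functor_cat C D) = nat_trans C D"
  "Ide (functor_cat C D) F = (\<lambda>X\<in>Ob C. Ide D (FOb F X))"
  "Comp (functor_cat C D) F G H \<beta> \<alpha> =
    (\<lambda>X\<in>Ob C. Comp D (FOb F X) (FOb G X) (FOb H X) (\<beta> X) (\<alpha> X))"
  by (simp_all add: functor_cat_def)

lemma functor_rules:
  assumes "is_functor C D F"
  shows functor_dom: "category C" and functor_cod: "category D"
    and functor_ob: "X \<in> Ob C \<Longrightarrow> FOb F X \<in> Ob D"
    and functor_hom: "\<lbrakk>X \<in> Ob C; Y \<in> Ob C; f \<in> Hom C X Y\<rbrakk>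
      \<Longrightarrow> FHom F X Y f \<in> Hom D (FOb F X) (FOb F Y)"
    and functor_ide: "X \<in> Ob C \<Longrightarrow> FHom F X X (Ide C X) = Ide D (FOb F X)"
    and functor_comp: "\<lbrakk>X \<in> Ob C; Y \<in> Ob C; Z \<in> Ob C; f \<in> Hom C X Y; g \<in> Hom C Y Z\<rbrakk> \<Longrightarrow>
        FHom F X Z (Comp C X Y Z g f) =
        Comp D (FOb F X) (FOb F Y) (FOb F Z) (FHom F Y Z g) (FHom F X Y f)"
  using assms unfolding is_functor_def by blast+

lemma make_func_sel [simp]:
  "X \<in> Ob C \<Longrightarrow> FOb (make_func C F0 F1) X = F0 X"
  "\<lbrakk>X \<in> Ob C; Y \<in> Ob C; f \<in> Hom C X Y\<rbrakk> \<Longrightarrow> FHom (make_func C F0 F1) X Y f = F1 X Y f"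
  by (simp_all add: make_func_def)

lemma is_functor_make_func:
  assumes "category C" "category D"
    and "\<And>X. X \<in> Ob C \<Longrightarrow> F0 X \<in> Ob D"
    and "\<And>X Y f. \<lbrakk>X \<in> Ob C; Y \<in> Ob C; f \<in> Hom C X Y\<rbrakk> \<Longrightarrow> F1 X Y f \<in> Hom D (F0 X) (F0 Y)"
    and "\<And>X. X \<in> Ob C \<Longrightarrow> F1 X X (Ide C X) = Ide D (F0 X)"
    and "\<And>X Y Z f g. \<lbrakk>X \<in> Ob C; Y \<in> Ob C; Z \<in> Ob C; f \<in> Hom C X Y; g \<in> Hom C Y Z\<rbrakk> \<Longrightarrow>
        F1 X Z (Comp C X Y Z g f) = Comp D (F0 X) (F0 Y) (F0 Z) (F1 Y Z g) (F1 X Y f)"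
  shows "is_functor C D (make_func C F0 F1)"
proof -
  have "make_func C (FOb (make_func C F0 F1)) (FHom (make_func C F0 F1)) = make_func C F0 F1"
    by (auto simp: make_func_def fun_eq_iff)
  then show ?thesis
    unfolding is_functor_def using assms by (simp add: category_rules)
qed

lemma is_functor_inclusion: "category C \<Longrightarrow> is_functor C C (inclusion_func C)"
  unfolding inclusion_func_def by (rule is_functor_make_func) auto

lemma inclusion_func_sel [simp]:
  "X \<in> Ob C \<Longrightarrow> FOb (inclusion_func C) X = X"
  "\<lbrakk>X \<in> Ob C; Y \<in> Ob C; f \<in> Hom C X Y\<rbrakk> \<Longrightarrow> FHom (inclusion_func C) X Y f = f"
  by (simp_all add: inclusion_func_def)

lemma comp_func_sel [simp]:
  "X \<in> Ob C \<Longrightarrow> FOb (comp_func C G F) X = FOb G (FOb F X)"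
  "\<lbrakk>X \<in> Ob C; Y \<in> Ob C; f \<in> Hom C X Y\<rbrakk>
    \<Longrightarrow> FHom (comp_func C G F) X Y f = FHom G (FOb F X) (FOb F Y) (FHom F X Y f)"
  by (simp_all add: comp_func_def)

lemma is_functor_comp:
  assumes "is_functor C D F" "is_functor D E G"
  shows "is_functor C E (comp_func C G F)"
  unfolding comp_func_def
  by (rule is_functor_make_func)
    (simp_all add: functor_rules[OF assms(1)] functor_rules[OF assms(2)])

lemma nat_trans_rules:
  assumes "\<alpha> \<in> nat_trans C D F G"
  shows nat_trans_ext: "\<alpha> \<in> extensional (Ob C)"
    and nat_trans_in: "X \<in> Ob C \<Longrightarrow> \<alpha> X \<in> Hom D (FOb F X) (FOb G X)"
    and nat_trans_nat: "\<lbrakk>X \<in> Ob C; Y \<in> Ob C; f \<in> Hom C X Y\<rbrakk> \<Longrightarrow>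
        Comp D (FOb F X) (FOb F Y) (FOb G Y) (\<alpha> Y) (FHom F X Y f) =
        Comp D (FOb F X) (FOb G X) (FOb G Y) (FHom G X Y f) (\<alpha> X)"
  using assms unfolding nat_trans_def by blast+

lemma category_functor_cat:
  assumes C: "category C" and D: "category D"
  shows "category (functor_cat C D)"
proof (rule categoryI, goal_cases)
  case (1 F)
  then show ?case
    by (auto simp: nat_trans_def functor_rules category_rules[OF D])
next
  case (2 F G H \<alpha> \<beta>)
  note F = functor_rules[of C D F] and G = functor_rules[of C D G] and H = functor_rules[of C D H]
  note a = nat_trans_rules[of \<alpha> C D F G] and b = nat_trans_rules[of \<beta> C D G H]
  have n: "Comp D (FOb F X) (FOb F Y) (FOb H Y)
          (Comp D (FOb F Y) (FOb G Y) (FOb H Y) (\<beta> Y) (\<alpha> Y)) (FHom F X Y f) =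
        Comp D (FOb F X) (FOb H X) (FOb H Y) (FHom H X Y f)
          (Comp D (FOb F X) (FOb G X) (FOb H X) (\<beta> X) (\<alpha> X))"
    if X: "X \<in> Ob C" and Y: "Y \<in> Ob C" and f: "f \<in> Hom C X Y" for X Y f
  proof -
    have "Comp D (FOb F X) (FOb F Y) (FOb H Y)
          (Comp D (FOb F Y) (FOb G Y) (FOb H Y) (\<beta> Y) (\<alpha> Y)) (FHom F X Y f)
        = Comp D (FOb F X) (FOb G Y) (FOb H Y) (\<beta> Y)
          (Comp D (FOb F X) (FOb F Y) (FOb G Y) (\<alpha> Y) (FHom F X Y f))"
      using 2 X Y f by (simp add: comp_assoc[OF D] F G H a(2) b(2))
    also have "\<dots> = Comp D (FOb F X) (FOb G X) (FOb H Y)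
          (Comp D (FOb G X) (FOb G Y) (FOb H Y) (\<beta> Y) (FHom G X Y f)) (\<alpha> X)"
      using 2 X Y f by (simp add: comp_assoc[OF D] F G H a(2,3) b(2))
    also have "\<dots> = Comp D (FOb F X) (FOb H X) (FOb H Y) (FHom H X Y f)
          (Comp D (FOb F X) (FOb G X) (FOb H X) (\<beta> X) (\<alpha> X))"
      using 2 X Y f by (simp add: comp_assoc[OF D] F G H a(2) b(2,3) flip: comp_assoc[OF D])
    finally show ?thesis .
  qed
  show ?case
    using 2 n by (auto simp: nat_trans_def[of C D F H] F G H a b comp_in[OF D])
next
  case (3 F G \<alpha>)
  then show ?case
    by (intro extensionalityI[of _ "Ob C"])
      (auto simp: functor_rules nat_trans_rules[of \<alpha> C D F G] category_rules[OF D])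
next
  case (4 F G \<alpha>)
  then show ?case
    by (intro extensionalityI[of _ "Ob C"])
      (auto simp: functor_rules nat_trans_rules[of \<alpha> C D F G] category_rules[OF D])
next
  case (5 F G H K \<alpha> \<beta> \<gamma>)
  then show ?case
    by (intro extensionalityI[of _ "Ob C"])
      (auto simp: functor_rules nat_trans_rules[of \<alpha> C D F G] nat_trans_rules[of \<beta> C D G H]
        nat_trans_rules[of \<gamma> C D H K] comp_assoc[OF D])
qed

text \<open>
  Naturality is asked of \<open>\<alpha>\<close> only: composing its naturality square with \<open>\<beta>\<close> on both sides gives the
  square of \<open>\<beta>\<close>.
\<close>

lemma isomorphic_in_functor_catI:
  assumes F: "is_functor C D F" and G: "is_functor C D G"
    and a: "\<And>X. X \<in> Ob C \<Longrightarrow> \<alpha> X \<in> Hom D (FOb F X) (FOb G X)"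
    and b: "\<And>X. X \<in> Ob C \<Longrightarrow> \<beta> X \<in> Hom D (FOb G X) (FOb F X)"
    and ba: "\<And>X. X \<in> Ob C \<Longrightarrow> Comp D (FOb F X) (FOb G X) (FOb F X) (\<beta> X) (\<alpha> X) = Ide D (FOb F X)"
    and ab: "\<And>X. X \<in> Ob C \<Longrightarrow> Comp D (FOb G X) (FOb F X) (FOb G X) (\<alpha> X) (\<beta> X) = Ide D (FOb G X)"
    and n: "\<And>X Y f. \<lbrakk>X \<in> Ob C; Y \<in> Ob C; f \<in> Hom C X Y\<rbrakk> \<Longrightarrow>
        Comp D (FOb F X) (FOb F Y) (FOb G Y) (\<alpha> Y) (FHom F X Y f) =
        Comp D (FOb F X) (FOb G X) (FOb G Y) (FHom G X Y f) (\<alpha> X)"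
  shows "isomorphic_in (functor_cat C D) F G"
proof -
  note D = category_rules[OF functor_cod[OF F]]
  note FR = functor_rules[OF F] and GR = functor_rules[OF G]
  have n': "Comp D (FOb G X) (FOb G Y) (FOb F Y) (\<beta> Y) (FHom G X Y f) =
        Comp D (FOb G X) (FOb F X) (FOb F Y) (FHom F X Y f) (\<beta> X)"
    if X: "X \<in> Ob C" and Y: "Y \<in> Ob C" and f: "f \<in> Hom C X Y" for X Y f
  proof -
    have "Comp D (FOb G X) (FOb G Y) (FOb F Y) (\<beta> Y) (FHom G X Y f) =
      Comp D (FOb G X) (FOb G Y) (FOb F Y) (\<beta> Y) (Comp D (FOb G X) (FOb G X) (FOb G Y) (FHom G X Y f)
         (Comp D (FOb G X) (FOb F X) (FOb G X) (\<alpha> X) (\<beta> X)))"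
      using X Y f by (simp add: D FR GR ab)
    also have "\<dots> = Comp D (FOb G X) (FOb G Y) (FOb F Y) (\<beta> Y) (Comp D (FOb G X) (FOb F X) (FOb G Y)
         (Comp D (FOb F X) (FOb G X) (FOb G Y) (FHom G X Y f) (\<alpha> X)) (\<beta> X))"
      using X Y f by (simp add: D FR GR a b)
    also have "\<dots> = Comp D (FOb G X) (FOb G Y) (FOb F Y) (\<beta> Y) (Comp D (FOb G X) (FOb F X) (FOb G Y)
         (Comp D (FOb F X) (FOb F Y) (FOb G Y) (\<alpha> Y) (FHom F X Y f)) (\<beta> X))"
      using X Y f by (simp add: n)
    also have "\<dots> = Comp D (FOb G X) (FOb F Y) (FOb F Y)
       (Comp D (FOb F Y) (FOb G Y) (FOb F Y) (\<beta> Y) (\<alpha> Y))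
       (Comp D (FOb G X) (FOb F X) (FOb F Y) (FHom F X Y f) (\<beta> X))"
      using X Y f by (simp add: D FR GR a b del: ba)
    also have "\<dots> = Comp D (FOb G X) (FOb F X) (FOb F Y) (FHom F X Y f) (\<beta> X)"
      using X Y f by (simp add: D FR GR ba a b)
    finally show ?thesis .
  qed
  have "restrict \<alpha> (Ob C) \<in> nat_trans C D F G" "restrict \<beta> (Ob C) \<in> nat_trans C D G F"
    using n n' by (auto simp: nat_trans_def a b)
  moreover have "(\<lambda>X\<in>Ob C. Comp D (FOb F X) (FOb G X) (FOb F X) (restrict \<beta> (Ob C) X) (restrict \<alpha> (Ob C) X))
      = (\<lambda>X\<in>Ob C. Ide D (FOb F X))"
    "(\<lambda>X\<in>Ob C. Comp D (FOb G X) (FOb F X) (FOb G X) (restrict \<alpha> (Ob C) X) (restrict \<beta> (Ob C) X))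
      = (\<lambda>X\<in>Ob C. Ide D (FOb G X))"
    by (auto simp: ba ab intro!: restrict_ext)
  ultimately show ?thesis
    unfolding isomorphic_in_def functor_cat_sel by blast
qed

text \<open>
  The quasi-inverse picks for every object \<open>Z\<close> a preimage \<open>G0 Z\<close> up to an isomorphism \<open>e Z\<close>; on
  arrows it is conjugation by \<open>e\<close> followed by the inverse of \<open>F\<close> on hom-sets.
\<close>

lemma is_equivalence_if_fully_faithful_ess_surj:
  assumes F: "is_functor C D F"
    and ff: "\<And>X Y. \<lbrakk>X \<in> Ob C; Y \<in> Ob C\<rbrakk> \<Longrightarrow>
      bij_betw (FHom F X Y) (Hom C X Y) (Hom D (FOb F X) (FOb F Y))"
    and es: "\<And>Z. Z \<in> Ob D \<Longrightarrow> \<exists>X\<in>Ob C. isomorphic_in D (FOb F X) Z"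
  shows "is_equivalence C D F"
proof -
  note D = category_rules[OF functor_cod[OF F]]
  note CR = category_rules[OF functor_dom[OF F]]
  note FR = functor_rules[OF F]
  have "\<forall>Z. \<exists>X e e'. Z \<in> Ob D \<longrightarrow> X \<in> Ob C \<and> e \<in> Hom D (FOb F X) Z \<and> e' \<in> Hom D Z (FOb F X) \<and>
     Comp D (FOb F X) Z (FOb F X) e' e = Ide D (FOb F X) \<and> Comp D Z (FOb F X) Z e e' = Ide D Z"
    using es unfolding isomorphic_in_def by meson
  then obtain G0 e e' where G0: "Z \<in> Ob D \<Longrightarrow> G0 Z \<in> Ob C"
    and e: "Z \<in> Ob D \<Longrightarrow> e Z \<in> Hom D (FOb F (G0 Z)) Z"
    and e': "Z \<in> Ob D \<Longrightarrow> e' Z \<in> Hom D Z (FOb F (G0 Z))"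
    and e'e: "Z \<in> Ob D \<Longrightarrow> Comp D (FOb F (G0 Z)) Z (FOb F (G0 Z)) (e' Z) (e Z) = Ide D (FOb F (G0 Z))"
    and ee': "Z \<in> Ob D \<Longrightarrow> Comp D Z (FOb F (G0 Z)) Z (e Z) (e' Z) = Ide D Z" for Z
    by metis
  define inv where "inv X Y = the_inv_into (Hom C X Y) (FHom F X Y)" for X Y
  have inv_in: "inv X Y h \<in> Hom C X Y" and inv_eq: "FHom F X Y (inv X Y h) = h"
    if "X \<in> Ob C" "Y \<in> Ob C" "h \<in> Hom D (FOb F X) (FOb F Y)" for X Y h
    using ff[OF that(1,2)] that(3) unfolding inv_def bij_betw_def
    by (auto intro: the_inv_into_into f_the_inv_into_f)
  have faithful: "f = g" if "X \<in> Ob C" "Y \<in> Ob C" "f \<in> Hom C X Y" "g \<in> Hom C X Y"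
    "FHom F X Y f = FHom F X Y g" for X Y f g
    using ff[OF that(1,2)] that(3-5) by (auto simp: bij_betw_def inj_on_def)
  define G1' where "G1' Z Z' h =
    Comp D (FOb F (G0 Z)) Z' (FOb F (G0 Z')) (e' Z') (Comp D (FOb F (G0 Z)) Z Z' h (e Z))" for Z Z' h
  define G1 where "G1 Z Z' h = inv (G0 Z) (G0 Z') (G1' Z Z' h)" for Z Z' h
  have G1'_in: "G1' Z Z' h \<in> Hom D (FOb F (G0 Z)) (FOb F (G0 Z'))"
    if "Z \<in> Ob D" "Z' \<in> Ob D" "h \<in> Hom D Z Z'" for Z Z' h
    using that by (simp add: G1'_def D FR G0 e e')
  have G1_in: "G1 Z Z' h \<in> Hom C (G0 Z) (G0 Z')" and FG1: "FHom F (G0 Z) (G0 Z') (G1 Z Z' h) = G1' Z Z' h"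
    if "Z \<in> Ob D" "Z' \<in> Ob D" "h \<in> Hom D Z Z'" for Z Z' h
    using that by (simp_all add: G1_def G1'_in inv_in inv_eq G0)
  have cancel: "Comp D W (FOb F (G0 Z)) Z (e Z) (Comp D W Z (FOb F (G0 Z)) (e' Z) h) = h"
    if "W \<in> Ob D" "Z \<in> Ob D" "h \<in> Hom D W Z" for W Z h
    using that by (simp add: D FR G0 e e' ee' flip: D(5))
  have eG1': "Comp D (FOb F (G0 Z)) (FOb F (G0 Z')) Z' (e Z') (G1' Z Z' h) = Comp D (FOb F (G0 Z)) Z Z' h (e Z)"
    if "Z \<in> Ob D" "Z' \<in> Ob D" "h \<in> Hom D Z Z'" for Z Z' h
    unfolding G1'_def by (rule cancel) (simp_all add: that D FR G0 e)
  have G1'_ide: "G1' Z Z (Ide D Z) = Ide D (FOb F (G0 Z))" if "Z \<in> Ob D" for Z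
    unfolding G1'_def using that by (simp add: D FR G0 e e'e)
  have G1'_comp: "G1' Z Z'' (Comp D Z Z' Z'' k h) =
      Comp D (FOb F (G0 Z)) (FOb F (G0 Z')) (FOb F (G0 Z'')) (G1' Z' Z'' k) (G1' Z Z' h)"
    if "Z \<in> Ob D" "Z' \<in> Ob D" "Z'' \<in> Ob D" "h \<in> Hom D Z Z'" "k \<in> Hom D Z' Z''" for Z Z' Z'' h k
  proof -
    have "Comp D (FOb F (G0 Z)) (FOb F (G0 Z')) (FOb F (G0 Z'')) (G1' Z' Z'' k) (G1' Z Z' h)
      = Comp D (FOb F (G0 Z)) Z'' (FOb F (G0 Z'')) (e' Z'') (Comp D (FOb F (G0 Z)) Z' Z'' k
         (Comp D (FOb F (G0 Z)) (FOb F (G0 Z')) Z' (e Z') (G1' Z Z' h)))"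
      using that by (simp add: G1'_def[of Z' Z''] D FR G0 e e' G1'_in)
    also have "\<dots> = G1' Z Z'' (Comp D Z Z' Z'' k h)"
      using that by (simp add: eG1') (simp add: G1'_def D FR G0 e e')
    finally show ?thesis by simp
  qed
  define G where "G = make_func D G0 G1"
  have G: "is_functor D C G"
    unfolding G_def
  proof (rule is_functor_make_func)
    show "G1 X X (Ide D X) = Ide C (G0 X)" if "X \<in> Ob D" for X
      by (rule faithful[of "G0 X" "G0 X"])
        (simp_all add: that G0 G1_in CR D FG1 G1'_ide FR)
    show "G1 X Z (Comp D X Y Z g f) = Comp C (G0 X) (G0 Y) (G0 Z) (G1 Y Z g) (G1 X Y f)"
      if "X \<in> Ob D" "Y \<in> Ob D" "Z \<in> Ob D" "f \<in> Hom D X Y" "g \<in> Hom D Y Z" for X Y Z f g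
      by (rule faithful[of "G0 X" "G0 Z"])
        (simp_all add: that G0 G1_in CR D FG1 G1'_comp FR)
  qed (simp_all add: functor_dom[OF F] functor_cod[OF F] G0 G1_in)
  have Gs: "FOb G Z = G0 Z" if "Z \<in> Ob D" for Z
    using that by (simp add: G_def)
  have Gs1: "FHom G Z Z' h = G1 Z Z' h" if "Z \<in> Ob D" "Z' \<in> Ob D" "h \<in> Hom D Z Z'" for Z Z' h
    using that by (simp add: G_def)
  have GF: "isomorphic_in (functor_cat C C) (comp_func C G F) (inclusion_func C)"
  proof (rule isomorphic_in_functor_catI[where
        \<alpha> = "\<lambda>X. inv (G0 (FOb F X)) X (e (FOb F X))" and \<beta> = "\<lambda>X. inv X (G0 (FOb F X)) (e' (FOb F X))"])
    show "is_functor C C (comp_func C G F)" by (rule is_functor_comp[OF F G])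
    show "is_functor C C (inclusion_func C)" by (rule is_functor_inclusion[OF functor_dom[OF F]])
    fix X assume X: "X \<in> Ob C"
    show "Comp C (FOb (comp_func C G F) X) (FOb (inclusion_func C) X) (FOb (comp_func C G F) X)
       (inv X (G0 (FOb F X)) (e' (FOb F X))) (inv (G0 (FOb F X)) X (e (FOb F X)))
       = Ide C (FOb (comp_func C G F) X)"
      by (rule faithful[of "G0 (FOb F X)" "G0 (FOb F X)"])
        (simp_all add: X CR D FR Gs G0 inv_in inv_eq e e' e'e)
    show "Comp C (FOb (inclusion_func C) X) (FOb (comp_func C G F) X) (FOb (inclusion_func C) X)
       (inv (G0 (FOb F X)) X (e (FOb F X))) (inv X (G0 (FOb F X)) (e' (FOb F X)))
       = Ide C (FOb (inclusion_func C) X)"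
      by (rule faithful[of X X])
        (simp_all add: X CR D FR Gs G0 inv_in inv_eq e e' ee')
  next
    fix X Y f assume X: "X \<in> Ob C" "Y \<in> Ob C" "f \<in> Hom C X Y"
    show "Comp C (FOb (comp_func C G F) X) (FOb (comp_func C G F) Y) (FOb (inclusion_func C) Y)
       (inv (G0 (FOb F Y)) Y (e (FOb F Y))) (FHom (comp_func C G F) X Y f)
     = Comp C (FOb (comp_func C G F) X) (FOb (inclusion_func C) X) (FOb (inclusion_func C) Y)
       (FHom (inclusion_func C) X Y f) (inv (G0 (FOb F X)) X (e (FOb F X)))"
      by (rule faithful[of "G0 (FOb F X)" Y])
        (simp_all add: X CR D FR Gs Gs1 G0 inv_in inv_eq e e' G1_in FG1 eG1')
  qed (simp_all add: CR D FR Gs G0 inv_in e e')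
  have FG: "isomorphic_in (functor_cat D D) (comp_func D F G) (inclusion_func D)"
  proof (rule isomorphic_in_functor_catI[where \<alpha> = e and \<beta> = e'])
    show "is_functor D D (comp_func D F G)" by (rule is_functor_comp[OF G F])
    show "is_functor D D (inclusion_func D)" by (rule is_functor_inclusion[OF functor_cod[OF F]])
  qed (simp_all add: CR D FR Gs Gs1 G0 e e' ee' e'e G1_in FG1 eG1')
  show ?thesis
    unfolding is_equivalence_def using F G GF FG by blast
qed

section \<open>Sheaves and covers by distinguished objects\<close>

lemma presheaf_rules:
  assumes "is_functor (op_cat C) set_cat F"
  shows presheaf_small: "X \<in> Ob C \<Longrightarrow> small (FOb F X)"
    and presheaf_fun: "\<lbrakk>Y \<in> Ob C; B \<in> Ob C; g \<in> Hom C Y B\<rbrakk> \<Longrightarrow> FHom F B Y g \<in> FOb F B \<rightarrow>\<^sub>E FOb F Y"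
    and presheaf_in: "\<lbrakk>Y \<in> Ob C; B \<in> Ob C; g \<in> Hom C Y B; x \<in> FOb F B\<rbrakk> \<Longrightarrow> FHom F B Y g x \<in> FOb F Y"
    and presheaf_ide: "\<lbrakk>X \<in> Ob C; x \<in> FOb F X\<rbrakk> \<Longrightarrow> FHom F X X (Ide C X) x = x"
    and presheaf_comp: "\<lbrakk>Z \<in> Ob C; Y \<in> Ob C; B \<in> Ob C; h \<in> Hom C Z Y; g \<in> Hom C Y B; x \<in> FOb F B\<rbrakk>
      \<Longrightarrow> FHom F B Z (Comp C Z Y B g h) x = FHom F Y Z h (FHom F B Y g x)"
proof -
  note F = functor_rules[OF assms, simplified]
  show "X \<in> Ob C \<Longrightarrow> small (FOb F X)" by (rule F)
  show 1: "\<lbrakk>Y \<in> Ob C; B \<in> Ob C; g \<in> Hom C Y B\<rbrakk> \<Longrightarrow> FHom F B Y g \<in> FOb F B \<rightarrow>\<^sub>E FOb F Y"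
    by (rule F)
  then show "\<lbrakk>Y \<in> Ob C; B \<in> Ob C; g \<in> Hom C Y B; x \<in> FOb F B\<rbrakk> \<Longrightarrow> FHom F B Y g x \<in> FOb F Y"
    by blast
  show "\<lbrakk>X \<in> Ob C; x \<in> FOb F X\<rbrakk> \<Longrightarrow> FHom F X X (Ide C X) x = x"
    by (simp add: F(5))
  show "\<lbrakk>Z \<in> Ob C; Y \<in> Ob C; B \<in> Ob C; h \<in> Hom C Z Y; g \<in> Hom C Y B; x \<in> FOb F B\<rbrakk>
      \<Longrightarrow> FHom F B Z (Comp C Z Y B g h) x = FHom F Y Z h (FHom F B Y g x)"
    by (simp add: F(6) compose_eq)
qed

lemma nat_trans_presheaf_iff:
  assumes F: "is_functor (op_cat C) set_cat F" and G: "is_functor (op_cat C) set_cat G"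
  shows "\<alpha> \<in> nat_trans (op_cat C) set_cat F G \<longleftrightarrow>
    \<alpha> \<in> extensional (Ob C) \<and> (\<forall>X\<in>Ob C. \<alpha> X \<in> FOb F X \<rightarrow>\<^sub>E FOb G X) \<and>
    (\<forall>X\<in>Ob C. \<forall>Y\<in>Ob C. \<forall>f\<in>Hom C X Y. \<forall>x\<in>FOb F Y. \<alpha> X (FHom F Y X f x) = FHom G Y X f (\<alpha> Y x))"
proof -
  have "compose (FOb F Y) (\<alpha> X) (FHom F Y X f) = compose (FOb F Y) (FHom G Y X f) (\<alpha> Y) \<longleftrightarrow>
     (\<forall>x\<in>FOb F Y. \<alpha> X (FHom F Y X f x) = FHom G Y X f (\<alpha> Y x))" for X Y f
    by (auto simp: compose_def fun_eq_iff restrict_def)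
  then show ?thesis
    unfolding nat_trans_def by auto
qed

lemma is_sheaf_presheaf: "is_sheaf C J F \<Longrightarrow> is_functor (op_cat C) set_cat F"
  by (simp add: is_sheaf_def)

lemma sieve_mem: "sieve C B R \<Longrightarrow> (Y, g) \<in> R \<Longrightarrow> Y \<in> Ob C \<and> g \<in> Hom C Y B"
  unfolding sieve_def by blast

lemma sieve_comp:
  "sieve C B R \<Longrightarrow> (Y, g) \<in> R \<Longrightarrow> Z \<in> Ob C \<Longrightarrow> h \<in> Hom C Z Y \<Longrightarrow> (Z, Comp C Z Y B g h) \<in> R"
  unfolding sieve_def by blast

lemma is_sheafD:
  assumes F: "is_sheaf C J F" and B: "B \<in> Ob C" and R: "R \<in> J B"
    and s: "\<And>Y g. (Y, g) \<in> R \<Longrightarrow> s Y g \<in> FOb F Y"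
    and m: "\<And>Y g Z h. \<lbrakk>(Y, g) \<in> R; Z \<in> Ob C; h \<in> Hom C Z Y\<rbrakk>
      \<Longrightarrow> FHom F Y Z h (s Y g) = s Z (Comp C Z Y B g h)"
  shows "\<exists>!x. x \<in> FOb F B \<and> (\<forall>(Y, g)\<in>R. FHom F B Y g x = s Y g)"
proof (rule F[unfolded is_sheaf_def, THEN conjunct2, THEN bspec, OF B, THEN bspec, OF R, THEN spec, THEN mp])
  show "(\<forall>(Y, g)\<in>R. s Y g \<in> FOb F Y) \<and>
     (\<forall>(Y, g)\<in>R. \<forall>Z\<in>Ob C. \<forall>h\<in>Hom C Z Y. FHom F Y Z h (s Y g) = s Z (Comp C Z Y B g h))"
    using s m by auto
qed

lemma sheaf_amalgamation:
  assumes "is_sheaf C J F" "B \<in> Ob C" "R \<in> J B"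
    and "\<And>Y g. (Y, g) \<in> R \<Longrightarrow> s Y g \<in> FOb F Y"
    and "\<And>Y g Z h. \<lbrakk>(Y, g) \<in> R; Z \<in> Ob C; h \<in> Hom C Z Y\<rbrakk>
      \<Longrightarrow> FHom F Y Z h (s Y g) = s Z (Comp C Z Y B g h)"
  obtains x where "x \<in> FOb F B" "\<And>Y g. (Y, g) \<in> R \<Longrightarrow> FHom F B Y g x = s Y g"
proof -
  have "\<exists>!x. x \<in> FOb F B \<and> (\<forall>(Y, g)\<in>R. FHom F B Y g x = s Y g)"
    using assms by (rule is_sheafD)
  with that show ?thesis by blast
qed

lemma sheaf_separated:
  assumes F: "is_sheaf C J F" and B: "B \<in> Ob C" and R: "R \<in> J B" "sieve C B R"
    and x: "x \<in> FOb F B" and y: "y \<in> FOb F B"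
    and eq: "\<And>Y g. (Y, g) \<in> R \<Longrightarrow> FHom F B Y g x = FHom F B Y g y"
  shows "x = y"
proof -
  let ?s = "\<lambda>Y g. FHom F B Y g x"
  note P = presheaf_rules[OF is_sheaf_presheaf[OF F]]
  have "\<exists>!x. x \<in> FOb F B \<and> (\<forall>(Y, g)\<in>R. FHom F B Y g x = ?s Y g)"
  proof (rule is_sheafD[OF F B R(1)])
    show "?s Y g \<in> FOb F Y" if "(Y, g) \<in> R" for Y g
      using sieve_mem[OF R(2) that] B x by (simp add: P)
    show "FHom F Y Z h (?s Y g) = ?s Z (Comp C Z Y B g h)"
      if "(Y, g) \<in> R" "Z \<in> Ob C" "h \<in> Hom C Z Y" for Y g Z h
      using sieve_mem[OF R(2) that(1)] that B x by (simp add: P)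
  qed
  moreover define Q where "Q w \<longleftrightarrow> w \<in> FOb F B \<and> (\<forall>(Y, g)\<in>R. FHom F B Y g w = ?s Y g)" for w
  ultimately have "\<exists>!w. Q w" by simp
  moreover have "Q x" "Q y" using x y by (auto simp: Q_def eq)
  ultimately show ?thesis by blast
qed

text \<open>
  A site in which every object \<open>X\<close> is covered by a single arrow \<open>q X : S X \<rightarrow> X\<close>. Sections over \<open>X\<close>
  of a sheaf are then the sections over \<open>S X\<close> that satisfy the descent condition.
\<close>

locale covered_site =
  fixes C :: "('o, 'm) cat" and J :: "'o \<Rightarrow> ('o \<times> 'm) set set" and S :: "'o \<Rightarrow> 'o" and q :: "'o \<Rightarrow> 'm"
  assumes cat: "category C"
    and J_sieve: "\<lbrakk>B \<in> Ob C; R \<in> J B\<rbrakk> \<Longrightarrow> sieve C B R"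
    and S_ob: "X \<in> Ob C \<Longrightarrow> S X \<in> Ob C"
    and q_in: "X \<in> Ob C \<Longrightarrow> q X \<in> Hom C (S X) X"
    and q_cover: "X \<in> Ob C \<Longrightarrow>
      {(Z, h). Z \<in> Ob C \<and> (\<exists>k\<in>Hom C Z (S X). h = Comp C Z (S X) X (q X) k)} \<in> J X"
begin

lemma sheaf_q_inj:
  assumes F: "is_sheaf C J F" and X: "X \<in> Ob C"
    and x: "x \<in> FOb F X" and y: "y \<in> FOb F X"
    and eq: "FHom F X (S X) (q X) x = FHom F X (S X) (q X) y"
  shows "x = y"
  using F X q_cover[OF X] J_sieve[OF X q_cover[OF X]] x y
proof (rule sheaf_separated)
  note P = presheaf_rules[OF is_sheaf_presheaf[OF F]]
  fix Y g assume "(Y, g) \<in> {(Z, h). Z \<in> Ob C \<and> (\<exists>k\<in>Hom C Z (S X). h = Comp C Z (S X) X (q X) k)}"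
  then show "FHom F X Y g x = FHom F X Y g y"
    using X x y eq by (auto simp: P S_ob q_in)
qed

text \<open>
  The descent condition compares two arrows \<open>Z \<rightarrow> S X\<close> that agree after \<open>q X\<close>. Since restriction along
  \<open>q Z\<close> is injective, it is enough to compare arrows that start from covers \<open>S Z\<close>; this form of the
  condition only mentions objects of the form \<open>S Z\<close>.
\<close>

lemma sheaf_descent:
  assumes F: "is_sheaf C J F" and X: "X \<in> Ob C" and a: "a \<in> FOb F (S X)"
    and eq: "\<And>Z k k'. \<lbrakk>Z \<in> Ob C; k \<in> Hom C (S Z) (S X); k' \<in> Hom C (S Z) (S X);
      Comp C (S Z) (S X) X (q X) k = Comp C (S Z) (S X) X (q X) k'\<rbrakk>
      \<Longrightarrow> FHom F (S X) (S Z) k a = FHom F (S X) (S Z) k' a"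
  obtains x where "x \<in> FOb F X" "FHom F X (S X) (q X) x = a"
proof -
  note CR = category_rules[OF cat]
  note P = presheaf_rules[OF is_sheaf_presheaf[OF F]]
  let ?R = "{(Z, h). Z \<in> Ob C \<and> (\<exists>k\<in>Hom C Z (S X). h = Comp C Z (S X) X (q X) k)}"
  define s where "s Z h = FHom F (S X) Z (SOME k. k \<in> Hom C Z (S X) \<and> h = Comp C Z (S X) X (q X) k) a"
    for Z h
  have wd: "FHom F (S X) Z k a = FHom F (S X) Z k' a"
    if Z: "Z \<in> Ob C" and k: "k \<in> Hom C Z (S X)" and k': "k' \<in> Hom C Z (S X)"
      and e: "Comp C Z (S X) X (q X) k = Comp C Z (S X) X (q X) k'" for Z k k'
  proof (rule sheaf_q_inj[OF F Z])
    have "Comp C (S Z) (S X) X (q X) (Comp C (S Z) Z (S X) k (q Z)) =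
      Comp C (S Z) (S X) X (q X) (Comp C (S Z) Z (S X) k' (q Z))"
      using e Z k k' X by (simp add: S_ob q_in flip: CR(5))
    then have "FHom F (S X) (S Z) (Comp C (S Z) Z (S X) k (q Z)) a =
      FHom F (S X) (S Z) (Comp C (S Z) Z (S X) k' (q Z)) a"
      using Z k k' X by (intro eq[of Z]) (simp_all add: CR S_ob q_in)
    then show "FHom F Z (S Z) (q Z) (FHom F (S X) Z k a) = FHom F Z (S Z) (q Z) (FHom F (S X) Z k' a)"
      using Z k k' X a by (simp add: P S_ob q_in)
  qed (use Z k k' X a in \<open>simp_all add: P S_ob\<close>)
  have s: "s Z (Comp C Z (S X) X (q X) k) = FHom F (S X) Z k a"
    if Z: "Z \<in> Ob C" and k: "k \<in> Hom C Z (S X)" for Z k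
    unfolding s_def
  proof (rule someI2)
    show "k \<in> Hom C Z (S X) \<and> Comp C Z (S X) X (q X) k = Comp C Z (S X) X (q X) k" using k by simp
  qed (elim conjE, rule wd[OF Z _ k], simp_all)
  obtain x where x: "x \<in> FOb F X" and xs: "\<And>Y g. (Y, g) \<in> ?R \<Longrightarrow> FHom F X Y g x = s Y g"
  proof (rule sheaf_amalgamation[OF F X q_cover[OF X], of s])
    show "s Y g \<in> FOb F Y" if "(Y, g) \<in> ?R" for Y g
      using that X a by (auto simp: s P S_ob)
    show "FHom F Y Z h (s Y g) = s Z (Comp C Z Y X g h)"
      if "(Y, g) \<in> ?R" "Z \<in> Ob C" "h \<in> Hom C Z Y" for Y g Z h
      using that X a by (auto simp: CR s S_ob q_in) (simp add: P S_ob s CR)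
  qed (rule that, assumption+)
  have "FHom F X (S X) (q X) x = a"
  proof -
    have I: "Ide C (S X) \<in> Hom C (S X) (S X)" "q X = Comp C (S X) (S X) X (q X) (Ide C (S X))"
      using X by (simp_all add: CR S_ob q_in)
    then have "(S X, q X) \<in> ?R" using X S_ob by blast
    then have "FHom F X (S X) (q X) x = s (S X) (q X)" by (rule xs)
    also have "\<dots> = a"
      using s[OF S_ob[OF X] I(1)] X a I(2) by (simp add: P S_ob)
    finally show ?thesis .
  qed
  with x show thesis by (rule that)
qed

end


section \<open>Comparison of sheaves on a site and on a full subcategory\<close>

text \<open>
  The condition \<open>lift\<close> is the projectivity of the objects \<open>S X\<close>, which replaces pullbacks of covers.
  The last two conditions tie the topologies together: pullbacks of coverings in \<open>C\<close> can be refined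
  by objects of \<open>D\<close>, and coverings in \<open>D\<close> generate coverings in \<open>C\<close>.
\<close>

locale comparison =
  C: covered_site C JC S q + D: covered_site "full_subcat C P" JD S q
  for C :: "('o, 'm) cat" and P JC JD S q +
  assumes S_P: "X \<in> Ob C \<Longrightarrow> P (S X)"
    and lift: "\<lbrakk>X \<in> Ob C; Y \<in> Ob C; h \<in> Hom C (S X) Y\<rbrakk>
      \<Longrightarrow> \<exists>l\<in>Hom C (S X) (S Y). Comp C (S X) (S Y) Y (q Y) l = h"
    and refine: "\<lbrakk>B \<in> Ob C; R \<in> JC B; W \<in> Ob C; P W; f \<in> Hom C W B\<rbrakk> \<Longrightarrow>
      {(V, v). V \<in> Ob C \<and> P V \<and> v \<in> Hom C V W \<and> (V, Comp C V W B f v) \<in> R} \<in> JD W"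
    and extend: "\<lbrakk>B \<in> Ob C; P B; R \<in> JD B\<rbrakk> \<Longrightarrow>
      {(Z, h). Z \<in> Ob C \<and> (\<exists>Y g k. (Y, g) \<in> R \<and> k \<in> Hom C Z Y \<and> h = Comp C Z Y B g k)} \<in> JC B"
begin

abbreviation D where "D \<equiv> full_subcat C P"

lemmas CR = category_rules[OF C.cat]
lemmas S_in = C.S_ob S_P C.q_in

definition res :: "('o, 'm, 'v) presheaf \<Rightarrow> ('o, 'm, 'v) presheaf" where
  "res F = comp_func (op_cat D) F (op_func (inclusion_func D))"

lemma res_sel:
  "\<lbrakk>X \<in> Ob C; P X\<rbrakk> \<Longrightarrow> FOb (res F) X = FOb F X"
  "\<lbrakk>X \<in> Ob C; P X; Y \<in> Ob C; P Y; f \<in> Hom C Y X\<rbrakk> \<Longrightarrow> FHom (res F) X Y f = FHom F X Y f"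
  by (simp_all add: res_def op_func_def inclusion_func_def make_func_def)

lemma is_functor_res:
  assumes "is_functor (op_cat C) set_cat F"
  shows "is_functor (op_cat D) set_cat (res F)"
  unfolding res_def comp_func_def
  by (rule is_functor_make_func)
    (simp_all add: op_func_def CR functor_rules[OF assms, simplified] category_op[OF D.cat]
      category_set_cat presheaf_fun[OF assms])

text \<open>
  A matching family on a covering in \<open>D\<close> extends to the sieve that it generates in \<open>C\<close>. The extension
  is well defined because equality of sections over \<open>Z\<close> can be tested on \<open>S Z\<close>, which lies in \<open>D\<close>,
  where the family already matches.
\<close>

lemma is_sheaf_res:
  fixes F :: "('o, 'm, 'v) presheaf"
  assumes F: "is_sheaf C JC F"
  shows "is_sheaf D JD (res F)"
  unfolding is_sheaf_def
proof (intro conjI ballI allI impI)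
  note PR = presheaf_rules[OF is_sheaf_presheaf[OF F]]
  show "is_functor (op_cat D) set_cat (res F)"
    by (rule is_functor_res[OF is_sheaf_presheaf[OF F]])
  fix B R and s :: "'o \<Rightarrow> 'm \<Rightarrow> 'v"
  assume BD: "B \<in> Ob D" and R: "R \<in> JD B"
  then have B: "B \<in> Ob C" "P B" by auto
  have mem: "Y \<in> Ob C" "P Y" "g \<in> Hom C Y B" if "(Y, g) \<in> R" for Y g
    using sieve_mem[OF D.J_sieve[OF BD R] that] by auto
  assume "(\<forall>(Y, g)\<in>R. s Y g \<in> FOb (res F) Y) \<and>
    (\<forall>(Y, g)\<in>R. \<forall>Z\<in>Ob D. \<forall>h\<in>Hom D Z Y. FHom (res F) Y Z h (s Y g) = s Z (Comp D Z Y B g h))"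
  then have s_in: "s Y g \<in> FOb F Y" and
    s_match: "\<lbrakk>Z \<in> Ob C; P Z; h \<in> Hom C Z Y\<rbrakk> \<Longrightarrow> FHom F Y Z h (s Y g) = s Z (Comp C Z Y B g h)"
    if "(Y, g) \<in> R" for Y g Z h
    using that mem[OF that] by (auto simp: res_sel dest!: bspec[of R])
  let ?R = "{(Z, h). Z \<in> Ob C \<and> (\<exists>Y g k. (Y, g) \<in> R \<and> k \<in> Hom C Z Y \<and> h = Comp C Z Y B g k)}"
  have RC: "?R \<in> JC B" by (rule extend[OF B R])
  have Rin: "(Y, g) \<in> ?R" if "(Y, g) \<in> R" for Y g
  proof -
    have "Ide C Y \<in> Hom C Y Y" "g = Comp C Y Y B g (Ide C Y)"
      using mem[OF that] B by (simp_all add: CR)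
    then show ?thesis using that mem[OF that] by blast
  qed
  have wd: "FHom F Y Z k (s Y g) = FHom F Y' Z k' (s Y' g')"
    if Z: "Z \<in> Ob C" and g: "(Y, g) \<in> R" "(Y', g') \<in> R" and k: "k \<in> Hom C Z Y" "k' \<in> Hom C Z Y'"
      and e: "Comp C Z Y B g k = Comp C Z Y' B g' k'" for Z Y g Y' g' k k'
  proof (rule C.sheaf_q_inj[OF F Z])
    have "Comp C (S Z) Y B g (Comp C (S Z) Z Y k (q Z)) = Comp C (S Z) Y' B g' (Comp C (S Z) Z Y' k' (q Z))"
      using e Z k B mem[OF g(1)] mem[OF g(2)] by (simp add: S_in flip: CR(5))
    then show "FHom F Z (S Z) (q Z) (FHom F Y Z k (s Y g)) = FHom F Z (S Z) (q Z) (FHom F Y' Z k' (s Y' g'))"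
      using Z k B g mem[OF g(1)] mem[OF g(2)]
      by (simp add: S_in CR s_in s_match flip: PR(5))
  qed (use Z k g mem s_in in \<open>simp_all add: PR\<close>)
  define s' where "s' Z h = (SOME x. \<exists>Y g k. (Y, g) \<in> R \<and> k \<in> Hom C Z Y \<and> h = Comp C Z Y B g k \<and>
    x = FHom F Y Z k (s Y g))" for Z h
  have s': "s' Z (Comp C Z Y B g k) = FHom F Y Z k (s Y g)"
    if Z: "Z \<in> Ob C" and g: "(Y, g) \<in> R" and k: "k \<in> Hom C Z Y" for Z Y g k
    unfolding s'_def
  proof (rule someI2)
    show "\<exists>Y' g' k'. (Y', g') \<in> R \<and> k' \<in> Hom C Z Y' \<and> Comp C Z Y B g k = Comp C Z Y' B g' k' \<and>
      FHom F Y Z k (s Y g) = FHom F Y' Z k' (s Y' g')"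
      using g k by blast
  qed (use wd[OF Z] g k in metis)
  obtain x where x: "x \<in> FOb F B" and xs: "\<And>Y g. (Y, g) \<in> ?R \<Longrightarrow> FHom F B Y g x = s' Y g"
  proof (rule sheaf_amalgamation[OF F B(1) RC, of s'])
    show "s' Y g \<in> FOb F Y" if "(Y, g) \<in> ?R" for Y g
      using that mem s_in by (auto simp: s' PR)
    show "FHom F Z Z' h (s' Z g) = s' Z' (Comp C Z' Z B g h)"
      if "(Z, g) \<in> ?R" "Z' \<in> Ob C" "h \<in> Hom C Z' Z" for Z g Z' h
    proof -
      obtain Y y k where Y: "(Y, y) \<in> R" "k \<in> Hom C Z Y" "g = Comp C Z Y B y k" and Z: "Z \<in> Ob C"
        using \<open>(Z, g) \<in> ?R\<close> by blast
      have "Comp C Z' Z B g h = Comp C Z' Y B y (Comp C Z' Z Y k h)"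
        using Y Z that(2,3) mem[OF Y(1)] B by (simp add: CR)
      then show ?thesis
        using Y Z that(2,3) mem[OF Y(1)] B by (simp add: s' CR PR s_in)
    qed
  qed (rule that, assumption+)
  have x_eq: "FHom F B Y g x = s Y g" if "(Y, g) \<in> R" for Y g
    using xs[OF Rin[OF that]] s'[of Y Y g "Ide C Y"] mem[OF that] that B by (simp add: CR PR s_in)
  have uniq: "y = x" if y: "y \<in> FOb F B" "\<And>Y g. (Y, g) \<in> R \<Longrightarrow> FHom F B Y g y = s Y g" for y
  proof (rule sheaf_separated[OF F B(1) RC C.J_sieve[OF B(1) RC] y(1) x])
    fix Z h assume "(Z, h) \<in> ?R"
    then obtain Y g k where "(Y, g) \<in> R" "k \<in> Hom C Z Y" "h = Comp C Z Y B g k" "Z \<in> Ob C" by blast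
    then show "FHom F B Z h y = FHom F B Z h x"
      using mem[of Y g] B x y x_eq[of Y g] by (simp add: PR)
  qed
  have r: "FOb (res F) B = FOb F B" using B by (simp add: res_sel)
  have r': "FHom (res F) B Y g = FHom F B Y g" if "(Y, g) \<in> R" for Y g
    using B mem[OF that] by (auto simp: res_sel fun_eq_iff)
  show "\<exists>!x. x \<in> FOb (res F) B \<and> (\<forall>(Y, g)\<in>R. FHom (res F) B Y g x = s Y g)"
  proof (rule ex1I[of _ x])
    show "x \<in> FOb (res F) B \<and> (\<forall>(Y, g)\<in>R. FHom (res F) B Y g x = s Y g)"
      using x x_eq by (auto simp: r r')
    show "y = x" if "y \<in> FOb (res F) B \<and> (\<forall>(Y, g)\<in>R. FHom (res F) B Y g y = s Y g)" for y
      using that by (intro uniq) (auto simp: r r')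
  qed
qed


subsection \<open>The restriction functor is fully faithful\<close>

text \<open>
  The component at \<open>X\<close> is determined by the one at \<open>S X\<close>, since restriction along \<open>q X\<close> is injective
  on the sections of \<open>G\<close>.
\<close>

lemma nat_trans_eq_if_eq_on_full_subcat:
  fixes F G :: "('o, 'm, 'v) presheaf"
  assumes F: "is_sheaf C JC F" and G: "is_sheaf C JC G"
    and a: "\<alpha> \<in> nat_trans (op_cat C) set_cat F G" and b: "\<beta> \<in> nat_trans (op_cat C) set_cat F G"
    and eq: "\<And>X. X \<in> Ob C \<Longrightarrow> P X \<Longrightarrow> \<alpha> X = \<beta> X"
  shows "\<alpha> = \<beta>"
proof -
  note FP = presheaf_rules[OF is_sheaf_presheaf[OF F]]
  note N = nat_trans_presheaf_iff[OF is_sheaf_presheaf[OF F] is_sheaf_presheaf[OF G]]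
  have a_ext: "\<alpha> \<in> extensional (Ob C)" and a_in: "\<And>X. X \<in> Ob C \<Longrightarrow> \<alpha> X \<in> FOb F X \<rightarrow>\<^sub>E FOb G X"
    and a_nat: "\<And>X Y f x. \<lbrakk>X \<in> Ob C; Y \<in> Ob C; f \<in> Hom C X Y; x \<in> FOb F Y\<rbrakk>
      \<Longrightarrow> \<alpha> X (FHom F Y X f x) = FHom G Y X f (\<alpha> Y x)"
    using a by (simp_all add: N)
  have b_ext: "\<beta> \<in> extensional (Ob C)" and b_in: "\<And>X. X \<in> Ob C \<Longrightarrow> \<beta> X \<in> FOb F X \<rightarrow>\<^sub>E FOb G X"
    and b_nat: "\<And>X Y f x. \<lbrakk>X \<in> Ob C; Y \<in> Ob C; f \<in> Hom C X Y; x \<in> FOb F Y\<rbrakk>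
      \<Longrightarrow> \<beta> X (FHom F Y X f x) = FHom G Y X f (\<beta> Y x)"
    using b by (simp_all add: N)
  show ?thesis
  proof (rule extensionalityI[OF a_ext b_ext])
    fix X assume X: "X \<in> Ob C"
    show "\<alpha> X = \<beta> X"
    proof (rule extensionalityI[of _ "FOb F X"])
      fix x assume x: "x \<in> FOb F X"
      show "\<alpha> X x = \<beta> X x"
      proof (rule C.sheaf_q_inj[OF G X])
        have "FHom G X (S X) (q X) (\<alpha> X x) = \<alpha> (S X) (FHom F X (S X) (q X) x)"
          using X x by (simp add: a_nat S_in)
        also have "\<dots> = \<beta> (S X) (FHom F X (S X) (q X) x)"
          using X by (simp add: eq S_in)
        also have "\<dots> = FHom G X (S X) (q X) (\<beta> X x)"
          using X x by (simp add: b_nat S_in)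
        finally show "FHom G X (S X) (q X) (\<alpha> X x) = FHom G X (S X) (q X) (\<beta> X x)" .
      qed (use a_in[OF X] b_in[OF X] x in auto)
    qed (use a_in[OF X] b_in[OF X] in \<open>auto simp: PiE_def\<close>)
  qed
qed

text \<open>
  Restricting a section \<open>x\<close> of \<open>F\<close> over \<open>X\<close> to \<open>S X\<close> and applying \<open>\<alpha>\<close> gives a section of \<open>G\<close> over \<open>S X\<close>
  that satisfies the descent condition, by naturality of \<open>\<alpha>\<close>; the value of the extension at \<open>x\<close> is the
  section over \<open>X\<close> to which it descends. Naturality in an arrow \<open>f\<close> follows by lifting \<open>f\<close> to the covers.
\<close>

lemma nat_trans_extends:
  fixes F G :: "('o, 'm, 'v) presheaf"
  assumes F: "is_sheaf C JC F" and G: "is_sheaf C JC G"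
    and a: "\<alpha> \<in> nat_trans (op_cat D) set_cat (res F) (res G)"
  obtains \<beta> where "\<beta> \<in> nat_trans (op_cat C) set_cat F G" "\<And>X. X \<in> Ob C \<Longrightarrow> P X \<Longrightarrow> \<beta> X = \<alpha> X"
proof -
  note FP = presheaf_rules[OF is_sheaf_presheaf[OF F]]
  note GP = presheaf_rules[OF is_sheaf_presheaf[OF G]]
  note N = nat_trans_presheaf_iff[OF is_sheaf_presheaf[OF F] is_sheaf_presheaf[OF G]]
  have a_in: "\<alpha> X \<in> FOb F X \<rightarrow>\<^sub>E FOb G X" if "X \<in> Ob C" "P X" for X
    using a that
    unfolding nat_trans_presheaf_iff[OF is_functor_res is_functor_res, OF is_sheaf_presheaf[OF F] is_sheaf_presheaf[OF G]]
    by (auto simp: res_sel)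
  have a_nat: "\<alpha> X (FHom F Y X f x) = FHom G Y X f (\<alpha> Y x)"
    if "X \<in> Ob C" "P X" "Y \<in> Ob C" "P Y" "f \<in> Hom C X Y" "x \<in> FOb F Y" for X Y f x
    using a that
    unfolding nat_trans_presheaf_iff[OF is_functor_res is_functor_res, OF is_sheaf_presheaf[OF F] is_sheaf_presheaf[OF G]]
    by (auto simp: res_sel)
  have a_in': "\<alpha> X x \<in> FOb G X" if "X \<in> Ob C" "P X" "x \<in> FOb F X" for X x
    using a_in that by blast
  have ex: "\<exists>y. y \<in> FOb G X \<and> FHom G X (S X) (q X) y = \<alpha> (S X) (FHom F X (S X) (q X) x)"
    if X: "X \<in> Ob C" and x: "x \<in> FOb F X" for X x
  proof (rule C.sheaf_descent[OF G X, of "\<alpha> (S X) (FHom F X (S X) (q X) x)"])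
    fix Z k k'
    assume Z: "Z \<in> Ob C" "k \<in> Hom C (S Z) (S X)" "k' \<in> Hom C (S Z) (S X)"
      "Comp C (S Z) (S X) X (q X) k = Comp C (S Z) (S X) X (q X) k'"
    have "FHom F (S X) (S Z) k (FHom F X (S X) (q X) x) = FHom F (S X) (S Z) k' (FHom F X (S X) (q X) x)"
      using Z X x by (simp add: S_in flip: FP(5))
    then show "FHom G (S X) (S Z) k (\<alpha> (S X) (FHom F X (S X) (q X) x)) =
      FHom G (S X) (S Z) k' (\<alpha> (S X) (FHom F X (S X) (q X) x))"
      using Z X x by (simp add: S_in FP flip: a_nat)
  qed (use X x in \<open>auto simp: S_in FP a_in'\<close>)
  then obtain b where b: "\<And>X x. \<lbrakk>X \<in> Ob C; x \<in> FOb F X\<rbrakk> \<Longrightarrow> b X x \<in> FOb G X"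
    and qb: "\<And>X x. \<lbrakk>X \<in> Ob C; x \<in> FOb F X\<rbrakk>
      \<Longrightarrow> FHom G X (S X) (q X) (b X x) = \<alpha> (S X) (FHom F X (S X) (q X) x)"
    by metis
  have b_nat: "b X (FHom F Y X f x) = FHom G Y X f (b Y x)"
    if X: "X \<in> Ob C" and Y: "Y \<in> Ob C" and f: "f \<in> Hom C X Y" and x: "x \<in> FOb F Y" for X Y f x
  proof -
    obtain l where l: "l \<in> Hom C (S X) (S Y)" "Comp C (S X) (S Y) Y (q Y) l = Comp C (S X) X Y f (q X)"
      using lift[of X Y "Comp C (S X) X Y f (q X)"] X Y f by (auto simp: CR S_in)
    show ?thesis
    proof (rule C.sheaf_q_inj[OF G X])
      have "FHom G X (S X) (q X) (b X (FHom F Y X f x)) = \<alpha> (S X) (FHom F X (S X) (q X) (FHom F Y X f x))"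
        using X Y f x by (simp add: qb FP)
      also have "FHom F X (S X) (q X) (FHom F Y X f x) = FHom F (S Y) (S X) l (FHom F Y (S Y) (q Y) x)"
        using X Y f x l by (simp add: S_in flip: FP(5))
      also have "\<alpha> (S X) \<dots> = FHom G (S Y) (S X) l (FHom G Y (S Y) (q Y) (b Y x))"
        using X Y f x l by (simp add: S_in a_nat FP qb)
      also have "\<dots> = FHom G X (S X) (q X) (FHom G Y X f (b Y x))"
        using X Y f x l b by (simp add: S_in flip: GP(5))
      finally show "FHom G X (S X) (q X) (b X (FHom F Y X f x)) = FHom G X (S X) (q X) (FHom G Y X f (b Y x))" .
    qed (use X Y f x b in \<open>auto simp: FP GP\<close>)
  qed
  have b_eq: "b X x = \<alpha> X x" if X: "X \<in> Ob C" "P X" and x: "x \<in> FOb F X" for X x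
    by (rule C.sheaf_q_inj[OF G X(1)]) (use X x in \<open>auto simp: b a_in' qb a_nat S_in\<close>)
  show thesis
  proof (rule that)
    show "(\<lambda>X\<in>Ob C. \<lambda>x\<in>FOb F X. b X x) \<in> nat_trans (op_cat C) set_cat F G"
      unfolding N using b b_nat FP by auto
    show "(\<lambda>X\<in>Ob C. \<lambda>x\<in>FOb F X. b X x) X = \<alpha> X" if "X \<in> Ob C" "P X" for X
      using that a_in[OF that] by (auto simp: fun_eq_iff b_eq PiE_def extensional_def)
  qed
qed


subsection \<open>The restriction functor is essentially surjective\<close>

text \<open>
  The descent condition along \<open>q X\<close>, read in \<open>H\<close>: it is meaningful for a presheaf on \<open>D\<close> because only
  arrows between objects \<open>S Z\<close> and \<open>S X\<close> occur, although \<open>Z\<close> and \<open>X\<close> range over \<open>C\<close>.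
\<close>

definition ext_ob :: "('o, 'm, 'v) presheaf \<Rightarrow> 'o \<Rightarrow> 'v set" where
  "ext_ob H X = {a \<in> FOb H (S X). \<forall>Z\<in>Ob C. \<forall>k\<in>Hom C (S Z) (S X). \<forall>k'\<in>Hom C (S Z) (S X).
     Comp C (S Z) (S X) X (q X) k = Comp C (S Z) (S X) X (q X) k' \<longrightarrow>
     FHom H (S X) (S Z) k a = FHom H (S X) (S Z) k' a}"

definition some_lift :: "'o \<Rightarrow> 'o \<Rightarrow> 'm \<Rightarrow> 'm" where
  "some_lift X Y f =
     (SOME l. l \<in> Hom C (S X) (S Y) \<and> Comp C (S X) (S Y) Y (q Y) l = Comp C (S X) X Y f (q X))"

definition ext :: "('o, 'm, 'v) presheaf \<Rightarrow> ('o, 'm, 'v) presheaf" where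
  "ext H = make_func (op_cat C) (ext_ob H)
     (\<lambda>Y X f. \<lambda>a\<in>ext_ob H Y. FHom H (S Y) (S X) (some_lift X Y f) a)"

lemma some_lift:
  assumes "X \<in> Ob C" "Y \<in> Ob C" "f \<in> Hom C X Y"
  shows "some_lift X Y f \<in> Hom C (S X) (S Y)"
    and "Comp C (S X) (S Y) Y (q Y) (some_lift X Y f) = Comp C (S X) X Y f (q X)"
proof -
  have "\<exists>l. l \<in> Hom C (S X) (S Y) \<and> Comp C (S X) (S Y) Y (q Y) l = Comp C (S X) X Y f (q X)"
    using lift[of X Y "Comp C (S X) X Y f (q X)"] assms by (auto simp: CR S_in)
  then have "some_lift X Y f \<in> Hom C (S X) (S Y) \<and>
      Comp C (S X) (S Y) Y (q Y) (some_lift X Y f) = Comp C (S X) X Y f (q X)"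
    unfolding some_lift_def by (rule someI_ex)
  then show "some_lift X Y f \<in> Hom C (S X) (S Y)"
    "Comp C (S X) (S Y) Y (q Y) (some_lift X Y f) = Comp C (S X) X Y f (q X)" by auto
qed

lemma ext_ob_sel: "X \<in> Ob C \<Longrightarrow> FOb (ext H) X = ext_ob H X"
  by (simp add: ext_def)

lemma ext_obD:
  assumes "a \<in> ext_ob H X"
  shows "a \<in> FOb H (S X)"
    and "\<lbrakk>Z \<in> Ob C; k \<in> Hom C (S Z) (S X); k' \<in> Hom C (S Z) (S X);
      Comp C (S Z) (S X) X (q X) k = Comp C (S Z) (S X) X (q X) k'\<rbrakk>
      \<Longrightarrow> FHom H (S X) (S Z) k a = FHom H (S X) (S Z) k' a"
  using assms unfolding ext_ob_def by blast+

text \<open>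
  Two lifts of the same arrow agree after \<open>q Y\<close>, so the descent condition of \<open>a\<close> makes the choice of
  the lift irrelevant. Functoriality comes from this freedom.
\<close>

lemma ext_hom_sel:
  assumes "X \<in> Ob C" "Y \<in> Ob C" "f \<in> Hom C X Y" "a \<in> ext_ob H Y" "l \<in> Hom C (S X) (S Y)"
    and "Comp C (S X) (S Y) Y (q Y) l = Comp C (S X) X Y f (q X)"
  shows "FHom (ext H) Y X f a = FHom H (S Y) (S X) l a"
  using assms some_lift[of X Y f] by (auto simp: ext_def intro: ext_obD(2))

context
  fixes H :: "('o, 'm, 'v) presheaf"
  assumes H: "is_sheaf D JD H"
begin

lemmas HP = presheaf_rules[OF is_sheaf_presheaf[OF H], simplified]

lemma ext_hom_in:
  assumes X: "X \<in> Ob C" and Y: "Y \<in> Ob C" and f: "f \<in> Hom C X Y" and a: "a \<in> ext_ob H Y"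
  shows "FHom (ext H) Y X f a \<in> ext_ob H X"
proof -
  note l = some_lift[OF X Y f]
  have "FHom H (S Y) (S X) (some_lift X Y f) a \<in> ext_ob H X"
    unfolding ext_ob_def
  proof (intro CollectI conjI ballI impI)
    show "FHom H (S Y) (S X) (some_lift X Y f) a \<in> FOb H (S X)"
      using X Y l ext_obD(1)[OF a] by (intro HP) (auto simp: S_in)
    fix Z k k'
    assume Z: "Z \<in> Ob C" and k: "k \<in> Hom C (S Z) (S X)" "k' \<in> Hom C (S Z) (S X)"
      and e: "Comp C (S Z) (S X) X (q X) k = Comp C (S Z) (S X) X (q X) k'"
    have "Comp C (S Z) (S X) Y (Comp C (S X) X Y f (q X)) k = Comp C (S Z) (S X) Y (Comp C (S X) X Y f (q X)) k'"
      using Z X Y f k e by (simp add: CR S_in)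
    then have "Comp C (S Z) (S Y) Y (q Y) (Comp C (S Z) (S X) (S Y) (some_lift X Y f) k) =
      Comp C (S Z) (S Y) Y (q Y) (Comp C (S Z) (S X) (S Y) (some_lift X Y f) k')"
      unfolding l(2)[symmetric] using Z X Y l(1) k by (simp add: CR S_in)
    then have "FHom H (S Y) (S Z) (Comp C (S Z) (S X) (S Y) (some_lift X Y f) k) a =
      FHom H (S Y) (S Z) (Comp C (S Z) (S X) (S Y) (some_lift X Y f) k') a"
      using Z X Y l(1) k by (intro ext_obD(2)[OF a]) (auto simp: CR S_in)
    then show "FHom H (S X) (S Z) k (FHom H (S Y) (S X) (some_lift X Y f) a) =
      FHom H (S X) (S Z) k' (FHom H (S Y) (S X) (some_lift X Y f) a)"
      using Z X Y l(1) k ext_obD(1)[OF a] by (simp add: HP S_in)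
  qed
  then show ?thesis
    using ext_hom_sel[OF X Y f a l] by simp
qed

lemma is_functor_ext: "is_functor (op_cat C) set_cat (ext H)"
  unfolding ext_def
proof (rule is_functor_make_func)
  show "category (op_cat C)" by (rule category_op[OF C.cat])
  show "category set_cat" by (rule category_set_cat)
  have sel: "FHom (ext H) Y X f = (\<lambda>a\<in>ext_ob H Y. FHom H (S Y) (S X) (some_lift X Y f) a)"
    if "X \<in> Ob C" "Y \<in> Ob C" "f \<in> Hom C X Y" for X Y f
    using that by (simp add: ext_def)
  show "ext_ob H X \<in> Ob set_cat" if "X \<in> Ob (op_cat C)" for X
  proof -
    have "small (FOb H (S X))" using that by (simp add: HP(1) S_in)
    moreover have "ext_ob H X \<subseteq> FOb H (S X)" by (auto simp: ext_ob_def)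
    ultimately show ?thesis by (simp add: small_subset)
  qed
  show "(\<lambda>a\<in>ext_ob H Y. FHom H (S Y) (S X) (some_lift X Y f) a) \<in> Hom set_cat (ext_ob H Y) (ext_ob H X)"
    if "Y \<in> Ob (op_cat C)" "X \<in> Ob (op_cat C)" "f \<in> Hom (op_cat C) Y X" for X Y f
    using that ext_hom_in[of X Y f] by (auto simp: sel)
  show "(\<lambda>a\<in>ext_ob H X. FHom H (S X) (S X) (some_lift X X (Ide (op_cat C) X)) a) = Ide set_cat (ext_ob H X)"
    if "X \<in> Ob (op_cat C)" for X
  proof -
    have X: "X \<in> Ob C" using that by simp
    have "FHom (ext H) X X (Ide C X) a = a" if a: "a \<in> ext_ob H X" for a
      using ext_hom_sel[of X X "Ide C X" a H "Ide C (S X)"] X a HP(4)[of "S X" a] ext_obD(1)[OF a]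
      by (simp add: CR S_in)
    then show ?thesis
      using X by (auto simp: CR sel fun_eq_iff)
  qed
  show "(\<lambda>a\<in>ext_ob H X. FHom H (S X) (S Z) (some_lift Z X (Comp (op_cat C) X Y Z g f)) a) =
    Comp set_cat (ext_ob H X) (ext_ob H Y) (ext_ob H Z)
      (\<lambda>a\<in>ext_ob H Y. FHom H (S Y) (S Z) (some_lift Z Y g) a)
      (\<lambda>a\<in>ext_ob H X. FHom H (S X) (S Y) (some_lift Y X f) a)"
    if "X \<in> Ob (op_cat C)" "Y \<in> Ob (op_cat C)" "Z \<in> Ob (op_cat C)"
      "f \<in> Hom (op_cat C) X Y" "g \<in> Hom (op_cat C) Y Z" for X Y Z f g
  proof -
    have X: "X \<in> Ob C" "Y \<in> Ob C" "Z \<in> Ob C" and f: "f \<in> Hom C Y X" and g: "g \<in> Hom C Z Y"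
      using that by auto
    note l = some_lift[OF X(2,1) f] and m = some_lift[OF X(3,2) g]
    let ?l = "Comp C (S Z) (S Y) (S X) (some_lift Y X f) (some_lift Z Y g)"
    have "Comp C (S Z) (S X) X (q X) ?l = Comp C (S Z) (S Y) X (Comp C (S Y) (S X) X (q X) (some_lift Y X f)) (some_lift Z Y g)"
      using X l(1) m(1) by (simp add: CR S_in)
    also have "\<dots> = Comp C (S Z) Y X f (Comp C (S Z) (S Y) Y (q Y) (some_lift Z Y g))"
      using X f m(1) by (simp only: l(2)) (simp add: CR S_in)
    also have "\<dots> = Comp C (S Z) Z X (Comp C Z Y X f g) (q Z)"
      using X f g by (simp only: m(2)) (simp add: CR S_in)
    finally have L: "Comp C (S Z) (S X) X (q X) ?l = Comp C (S Z) Z X (Comp C Z Y X f g) (q Z)" .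
    have "FHom (ext H) X Z (Comp C Z Y X f g) a = FHom (ext H) Y Z g (FHom (ext H) X Y f a)"
      if a: "a \<in> ext_ob H X" for a
    proof -
      have "FHom (ext H) X Z (Comp C Z Y X f g) a = FHom H (S X) (S Z) ?l a"
        by (rule ext_hom_sel) (use X f g a l m L in \<open>simp_all add: CR S_in\<close>)
      also have "\<dots> = FHom H (S Y) (S Z) (some_lift Z Y g) (FHom H (S X) (S Y) (some_lift Y X f) a)"
        using X l(1) m(1) ext_obD(1)[OF a] by (simp add: HP S_in)
      also have "\<dots> = FHom (ext H) Y Z g (FHom (ext H) X Y f a)"
        using X f g l m ext_hom_in[OF X(2,1) f a] by (simp add: ext_hom_sel[OF X(2,1) f a l] ext_hom_sel[OF X(3,2) g _ m])
      finally show ?thesis .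
    qed
    then have "(\<lambda>a\<in>ext_ob H X. FHom (ext H) X Z (Comp C Z Y X f g) a) =
        compose (ext_ob H X) (FHom (ext H) Y Z g) (FHom (ext H) X Y f)"
      by (auto simp: compose_def fun_eq_iff)
    then show ?thesis
      using X f g by (simp add: CR sel cong: restrict_cong)
  qed
qed

text \<open>
  Over an object of \<open>D\<close>, the sheaf \<open>H\<close> itself satisfies descent along \<open>q X\<close>; this identifies the
  restriction of \<open>ext H\<close> with \<open>H\<close>.
\<close>

lemma q_image_eq_ext_ob:
  assumes X: "X \<in> Ob C" "P X"
  shows "bij_betw (FHom H X (S X) (q X)) (FOb H X) (ext_ob H X)"
  unfolding bij_betw_def
proof (intro conjI subset_antisym subsetI)
  show "inj_on (FHom H X (S X) (q X)) (FOb H X)"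
    using D.sheaf_q_inj[OF H] X by (auto simp: inj_on_def)
  show "b \<in> ext_ob H X" if b: "b \<in> FHom H X (S X) (q X) ` FOb H X" for b
  proof -
    obtain x where x: "x \<in> FOb H X" and b: "b = FHom H X (S X) (q X) x" using b by blast
    show ?thesis
      unfolding b ext_ob_def using X x by (auto simp: HP S_in simp flip: HP(5))
  qed
  show "b \<in> FHom H X (S X) (q X) ` FOb H X" if b: "b \<in> ext_ob H X" for b
  proof (rule D.sheaf_descent[OF H, of X b])
    show "FHom H (S X) (S Z) k b = FHom H (S X) (S Z) k' b"
      if "Z \<in> Ob D" "k \<in> Hom D (S Z) (S X)" "k' \<in> Hom D (S Z) (S X)"
        "Comp D (S Z) (S X) X (q X) k = Comp D (S Z) (S X) X (q X) k'" for Z k k'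
      using that by (intro ext_obD(2)[OF b]) auto
  qed (use X ext_obD(1)[OF b] in auto)
qed

lemma ext_hom_q:
  assumes B: "B \<in> Ob C" and x: "x \<in> ext_ob H B" and W: "W \<in> Ob C" "P W" and h: "h \<in> Hom C W (S B)"
  shows "FHom (ext H) B W (Comp C W (S B) B (q B) h) x = FHom H W (S W) (q W) (FHom H (S B) W h x)"
proof -
  have "FHom (ext H) B W (Comp C W (S B) B (q B) h) x = FHom H (S B) (S W) (Comp C (S W) W (S B) h (q W)) x"
    by (rule ext_hom_sel) (use assms in \<open>simp_all add: CR S_in\<close>)
  then show ?thesis
    using assms ext_obD(1)[OF x] by (simp add: HP S_in)
qed

text \<open>
  A covering of \<open>B\<close> in \<open>C\<close> pulls back to a covering of \<open>S B\<close> in \<open>D\<close>. Under the bijections between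
  \<open>FOb H V\<close> and \<open>ext_ob H V\<close>, a matching family for \<open>ext H\<close> becomes a matching family \<open>t\<close> for \<open>H\<close>, which
  has a unique amalgamation \<open>a\<close> over \<open>S B\<close>. That \<open>a\<close> satisfies the descent condition is checked
  locally, where \<open>t\<close> depends only on the composite with \<open>q B\<close>.
\<close>

lemma is_sheaf_ext: "is_sheaf C JC (ext H)"
  unfolding is_sheaf_def
proof (intro conjI ballI allI impI)
  show "is_functor (op_cat C) set_cat (ext H)" by (rule is_functor_ext)
  note EP = presheaf_rules[OF is_functor_ext]
  fix B R and s :: "'o \<Rightarrow> 'm \<Rightarrow> 'v"
  assume B: "B \<in> Ob C" and R: "R \<in> JC B"
  note mem = sieve_mem[OF C.J_sieve[OF B R]]
  note comp = sieve_comp[OF C.J_sieve[OF B R]]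
  assume "(\<forall>(Y, g)\<in>R. s Y g \<in> FOb (ext H) Y) \<and>
    (\<forall>(Y, g)\<in>R. \<forall>Z\<in>Ob C. \<forall>h\<in>Hom C Z Y. FHom (ext H) Y Z h (s Y g) = s Z (Comp C Z Y B g h))"
  then have s_in: "s Y g \<in> ext_ob H Y" and
    s_match: "\<lbrakk>Z \<in> Ob C; h \<in> Hom C Z Y\<rbrakk> \<Longrightarrow> FHom (ext H) Y Z h (s Y g) = s Z (Comp C Z Y B g h)"
    if "(Y, g) \<in> R" for Y g Z h
    using that mem[OF that] by (auto simp: ext_ob_sel dest!: bspec[of R])
  have SB: "S B \<in> Ob C" "P (S B)" "q B \<in> Hom C (S B) B" using B by (simp_all add: S_in)
  let ?R = "{(V, v). V \<in> Ob C \<and> P V \<and> v \<in> Hom C V (S B) \<and> (V, Comp C V (S B) B (q B) v) \<in> R}"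
  have RD: "?R \<in> JD (S B)" by (rule refine[OF B R SB])
  have SBD: "S B \<in> Ob D" using SB by simp
  note RDs = D.J_sieve[OF SBD RD]
  have uniq: "x = y" if x: "x \<in> ext_ob H B" and y: "y \<in> ext_ob H B"
    and e: "\<And>Y g. (Y, g) \<in> R \<Longrightarrow> FHom (ext H) B Y g x = FHom (ext H) B Y g y" for x y
  proof (rule sheaf_separated[OF H SBD RD RDs ext_obD(1)[OF x] ext_obD(1)[OF y]])
    fix V v assume "(V, v) \<in> ?R"
    then have V: "V \<in> Ob C" "P V" "v \<in> Hom C V (S B)" "(V, Comp C V (S B) B (q B) v) \<in> R" by auto
    have VD: "V \<in> Ob D" using V by simp
    show "FHom H (S B) V v x = FHom H (S B) V v y"
      by (rule D.sheaf_q_inj[OF H VD])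
        (use e[OF V(4)] V SB ext_obD(1)[OF x] ext_obD(1)[OF y] in
          \<open>simp_all add: HP ext_hom_q[OF B x V(1,2,3)] ext_hom_q[OF B y V(1,2,3)]\<close>)
  qed
  define t where "t V v = the_inv_into (FOb H V) (FHom H V (S V) (q V)) (s V (Comp C V (S B) B (q B) v))" for V v
  have t: "t V v \<in> FOb H V" "FHom H V (S V) (q V) (t V v) = s V (Comp C V (S B) B (q B) v)"
    if V: "(V, v) \<in> ?R" for V v
  proof -
    have V: "V \<in> Ob C" "P V" "v \<in> Hom C V (S B)" "(V, Comp C V (S B) B (q B) v) \<in> R" using V by auto
    have m: "s V (Comp C V (S B) B (q B) v) \<in> FHom H V (S V) (q V) ` FOb H V"
      using q_image_eq_ext_ob[OF V(1,2)] s_in[OF V(4)] by (simp add: bij_betw_def)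
    have i: "inj_on (FHom H V (S V) (q V)) (FOb H V)"
      using q_image_eq_ext_ob[OF V(1,2)] by (simp add: bij_betw_def)
    show "t V v \<in> FOb H V" unfolding t_def by (rule the_inv_into_into[OF i m subset_refl])
    show "FHom H V (S V) (q V) (t V v) = s V (Comp C V (S B) B (q B) v)"
      unfolding t_def by (rule f_the_inv_into_f[OF i m])
  qed
  have t_match: "FHom H V W w (t V v) = t W (Comp C W V (S B) v w)"
    if Vv: "(V, v) \<in> ?R" and W: "W \<in> Ob C" "P W" "w \<in> Hom C W V" for V v W w
  proof -
    have V: "V \<in> Ob C" "P V" "v \<in> Hom C V (S B)" "(V, Comp C V (S B) B (q B) v) \<in> R" using Vv by auto
    have Wv: "(W, Comp C W V (S B) v w) \<in> ?R"
      using sieve_comp[OF RDs Vv, of W w] W by simp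
    have WD: "W \<in> Ob D" using W by simp
    obtain l where l: "l \<in> Hom C (S W) (S V)" "Comp C (S W) (S V) V (q V) l = Comp C (S W) W V w (q W)"
      using some_lift[OF W(1) V(1) W(3)] by blast
    show ?thesis
    proof (rule D.sheaf_q_inj[OF H WD])
      have "FHom H W (S W) (q W) (FHom H V W w (t V v)) = FHom H (S V) (S W) l (FHom H V (S V) (q V) (t V v))"
        using V W l t(1)[OF Vv] by (simp add: S_in flip: HP(5))
      also have "\<dots> = FHom (ext H) V W w (s V (Comp C V (S B) B (q B) v))"
        unfolding t(2)[OF Vv] by (rule ext_hom_sel[symmetric]) (use V W l s_in in simp_all)
      also have "\<dots> = FHom H W (S W) (q W) (t W (Comp C W V (S B) v w))"
        using s_match[OF V(4) W(1,3)] t(2)[OF Wv] B SB V W by (simp add: CR)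
      finally show "FHom H W (S W) (q W) (FHom H V W w (t V v)) = FHom H W (S W) (q W) (t W (Comp C W V (S B) v w))" .
    qed (use V W t[OF Vv] t[OF Wv] in \<open>simp_all add: HP\<close>)
  qed
  obtain a where a: "a \<in> FOb H (S B)" and at: "\<And>V v. (V, v) \<in> ?R \<Longrightarrow> FHom H (S B) V v a = t V v"
    by (rule sheaf_amalgamation[OF H SBD RD, of t]) (use t(1) t_match in auto)
  have a_ext: "a \<in> ext_ob H B"
    unfolding ext_ob_def
  proof (intro CollectI conjI ballI impI a)
    fix Z k k'
    assume Z: "Z \<in> Ob C" and k: "k \<in> Hom C (S Z) (S B)" "k' \<in> Hom C (S Z) (S B)"
      and e: "Comp C (S Z) (S B) B (q B) k = Comp C (S Z) (S B) B (q B) k'"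
    let ?h = "Comp C (S Z) (S B) B (q B) k"
    have SZ: "S Z \<in> Ob C" "P (S Z)" "S Z \<in> Ob D" using Z by (simp_all add: S_in)
    have h: "?h \<in> Hom C (S Z) B" using k SB SZ B by (simp add: CR)
    let ?K = "{(V, v). V \<in> Ob C \<and> P V \<and> v \<in> Hom C V (S Z) \<and> (V, Comp C V (S Z) B ?h v) \<in> R}"
    have K: "?K \<in> JD (S Z)" by (rule refine[OF B R SZ(1,2) h])
    show "FHom H (S B) (S Z) k a = FHom H (S B) (S Z) k' a"
    proof (rule sheaf_separated[OF H SZ(3) K D.J_sieve[OF SZ(3) K]])
      fix V v assume "(V, v) \<in> ?K"
      then have V: "V \<in> Ob C" "P V" "v \<in> Hom C V (S Z)" "(V, Comp C V (S Z) B ?h v) \<in> R" by auto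
      have c: "Comp C V (S Z) B ?h v = Comp C V (S B) B (q B) (Comp C V (S Z) (S B) k v)"
        using V SZ SB B k by (simp add: CR)
      have c': "Comp C V (S Z) B ?h v = Comp C V (S B) B (q B) (Comp C V (S Z) (S B) k' v)"
        unfolding e using V SZ SB B k by (simp add: CR)
      have "(V, Comp C V (S Z) (S B) k v) \<in> ?R" "(V, Comp C V (S Z) (S B) k' v) \<in> ?R"
        using V SZ SB k by (simp_all add: CR flip: c c')
      then have "FHom H (S B) V (Comp C V (S Z) (S B) k v) a = FHom H (S B) V (Comp C V (S Z) (S B) k' v) a"
        by (simp only: at t_def flip: c c')
      then show "FHom H (S Z) V v (FHom H (S B) (S Z) k a) = FHom H (S Z) V v (FHom H (S B) (S Z) k' a)"
        using V SZ SB k a by (simp add: HP)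
    qed (use SZ SB k a in \<open>simp_all add: HP\<close>)
  qed
  have a_s: "FHom (ext H) B Y g a = s Y g" if g: "(Y, g) \<in> R" for Y g
  proof -
    have Y: "Y \<in> Ob C" "g \<in> Hom C Y B" using mem[OF g] by auto
    have SY: "S Y \<in> Ob C" "P (S Y)" "q Y \<in> Hom C (S Y) Y" "S Y \<in> Ob D" using Y by (simp_all add: S_in)
    define l where "l = some_lift Y B g"
    have l: "l \<in> Hom C (S Y) (S B)" "Comp C (S Y) (S B) B (q B) l = Comp C (S Y) Y B g (q Y)"
      using some_lift[OF Y(1) B Y(2)] by (simp_all add: l_def)
    have gR: "(S Y, Comp C (S Y) Y B g (q Y)) \<in> R" by (rule comp[OF g SY(1,3)])
    then have lR: "(S Y, l) \<in> ?R" using SY l by simp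
    \<comment> \<open>Both are sections over \<open>S Y\<close>, compared over \<open>S (S Y)\<close>: there \<open>q (S Y)\<close> is a lift of \<open>q Y\<close>.\<close>
    have "t (S Y) l = s Y g"
    proof (rule D.sheaf_q_inj[OF H SY(4)])
      have "FHom H (S Y) (S (S Y)) (q (S Y)) (t (S Y) l) = FHom (ext H) Y (S Y) (q Y) (s Y g)"
        using t(2)[OF lR] s_match[OF g SY(1,3)] l by simp
      also have "\<dots> = FHom H (S Y) (S (S Y)) (q (S Y)) (s Y g)"
        by (rule ext_hom_sel) (use Y SY s_in[OF g] in \<open>simp_all add: S_in\<close>)
      finally show "FHom H (S Y) (S (S Y)) (q (S Y)) (t (S Y) l) = FHom H (S Y) (S (S Y)) (q (S Y)) (s Y g)" .
    qed (use t(1)[OF lR] ext_obD(1)[OF s_in[OF g]] in auto)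
    then show ?thesis
      using ext_hom_sel[OF Y(1) B Y(2) a_ext l] at[OF lR] by simp
  qed
  show "\<exists>!x. x \<in> FOb (ext H) B \<and> (\<forall>(Y, g)\<in>R. FHom (ext H) B Y g x = s Y g)"
  proof (rule ex1I[of _ a])
    show "a \<in> FOb (ext H) B \<and> (\<forall>(Y, g)\<in>R. FHom (ext H) B Y g a = s Y g)"
      using a_ext a_s by (auto simp: ext_ob_sel[OF B])
    show "x = a" if "x \<in> FOb (ext H) B \<and> (\<forall>(Y, g)\<in>R. FHom (ext H) B Y g x = s Y g)" for x
    proof (rule uniq[OF _ a_ext])
      show "x \<in> ext_ob H B" using that by (simp add: ext_ob_sel[OF B])
      show "FHom (ext H) B Y g x = FHom (ext H) B Y g a" if "(Y, g) \<in> R" for Y g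
        using \<open>x \<in> _ \<and> _\<close> that a_s[OF that] by auto
    qed
  qed
qed

lemma res_ext_iso: "isomorphic_in (functor_cat (op_cat D) set_cat) (res (ext H)) H"
proof (rule isomorphic_in_functor_catI[where
      \<alpha> = "\<lambda>X. \<lambda>a\<in>ext_ob H X. the_inv_into (FOb H X) (FHom H X (S X) (q X)) a" and
      \<beta> = "\<lambda>X. \<lambda>x\<in>FOb H X. FHom H X (S X) (q X) x"])
  show "is_functor (op_cat D) set_cat (res (ext H))" by (rule is_functor_res[OF is_functor_ext])
  show "is_functor (op_cat D) set_cat H" by (rule is_sheaf_presheaf[OF H])
  have sel: "FOb (res (ext H)) X = ext_ob H X" if "X \<in> Ob C" "P X" for X
    using that by (simp add: res_sel ext_ob_sel)
  note bij = q_image_eq_ext_ob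
  have inv_in: "the_inv_into (FOb H X) (FHom H X (S X) (q X)) a \<in> FOb H X"
    and f_inv: "FHom H X (S X) (q X) (the_inv_into (FOb H X) (FHom H X (S X) (q X)) a) = a"
    if "X \<in> Ob C" "P X" "a \<in> ext_ob H X" for X a
    using bij[OF that(1,2)] that(3)
    by (auto simp: bij_betw_def intro: the_inv_into_into f_the_inv_into_f)
  have inv_f: "the_inv_into (FOb H X) (FHom H X (S X) (q X)) (FHom H X (S X) (q X) x) = x"
    if "X \<in> Ob C" "P X" "x \<in> FOb H X" for X x
    using bij[OF that(1,2)] that(3) by (auto simp: bij_betw_def intro: the_inv_into_f_f)
  have f_in: "FHom H X (S X) (q X) x \<in> ext_ob H X" if "X \<in> Ob C" "P X" "x \<in> FOb H X" for X x
    using bij[OF that(1,2)] that(3) by (auto simp: bij_betw_def)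
  {
    fix X assume "X \<in> Ob (op_cat D)"
    then have X: "X \<in> Ob C" "P X" by auto
    show "(\<lambda>a\<in>ext_ob H X. the_inv_into (FOb H X) (FHom H X (S X) (q X)) a) \<in> Hom set_cat (FOb (res (ext H)) X) (FOb H X)"
      using X by (auto simp: sel inv_in)
    show "(\<lambda>x\<in>FOb H X. FHom H X (S X) (q X) x) \<in> Hom set_cat (FOb H X) (FOb (res (ext H)) X)"
      using X by (auto simp: sel f_in)
    show "Comp set_cat (FOb (res (ext H)) X) (FOb H X) (FOb (res (ext H)) X)
      (\<lambda>x\<in>FOb H X. FHom H X (S X) (q X) x) (\<lambda>a\<in>ext_ob H X. the_inv_into (FOb H X) (FHom H X (S X) (q X)) a)
      = Ide set_cat (FOb (res (ext H)) X)"
      using X by (auto simp: sel compose_def fun_eq_iff inv_in f_inv)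
    show "Comp set_cat (FOb H X) (FOb (res (ext H)) X) (FOb H X)
      (\<lambda>a\<in>ext_ob H X. the_inv_into (FOb H X) (FHom H X (S X) (q X)) a) (\<lambda>x\<in>FOb H X. FHom H X (S X) (q X) x)
      = Ide set_cat (FOb H X)"
      using X by (auto simp: sel compose_def fun_eq_iff f_in inv_f)
  }
  fix Y X f assume "Y \<in> Ob (op_cat D)" "X \<in> Ob (op_cat D)" "f \<in> Hom (op_cat D) Y X"
  then have X: "X \<in> Ob C" "P X" and Y: "Y \<in> Ob C" "P Y" and f: "f \<in> Hom C X Y" by auto
  have "the_inv_into (FOb H X) (FHom H X (S X) (q X)) (FHom (ext H) Y X f a) =
    FHom H Y X f (the_inv_into (FOb H Y) (FHom H Y (S Y) (q Y)) a)" if a: "a \<in> ext_ob H Y" for a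
  proof -
    define y where "y = the_inv_into (FOb H Y) (FHom H Y (S Y) (q Y)) a"
    have y: "y \<in> FOb H Y" "a = FHom H Y (S Y) (q Y) y"
      unfolding y_def using inv_in[OF Y a] f_inv[OF Y a] by auto
    note l = some_lift[OF X(1) Y(1) f]
    have "FHom (ext H) Y X f a = FHom H (S Y) (S X) (some_lift X Y f) a"
      by (rule ext_hom_sel[OF X(1) Y(1) f a l])
    also have "\<dots> = FHom H X (S X) (q X) (FHom H Y X f y)"
      unfolding y(2) using X Y f y(1) l by (simp add: S_in flip: HP(5))
    finally show ?thesis
      using X Y f y(1) by (simp add: inv_f HP flip: y_def)
  qed
  then show "Comp set_cat (FOb (res (ext H)) Y) (FOb (res (ext H)) X) (FOb H X)
      (\<lambda>a\<in>ext_ob H X. the_inv_into (FOb H X) (FHom H X (S X) (q X)) a) (FHom (res (ext H)) Y X f) =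
     Comp set_cat (FOb (res (ext H)) Y) (FOb H Y) (FOb H X) (FHom H Y X f)
      (\<lambda>a\<in>ext_ob H Y. the_inv_into (FOb H Y) (FHom H Y (S Y) (q Y)) a)"
    using X Y f ext_hom_in[OF X(1) Y(1) f] by (auto simp: sel res_sel ext_ob_sel compose_def fun_eq_iff)
qed

end

subsection \<open>Restriction is an equivalence\<close>

lemma restriction_is_equivalence:
  "is_equivalence
    (full_subcat (functor_cat (op_cat C) set_cat) (is_sheaf C JC) :: ('o, 'm, 'v) sheaf_cat)
    (full_subcat (functor_cat (op_cat D) set_cat) (is_sheaf D JD))
    (make_func (full_subcat (functor_cat (op_cat C) set_cat) (is_sheaf C JC))
      res (\<lambda>F G \<alpha>. \<lambda>X\<in>Ob D. \<alpha> X))"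
  (is "is_equivalence ?SC ?SD ?r")
proof (rule is_equivalence_if_fully_faithful_ess_surj)
  have restrict_in: "restrict \<alpha> (Ob D) \<in> nat_trans (op_cat D) set_cat (res F) (res G)"
    if F: "is_functor (op_cat C) set_cat F" and G: "is_functor (op_cat C) set_cat G"
    and a: "\<alpha> \<in> nat_trans (op_cat C) set_cat F G" for F G :: "('o, 'm, 'v) presheaf" and \<alpha>
    using a unfolding nat_trans_presheaf_iff[OF F G]
      nat_trans_presheaf_iff[OF is_functor_res[OF F] is_functor_res[OF G]]
    by (auto simp: res_sel presheaf_in[OF F])
  show "is_functor ?SC ?SD ?r"
  proof (rule is_functor_make_func)
    show "category ?SC"
      by (intro category_full_subcat category_functor_cat category_op C.cat category_set_cat)
    show "category ?SD"
      by (intro category_full_subcat[of "functor_cat _ _"] category_functor_cat category_op D.cat category_set_cat)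
    show "res F \<in> Ob ?SD" if "F \<in> Ob ?SC" for F
      using that is_sheaf_res[of F] is_sheaf_presheaf[OF is_sheaf_res[of F]] by auto
    show "restrict \<alpha> (Ob D) \<in> Hom ?SD (res F) (res G)"
      if "F \<in> Ob ?SC" "G \<in> Ob ?SC" "\<alpha> \<in> Hom ?SC F G" for F G \<alpha>
      using that restrict_in[of F G \<alpha>] by auto
    show "restrict (Ide ?SC F) (Ob D) = Ide ?SD (res F)" if "F \<in> Ob ?SC" for F
      by (auto simp: fun_eq_iff res_sel)
    show "restrict (Comp ?SC F G H \<beta> \<alpha>) (Ob D) = Comp ?SD (res F) (res G) (res H) (restrict \<beta> (Ob D)) (restrict \<alpha> (Ob D))"
      if "F \<in> Ob ?SC" "G \<in> Ob ?SC" "H \<in> Ob ?SC" "\<alpha> \<in> Hom ?SC F G" "\<beta> \<in> Hom ?SC G H" for F G H \<alpha> \<beta>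
      by (auto simp: fun_eq_iff res_sel)
  qed
  fix F G :: "('o, 'm, 'v) presheaf"
  assume FO: "F \<in> Ob ?SC" and GO: "G \<in> Ob ?SC"
  then have F: "is_sheaf C JC F" and G: "is_sheaf C JC G" by auto
  show "bij_betw (FHom ?r F G) (Hom ?SC F G) (Hom ?SD (FOb ?r F) (FOb ?r G))"
    unfolding bij_betw_def
  proof (intro conjI subset_antisym subsetI inj_onI)
    fix \<alpha> \<beta> assume a: "\<alpha> \<in> Hom ?SC F G" "\<beta> \<in> Hom ?SC F G" and e: "FHom ?r F G \<alpha> = FHom ?r F G \<beta>"
    have e: "restrict \<alpha> (Ob D) = restrict \<beta> (Ob D)"
      using e FO GO a by (simp only: make_func_sel)
    show "\<alpha> = \<beta>"
    proof (rule nat_trans_eq_if_eq_on_full_subcat[OF F G])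
      show "\<alpha> X = \<beta> X" if "X \<in> Ob C" "P X" for X
        using fun_cong[OF e, of X] that by simp
    qed (use a in auto)
  next
    fix \<alpha> assume "\<alpha> \<in> FHom ?r F G ` Hom ?SC F G"
    then obtain \<beta> where b: "\<beta> \<in> Hom ?SC F G" and a: "\<alpha> = FHom ?r F G \<beta>" by blast
    have "\<alpha> = restrict \<beta> (Ob D)"
      unfolding a using FO GO b by (simp only: make_func_sel)
    then show "\<alpha> \<in> Hom ?SD (FOb ?r F) (FOb ?r G)"
      using restrict_in[OF is_sheaf_presheaf[OF F] is_sheaf_presheaf[OF G], of \<beta>] b FO GO
      by (simp only: make_func_sel full_subcat_sel functor_cat_sel)
  next
    fix \<alpha> assume "\<alpha> \<in> Hom ?SD (FOb ?r F) (FOb ?r G)"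
    then have a: "\<alpha> \<in> nat_trans (op_cat D) set_cat (res F) (res G)"
      using FO GO by (simp only: make_func_sel full_subcat_sel functor_cat_sel)
    obtain \<beta> where b: "\<beta> \<in> nat_trans (op_cat C) set_cat F G" and e: "\<And>X. X \<in> Ob C \<Longrightarrow> P X \<Longrightarrow> \<beta> X = \<alpha> X"
      using nat_trans_extends[OF F G a] by blast
    have bH: "\<beta> \<in> Hom ?SC F G" using b by simp
    have "FHom ?r F G \<beta> = restrict \<beta> (Ob D)"
      using FO GO bH by (simp only: make_func_sel)
    also have "\<dots> = \<alpha>"
      using nat_trans_ext[OF a] e by (auto simp: fun_eq_iff extensional_def)
    finally show "\<alpha> \<in> FHom ?r F G ` Hom ?SC F G" using bH by blast
  qed
next
  fix H :: "('o, 'm, 'v) presheaf"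
  assume "H \<in> Ob ?SD"
  then have H: "is_sheaf D JD H" by auto
  have E: "ext H \<in> Ob ?SC" using is_sheaf_ext[OF H] is_functor_ext[OF H] by simp
  have "isomorphic_in ?SD (res (ext H)) H"
    using res_ext_iso[OF H] by (simp add: isomorphic_in_def)
  then have "isomorphic_in ?SD (FOb ?r (ext H)) H" using E by (simp only: make_func_sel)
  with E show "\<exists>F\<in>Ob ?SC. isomorphic_in ?SD (FOb ?r F) H" by blast
qed

end

section \<open>The free compact Hausdorff space on a set\<close>

text \<open>
  An ultrafilter on \<open>A\<close> is represented by its membership function on subsets of \<open>A\<close>, a point of the
  Cantor cube with one coordinate for each subset. The principal ones are dense in \<open>ultra_space A\<close> by
  definition, and compactness is that of the cube.
\<close>

definition ultra_point :: "'a set \<Rightarrow> 'a \<Rightarrow> 'a set \<Rightarrow> bool" where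
  "ultra_point A a = (\<lambda>B\<in>Pow A. a \<in> B)"

abbreviation cantor_cube :: "'a set \<Rightarrow> ('a \<Rightarrow> bool) topology" where
  "cantor_cube I \<equiv> product_topology (\<lambda>_. discrete_topology UNIV) I"

definition ultra_space :: "'a set \<Rightarrow> ('a set \<Rightarrow> bool) topology" where
  "ultra_space A = subtopology (cantor_cube (Pow A)) (cantor_cube (Pow A) closure_of (ultra_point A ` A))"

lemma topspace_ultra_space:
  "topspace (ultra_space A) = cantor_cube (Pow A) closure_of (ultra_point A ` A)"
  unfolding ultra_space_def
  by (simp add: Int_absorb1 closure_of_subset_topspace del: topspace_product_topology)

lemma ultra_point_in: "a \<in> A \<Longrightarrow> ultra_point A a \<in> topspace (ultra_space A)"
  unfolding topspace_ultra_space
  by (rule subsetD[OF closure_of_subset]) (simp_all add: image_subset_iff ultra_point_def)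

lemma compact_ultra_space: "compact_space (ultra_space A)"
proof -
  have "compact_space (cantor_cube (Pow A))"
    by (simp add: compact_space_product_topology compact_space_discrete_topology)
  then show ?thesis
    unfolding ultra_space_def
    by (intro compact_space_subtopology closedin_compact_space closedin_closure_of)
qed

lemma Hausdorff_ultra_space: "Hausdorff_space (ultra_space A)"
  unfolding ultra_space_def
  by (intro Hausdorff_space_subtopology)
    (auto simp: Hausdorff_space_product_topology Hausdorff_space_discrete_topology)

lemma ultra_space_dense:
  assumes "openin (ultra_space A) T" "p \<in> T"
  shows "\<exists>a\<in>A. ultra_point A a \<in> T"
proof -
  obtain U where U: "openin (cantor_cube (Pow A)) U"
    "T = U \<inter> cantor_cube (Pow A) closure_of (ultra_point A ` A)"
    using assms(1) by (auto simp: ultra_space_def openin_subtopology)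
  then have "p \<in> U" "p \<in> cantor_cube (Pow A) closure_of (ultra_point A ` A)" using assms(2) by auto
  then obtain y where "y \<in> ultra_point A ` A" "y \<in> U"
    using U(1) unfolding in_closure_of by metis
  then show ?thesis
    using U(2) ultra_point_in[of _ A] by (auto simp: topspace_ultra_space)
qed

text \<open>
  A basic open set of the cube prescribes finitely many coordinates. Every use of an ultrafilter
  property is an instance with suitable coordinates \<open>\<F>\<close>.
\<close>

lemma ultra_space_finite:
  assumes p: "p \<in> topspace (ultra_space A)" and fin: "finite \<F>" and sub: "\<F> \<subseteq> Pow A"
  shows "\<exists>a\<in>A. \<forall>B\<in>\<F>. p B \<longleftrightarrow> a \<in> B"
proof -
  let ?U = "\<Pi>\<^sub>E B\<in>Pow A. if B \<in> \<F> then {p B} else UNIV"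
  have "finite {B \<in> Pow A. (if B \<in> \<F> then {p B} else UNIV) \<noteq> UNIV}"
    by (rule finite_subset[OF _ fin]) auto
  then have "openin (cantor_cube (Pow A)) ?U"
    by (simp add: openin_PiE_gen)
  moreover have "p \<in> ?U"
    using p closure_of_subset_topspace[of "cantor_cube (Pow A)"]
    by (fastforce simp: topspace_ultra_space PiE_iff)
  ultimately obtain y where "y \<in> ultra_point A ` A" "y \<in> ?U"
    using p unfolding topspace_ultra_space in_closure_of by blast
  then obtain a where a: "a \<in> A" "ultra_point A a \<in> ?U" by blast
  have "p B \<longleftrightarrow> a \<in> B" if "B \<in> \<F>" for B
    using PiE_mem[OF a(2), of B] that sub by (auto simp: ultra_point_def)
  then show ?thesis using a(1) by blast
qed

lemma ultra_space_clopen: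
  assumes "B \<subseteq> A"
  shows "openin (ultra_space A) {p \<in> topspace (ultra_space A). p B}"
    and "closedin (ultra_space A) {p \<in> topspace (ultra_space A). p B}"
proof -
  have c: "continuous_map (ultra_space A) (discrete_topology UNIV) (\<lambda>p. p B)"
    unfolding ultra_space_def
    by (rule continuous_map_from_subtopology, rule continuous_map_product_projection) (use assms in simp)
  show "openin (ultra_space A) {p \<in> topspace (ultra_space A). p B}"
    using openin_continuous_map_preimage[OF c, of "{True}"] by simp
  show "closedin (ultra_space A) {p \<in> topspace (ultra_space A). p B}"
    using closedin_continuous_map_preimage[OF c, of "{True}"] by simp
qed

text \<open>
  By density, the closure of an open set \<open>U\<close> depends only on the set \<open>B\<close> of points of \<open>A\<close> in \<open>U\<close>; it is
  the clopen set of ultrafilters that contain \<open>B\<close>.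
\<close>

lemma extremally_disconnected_ultra_space: "extremally_disconnected_space (ultra_space A)"
  unfolding extremally_disconnected_space_def
proof (intro allI impI)
  fix U assume U: "openin (ultra_space A) U"
  define B where "B = {a \<in> A. ultra_point A a \<in> U}"
  have B: "B \<subseteq> A" by (auto simp: B_def)
  let ?B = "{p \<in> topspace (ultra_space A). p B}"
  have pt: "ultra_point A a B \<longleftrightarrow> ultra_point A a \<in> U" if "a \<in> A" for a
    using that B by (simp add: ultra_point_def B_def)
  have "U \<subseteq> ?B"
  proof
    fix p assume p: "p \<in> U"
    show "p \<in> ?B"
    proof (rule ccontr)
      assume "p \<notin> ?B"
      moreover have "openin (ultra_space A) (U - ?B)"
        using U ultra_space_clopen(2)[OF B] by (rule openin_diff)
      ultimately obtain a where "a \<in> A" "ultra_point A a \<in> U - ?B"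
        using ultra_space_dense[of A "U - ?B" p] p by blast
      then show False using pt ultra_point_in[of _ A] by auto
    qed
  qed
  then have 1: "ultra_space A closure_of U \<subseteq> ?B"
    by (rule closure_of_minimal[OF _ ultra_space_clopen(2)[OF B]])
  have 2: "?B \<subseteq> ultra_space A closure_of U"
  proof
    fix p assume p: "p \<in> ?B"
    have "\<exists>y. y \<in> U \<and> y \<in> T" if T: "p \<in> T" "openin (ultra_space A) T" for T
    proof -
      have "openin (ultra_space A) (T \<inter> ?B)"
        using T ultra_space_clopen(1)[OF B] by auto
      then obtain a where "a \<in> A" "ultra_point A a \<in> T \<inter> ?B"
        using ultra_space_dense[of A "T \<inter> ?B" p] p T by blast
      then show ?thesis using pt by auto
    qed
    then show "p \<in> ultra_space A closure_of U"
      using p by (auto simp: in_closure_of)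
  qed
  show "openin (ultra_space A) (ultra_space A closure_of U)"
    using 1 2 ultra_space_clopen(1)[OF B] by (simp add: subset_antisym)
qed

text \<open>
  The extension sends an ultrafilter to the limit of its image: a limit exists by compactness, is
  unique by the Hausdorff property, and depends continuously on the ultrafilter because a compact
  Hausdorff space is regular.
\<close>

lemma ultra_space_extension:
  fixes A :: "'a set" and X :: "'b topology"
  assumes X: "compact_space X" "Hausdorff_space X" and \<phi>: "\<phi> \<in> A \<rightarrow> topspace X"
  shows "\<exists>g. continuous_map (ultra_space A) X g \<and> (\<forall>a\<in>A. g (ultra_point A a) = \<phi> a)"
proof -
  define lim where "lim p x \<longleftrightarrow> x \<in> topspace X \<and> (\<forall>V. openin X V \<and> x \<in> V \<longrightarrow> p {a \<in> A. \<phi> a \<in> V})"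
    for p :: "'a set \<Rightarrow> bool" and x
  \<comment> \<open>Two members of an ultrafilter meet.\<close>
  have meet: "\<exists>a\<in>A. \<phi> a \<in> V \<and> \<phi> a \<in> W"
    if "p \<in> topspace (ultra_space A)" "p {a \<in> A. \<phi> a \<in> V}" "p {a \<in> A. \<phi> a \<in> W}" for p V W
    using ultra_space_finite[of p A "{{a \<in> A. \<phi> a \<in> V}, {a \<in> A. \<phi> a \<in> W}}"] that by auto
  have ex: "\<exists>x. lim p x" if p: "p \<in> topspace (ultra_space A)" for p
  proof (rule ccontr)
    assume "\<nexists>x. lim p x"
    then have "\<forall>x\<in>topspace X. \<exists>V. openin X V \<and> x \<in> V \<and> \<not> p {a \<in> A. \<phi> a \<in> V}"
      unfolding lim_def by blast
    then obtain V where V: "\<And>x. x \<in> topspace X \<Longrightarrow> openin X (V x) \<and> x \<in> V x \<and> \<not> p {a \<in> A. \<phi> a \<in> V x}"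
      by metis
    obtain \<F> where F: "finite \<F>" "\<F> \<subseteq> V ` topspace X" "topspace X \<subseteq> \<Union>\<F>"
      using X(1)[unfolded compact_space_alt, rule_format, of "V ` topspace X"] V by blast
    let ?G = "(\<lambda>W. {a \<in> A. \<phi> a \<in> W}) ` \<F>"
    obtain a where a: "a \<in> A" "\<forall>B\<in>?G. p B \<longleftrightarrow> a \<in> B"
      using ultra_space_finite[OF p, of ?G] F(1) by blast
    obtain W where W: "W \<in> \<F>" "\<phi> a \<in> W" using F(3) \<phi> a(1) by blast
    then have "p {a \<in> A. \<phi> a \<in> W}" using a by auto
    then show False using W(1) F(2) V by blast
  qed
  have uniq: "x = y" if p: "p \<in> topspace (ultra_space A)" and l: "lim p x" "lim p y" for p x y
  proof (rule ccontr)
    assume "x \<noteq> y"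
    moreover have "x \<in> topspace X" "y \<in> topspace X" using l by (simp_all add: lim_def)
    ultimately obtain V W where V: "openin X V" "openin X W" "x \<in> V" "y \<in> W" and d: "disjnt V W"
      using X(2) unfolding Hausdorff_space_def by metis
    have "p {a \<in> A. \<phi> a \<in> V}" "p {a \<in> A. \<phi> a \<in> W}" using V l by (simp_all add: lim_def)
    then show False using meet[OF p, of V W] d by (auto simp: disjnt_iff)
  qed
  define g where "g p = (SOME x. lim p x)" for p
  have g: "lim p (g p)" if "p \<in> topspace (ultra_space A)" for p
    unfolding g_def by (rule someI_ex[OF ex[OF that]])
  have in_X: "g p \<in> topspace X" if "p \<in> topspace (ultra_space A)" for p
    using g[OF that] by (simp add: lim_def)
  have "continuous_map (ultra_space A) X g"
    unfolding continuous_map_eq_topcontinuous_at topcontinuous_at_def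
  proof (intro ballI conjI allI impI)
    show "g \<in> topspace (ultra_space A) \<rightarrow> topspace X" using in_X by blast
    fix p W assume p: "p \<in> topspace (ultra_space A)" and W: "openin X W \<and> g p \<in> W"
    have "neighbourhood_base_of (closedin X) X"
      using compact_Hausdorff_imp_regular_space[OF X] by (simp add: neighbourhood_base_of_closedin)
    then obtain V K where V: "openin X V" "closedin X K" "g p \<in> V" "V \<subseteq> K" "K \<subseteq> W"
      using W unfolding neighbourhood_base_of by meson
    let ?U = "{p' \<in> topspace (ultra_space A). p' {a \<in> A. \<phi> a \<in> V}}"
    have "openin (ultra_space A) ?U" by (rule ultra_space_clopen) auto
    moreover have "p \<in> ?U" using g[OF p] p V by (auto simp: lim_def)
    moreover have "g p' \<in> W" if p': "p' \<in> ?U" for p'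
    proof (rule ccontr)
      assume "g p' \<notin> W"
      then have "g p' \<in> topspace X - K" using V in_X p' by auto
      moreover have "openin X (topspace X - K)" using V(2) by blast
      ultimately have "p' {a \<in> A. \<phi> a \<in> topspace X - K}" using g[of p'] p' by (auto simp: lim_def)
      then show False using meet[of p' V "topspace X - K"] p' V(4) by blast
    qed
    ultimately show "\<exists>U. openin (ultra_space A) U \<and> p \<in> U \<and> (\<forall>y\<in>U. g y \<in> W)" by blast
  qed
  moreover have "g (ultra_point A a) = \<phi> a" if a: "a \<in> A" for a
  proof (rule uniq[OF ultra_point_in[OF a] g[OF ultra_point_in[OF a]]])
    show "lim (ultra_point A a) (\<phi> a)" using a \<phi> by (auto simp: lim_def ultra_point_def)
  qed
  ultimately show ?thesis by blast
qed

subsection \<open>Transport to the universe\<close>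

lemma homeomorphic_copy:
  assumes i: "inj_on i (topspace X)"
  obtains Y where "homeomorphic_map X Y i" "topspace Y = i ` topspace X"
proof -
  let ?j = "inv_into (topspace X) i"
  let ?Y = "pullback_topology (i ` topspace X) ?j X"
  have ts: "topspace ?Y = i ` topspace X"
    using i by (auto simp: topspace_pullback_topology)
  have "homeomorphic_maps X ?Y i ?j"
    unfolding homeomorphic_maps_def
  proof (intro conjI ballI)
    show "continuous_map X ?Y i"
      unfolding continuous_map_alt
    proof (intro conjI allI impI)
      show "i \<in> topspace X \<rightarrow> topspace ?Y" by (simp add: ts)
      fix U assume "openin ?Y U"
      then obtain V where V: "openin X V" "U = ?j -` V \<inter> i ` topspace X"
        by (auto simp: openin_pullback_topology)
      have "i -` U \<inter> topspace X = V"
        using V(2) openin_subset[OF V(1)] i by (auto dest: inj_onD)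
      then show "openin X (i -` U \<inter> topspace X)" using V(1) by simp
    qed
    show "continuous_map ?Y X ?j"
      unfolding continuous_map_alt ts openin_pullback_topology
      using i by auto
  qed (use i in \<open>auto simp: ts f_inv_into_f\<close>)
  then have "homeomorphic_map X ?Y i" using homeomorphic_maps_map by blast
  then show thesis using ts by (rule that)
qed

lemma extremally_disconnected_homeomorphic:
  assumes f: "homeomorphic_map X Y f" and X: "extremally_disconnected_space X"
  shows "extremally_disconnected_space Y"
  unfolding extremally_disconnected_space_def
proof (intro allI impI)
  fix U assume U: "openin Y U"
  define V where "V = {x \<in> topspace X. f x \<in> U}"
  have V: "openin X V"
    unfolding V_def
    by (rule openin_continuous_map_preimage[OF homeomorphic_imp_continuous_map[OF f] U])
  have "U = f ` V"
    using homeomorphic_imp_surjective_map[OF f] openin_subset[OF U] by (auto simp: V_def)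
  then have "Y closure_of U = f ` (X closure_of V)"
    using homeomorphic_map_closure_of[OF f openin_subset[OF V]] by simp
  moreover have "openin X (X closure_of V)"
    using X V by (simp add: extremally_disconnected_space_def)
  ultimately show "openin Y (Y closure_of U)"
    using homeomorphic_map_openness_eq[OF f] by metis
qed

text \<open>
  The universal property is restricted to targets on the same type, which are the ones that occur in
  \<open>CompHaus\<close>. Uniqueness of the extension is expressed by density of the image of the unit \<open>\<eta>\<close>.
\<close>

definition free_comphaus :: "'u set \<Rightarrow> 'u topology \<Rightarrow> ('u \<Rightarrow> 'u) \<Rightarrow> bool" where
  "free_comphaus A Y \<eta> \<longleftrightarrow>
     compact_space Y \<and> Hausdorff_space Y \<and> extremally_disconnected_space Y \<and> small (topspace Y) \<and>
     \<eta> \<in> A \<rightarrow> topspace Y \<and> Y closure_of (\<eta> ` A) = topspace Y \<and>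
     (\<forall>(X :: 'u topology) \<phi>. compact_space X \<and> Hausdorff_space X \<and> \<phi> \<in> A \<rightarrow> topspace X \<longrightarrow>
        (\<exists>g. continuous_map Y X g \<and> (\<forall>a\<in>A. g (\<eta> a) = \<phi> a)))"

lemma free_comphausD:
  assumes "free_comphaus A Y \<eta>"
  shows "compact_space Y" "Hausdorff_space Y" "extremally_disconnected_space Y" "small (topspace Y)"
    "a \<in> A \<Longrightarrow> \<eta> a \<in> topspace Y" "Y closure_of (\<eta> ` A) = topspace Y"
  using assms unfolding free_comphaus_def by blast+

lemma free_comphaus_extend:
  fixes A :: "'u set" and X :: "'u topology"
  assumes "free_comphaus A Y \<eta>" "compact_space X" "Hausdorff_space X"
    and "\<And>a. a \<in> A \<Longrightarrow> \<phi> a \<in> topspace X"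
  obtains g where "continuous_map Y X g" "\<And>a. a \<in> A \<Longrightarrow> g (\<eta> a) = \<phi> a"
proof -
  have "\<phi> \<in> A \<rightarrow> topspace X" using assms(4) by blast
  show thesis
  proof -
    have ext: "\<forall>(X :: 'u topology) \<phi>. compact_space X \<and> Hausdorff_space X \<and> \<phi> \<in> A \<rightarrow> topspace X \<longrightarrow>
        (\<exists>g. continuous_map Y X g \<and> (\<forall>a\<in>A. g (\<eta> a) = \<phi> a))"
      using assms(1) unfolding free_comphaus_def by (elim conjE)
    have "\<exists>g. continuous_map Y X g \<and> (\<forall>a\<in>A. g (\<eta> a) = \<phi> a)"
      by (rule ext[THEN spec[of _ X], THEN spec[of _ \<phi>], THEN mp]) (intro conjI assms(2,3) \<open>\<phi> \<in> _\<close>)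
    then show thesis using that by blast
  qed
qed

text \<open>
  The strong limit condition concerns subsets of the type itself, so the power set of \<open>A\<close> is first
  copied into the type.
\<close>

lemma small_double_powerset:
  assumes u: "universe TYPE('u)" and A: "small (A :: 'u set)"
  shows "Pow (Pow A) \<prec> (UNIV :: 'u set)"
proof -
  have P: "Pow A \<prec> (UNIV :: 'u set)" using u A by (simp add: universe_def)
  then obtain f :: "'u set \<Rightarrow> 'u" where f: "inj_on f (Pow A)"
    by (auto simp: lesspoll_def lepoll_def)
  have eq: "f ` Pow A \<approx> Pow A" using f by (rule inj_on_image_eqpoll_self)
  then have "small (f ` Pow A)"
    unfolding small_def using P lesspoll_trans1[OF eqpoll_imp_lepoll] by blast
  then have "Pow (f ` Pow A) \<prec> (UNIV :: 'u set)" using u by (simp add: universe_def)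
  moreover have "Pow (Pow A) \<lesssim> Pow (f ` Pow A)"
  proof -
    have "inj_on ((`) f) (Pow (Pow A))" using f by (rule inj_on_image_Pow)
    then show ?thesis unfolding lepoll_def by blast
  qed
  ultimately show ?thesis by (rule lesspoll_trans1[rotated])
qed

lemma free_comphaus_exists:
  assumes u: "universe TYPE('u)" and A: "small (A :: 'u set)"
  shows "\<exists>Y \<eta>. free_comphaus A Y \<eta>"
proof -
  let ?T = "topspace (ultra_space A)"
  have "?T \<subseteq> Pow A \<rightarrow>\<^sub>E UNIV"
    using closure_of_subset_topspace[of "cantor_cube (Pow A)"] by (auto simp: topspace_ultra_space)
  then have "inj_on (\<lambda>p. {B \<in> Pow A. p B}) ?T"
  proof (intro inj_onI)
    fix p p' assume "p \<in> ?T" "p' \<in> ?T" and e: "{B \<in> Pow A. p B} = {B \<in> Pow A. p' B}"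
    then have "p \<in> Pow A \<rightarrow>\<^sub>E UNIV" "p' \<in> Pow A \<rightarrow>\<^sub>E UNIV" using \<open>?T \<subseteq> _\<close> by blast+
    moreover have "p B = p' B" if "B \<in> Pow A" for B using e that by blast
    ultimately show "p = p'" by (rule PiE_ext)
  qed
  moreover have "(\<lambda>p. {B \<in> Pow A. p B}) ` ?T \<subseteq> Pow (Pow A)" by blast
  ultimately have "?T \<lesssim> Pow (Pow A)" unfolding lepoll_def by blast
  then have T: "?T \<prec> (UNIV :: 'u set)"
    using small_double_powerset[OF u A] by (rule lesspoll_trans1)
  then obtain i :: "_ \<Rightarrow> 'u" where i: "inj_on i ?T" by (auto simp: lesspoll_def lepoll_def)
  then obtain Y where Y: "homeomorphic_map (ultra_space A) Y i" "topspace Y = i ` ?T"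
    by (rule homeomorphic_copy)
  have hs: "ultra_space A homeomorphic_space Y"
    using Y(1) by (rule homeomorphic_map_imp_homeomorphic_space)
  obtain j where j: "homeomorphic_maps (ultra_space A) Y i j"
    using Y(1) homeomorphic_map_maps by blast
  have "free_comphaus A Y (i \<circ> ultra_point A)"
    unfolding free_comphaus_def
  proof (intro conjI allI impI)
    show "compact_space Y" using compact_ultra_space homeomorphic_compact_space[OF hs] by blast
    show "Hausdorff_space Y" using Hausdorff_ultra_space homeomorphic_Hausdorff_space[OF hs] by blast
    show "extremally_disconnected_space Y"
      using Y(1) extremally_disconnected_ultra_space by (rule extremally_disconnected_homeomorphic)
    have "i ` ?T \<approx> ?T" using i by (rule inj_on_image_eqpoll_self)
    then show "small (topspace Y)"
      unfolding small_def Y(2) using T lesspoll_trans1[OF eqpoll_imp_lepoll] by blast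
    show "i \<circ> ultra_point A \<in> A \<rightarrow> topspace Y" using ultra_point_in[of _ A] by (auto simp: Y(2))
    have "p \<in> ultra_space A closure_of (ultra_point A ` A)" if "p \<in> ?T" for p
      unfolding in_closure_of using ultra_space_dense[of A _ p] that by blast
    then have "ultra_space A closure_of (ultra_point A ` A) = ?T"
      by (intro subset_antisym closure_of_subset_topspace subsetI)
    then show "Y closure_of ((i \<circ> ultra_point A) ` A) = topspace Y"
      using homeomorphic_map_closure_of[OF Y(1), of "ultra_point A ` A"] ultra_point_in[of _ A]
      by (simp add: Y(2) image_comp image_subset_iff)
    fix X :: "'u topology" and \<phi>
    assume X: "compact_space X \<and> Hausdorff_space X \<and> \<phi> \<in> A \<rightarrow> topspace X"
    then obtain g where g: "continuous_map (ultra_space A) X g" "\<forall>a\<in>A. g (ultra_point A a) = \<phi> a"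
      using ultra_space_extension by metis
    have "continuous_map Y X (g \<circ> j)"
      using j g(1) by (auto simp: homeomorphic_maps_def intro: continuous_map_compose)
    moreover have "\<forall>a\<in>A. (g \<circ> j) ((i \<circ> ultra_point A) a) = \<phi> a"
      using j g(2) ultra_point_in[of _ A] by (auto simp: homeomorphic_maps_def)
    ultimately show "\<exists>g. continuous_map Y X g \<and> (\<forall>a\<in>A. g ((i \<circ> ultra_point A) a) = \<phi> a)" by blast
  qed
  then show ?thesis by blast
qed

lemma free_comphaus_unique:
  assumes Y: "free_comphaus A Y \<eta>" and Z: "Hausdorff_space Z"
    and f: "continuous_map Y Z f" and g: "continuous_map Y Z g"
    and eq: "\<And>a. a \<in> A \<Longrightarrow> f (\<eta> a) = g (\<eta> a)" and y: "y \<in> topspace Y"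
  shows "f y = g y"
proof (rule forall_in_closure_of_eq[OF _ Z f g])
  show "y \<in> Y closure_of (\<eta> ` A)" using Y y by (simp add: free_comphausD)
qed (use eq in auto)

section \<open>Compact Hausdorff spaces\<close>

lemma CompHaus_sel [simp]:
  "X \<in> Ob CompHaus \<longleftrightarrow> compact_space X \<and> Hausdorff_space X \<and> small (topspace X)"
  "f \<in> Hom CompHaus X Y \<longleftrightarrow> f \<in> extensional (topspace X) \<and> continuous_map X Y f"
  "Ide CompHaus X = (\<lambda>x\<in>topspace X. x)"
  "Comp CompHaus X Y Z g f = compose (topspace X) g f"
  by (simp_all add: CompHaus_def)

lemma CompHaus_restrict_in:
  "continuous_map X Y f \<Longrightarrow> restrict f (topspace X) \<in> Hom CompHaus X Y"
  by (auto intro: continuous_map_eq)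

lemma category_CompHaus: "category CompHaus"
proof (rule categoryI, goal_cases)
  case (1 X)
  then show ?case by (auto intro: continuous_map_eq[OF continuous_map_id])
next
  case (2 X Y Z f g)
  then show ?case
    by (auto simp: compose_def intro: continuous_map_eq[OF continuous_map_compose])
next
  case (3 X Y f)
  then show ?case by (auto simp: compose_def extensional_def fun_eq_iff)
next
  case (4 X Y f)
  then have "f \<in> topspace X \<rightarrow> topspace Y" using continuous_map_funspace by auto
  with 4 show ?case by (auto simp: compose_def extensional_def fun_eq_iff)
next
  case (5 W X Y Z f g h)
  then have "f \<in> topspace W \<rightarrow> topspace X" using continuous_map_funspace by auto
  then show ?case by (auto simp: compose_def fun_eq_iff)
qed

lemma small_finite: "universe TYPE('u) \<Longrightarrow> finite (A :: 'u set) \<Longrightarrow> small A"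
  by (simp add: universe_def small_def finite_lesspoll_infinite)

text \<open>
  Projectivity: the values at the generators are lifted by choice, and the two maps \<open>p \<circ> k\<close> and \<open>h\<close>
  agree everywhere because they agree on the generators.
\<close>

lemma free_comphaus_lift:
  assumes V: "free_comphaus A V \<eta>" and Y: "Y \<in> Ob CompHaus" and Z: "Z \<in> Ob CompHaus"
    and p: "continuous_map Y Z p" and h: "continuous_map V Z h"
    and A: "\<And>a. a \<in> A \<Longrightarrow> h (\<eta> a) \<in> p ` topspace Y"
  obtains k where "k \<in> Hom CompHaus V Y" "\<And>x. x \<in> topspace V \<Longrightarrow> p (k x) = h x"
proof -
  have "\<forall>a. \<exists>y. a \<in> A \<longrightarrow> y \<in> topspace Y \<and> p y = h (\<eta> a)" using A by force
  then obtain \<phi> where \<phi>: "\<And>a. a \<in> A \<Longrightarrow> \<phi> a \<in> topspace Y \<and> p (\<phi> a) = h (\<eta> a)" by metis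
  obtain g where g: "continuous_map V Y g" "\<And>a. a \<in> A \<Longrightarrow> g (\<eta> a) = \<phi> a"
    by (rule free_comphaus_extend[OF V, of Y \<phi>]) (use Y \<phi> in auto)
  have "p (g x) = h x" if x: "x \<in> topspace V" for x
    using free_comphaus_unique[OF V, of Z "p \<circ> g" h x] Z continuous_map_compose[OF g(1) p] h x \<phi> g(2)
    by simp
  then show thesis
    using CompHaus_restrict_in[OF g(1)] by (intro that[of "restrict g (topspace V)"]) auto
qed

text \<open>
  The surjection that extends the identity of \<open>X\<close> to the free compact Hausdorff space on the points of
  \<open>X\<close>. It serves as the projective cover \<open>q X : S X \<rightarrow> X\<close> of the comparison argument.
\<close>

definition cover_pair :: "'u topology \<Rightarrow> 'u topology \<Rightarrow> ('u \<Rightarrow> 'u) \<Rightarrow> bool" where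
  "cover_pair X S q \<longleftrightarrow> (\<exists>\<eta>. free_comphaus (topspace X) S \<eta> \<and>
     q \<in> Hom CompHaus S X \<and> (\<forall>x\<in>topspace X. q (\<eta> x) = x))"

lemma cover_pair_exists:
  assumes u: "universe TYPE('u)" and X: "X \<in> Ob (CompHaus :: ('u topology, 'u \<Rightarrow> 'u) cat)"
  shows "\<exists>S q. cover_pair X S q"
proof -
  obtain S \<eta> where S: "free_comphaus (topspace X) S \<eta>"
    using free_comphaus_exists[OF u, of "topspace X"] X by auto
  obtain g where g: "continuous_map S X g" "\<And>x. x \<in> topspace X \<Longrightarrow> g (\<eta> x) = x"
    by (rule free_comphaus_extend[OF S, of X "\<lambda>x. x"]) (use X in auto)
  have "cover_pair X S (restrict g (topspace S))"
    unfolding cover_pair_def using S CompHaus_restrict_in[OF g(1)] g(2) by (intro exI[of _ \<eta>]) (auto simp: free_comphausD)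
  then show ?thesis by blast
qed

lemma cover_pairD:
  assumes "cover_pair X S q"
  shows "S \<in> Ob CompHaus" "extremally_disconnected_space S" "q \<in> Hom CompHaus S X"
    "topspace X \<subseteq> q ` topspace S"
proof -
  obtain \<eta> where e: "free_comphaus (topspace X) S \<eta>" "q \<in> Hom CompHaus S X" "\<forall>x\<in>topspace X. q (\<eta> x) = x"
    using assms by (auto simp: cover_pair_def)
  then show "S \<in> Ob CompHaus" "extremally_disconnected_space S" "q \<in> Hom CompHaus S X"
    by (auto simp: free_comphausD)
  show "topspace X \<subseteq> q ` topspace S"
  proof
    fix x assume "x \<in> topspace X"
    then have "x = q (\<eta> x)" "\<eta> x \<in> topspace S" using e by (auto simp: free_comphausD)
    then show "x \<in> q ` topspace S" by blast
  qed
qed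

lemma cover_pair_lift:
  assumes X: "cover_pair X S q" and Y: "cover_pair Y S' q'" and YO: "Y \<in> Ob CompHaus"
    and h: "h \<in> Hom CompHaus S Y"
  shows "\<exists>l\<in>Hom CompHaus S S'. Comp CompHaus S S' Y q' l = h"
proof -
  obtain \<eta> where e: "free_comphaus (topspace X) S \<eta>" using X by (auto simp: cover_pair_def)
  note Yd = cover_pairD[OF Y]
  have hY: "h (\<eta> a) \<in> topspace Y" if "a \<in> topspace X" for a
    using e h that continuous_map_funspace[of S Y h] by (auto simp: free_comphausD)
  obtain k where k: "k \<in> Hom CompHaus S S'" "\<And>x. x \<in> topspace S \<Longrightarrow> q' (k x) = h x"
    by (rule free_comphaus_lift[OF e Yd(1) YO, of q' h]) (use Yd h hY in auto)
  have "Comp CompHaus S S' Y q' k = h"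
    using k(2) h by (auto simp: compose_def extensional_def fun_eq_iff)
  then show ?thesis using k(1) by blast
qed

section \<open>Finite jointly surjective families\<close>

definition jointly_surj :: "'u topology \<Rightarrow> ('u topology \<times> ('u \<Rightarrow> 'u)) set \<Rightarrow> bool" where
  "jointly_surj B F \<longleftrightarrow> finite F \<and> topspace B \<subseteq> (\<Union>(Y, g)\<in>F. g ` topspace Y)"

text \<open>
  Pullback stability without fibre products: the points of \<open>B'\<close> over the image of \<open>g\<close> generate a free
  compact Hausdorff space, and the composite of its map to \<open>B'\<close> with \<open>f\<close> lifts through \<open>g\<close>.
\<close>

lemma jointly_surj_refine:
  fixes B B' :: "'u topology"
  assumes u: "universe TYPE('u)" and F: "jointly_surj B F"
    and Fin: "\<And>Y g. (Y, g) \<in> F \<Longrightarrow> Y \<in> Ob CompHaus \<and> g \<in> Hom CompHaus Y B"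
    and B: "B \<in> Ob CompHaus" and B': "B' \<in> Ob CompHaus" and f: "f \<in> Hom CompHaus B' B"
  obtains F' where "jointly_surj B' F'"
    "\<And>V v. (V, v) \<in> F' \<Longrightarrow> V \<in> Ob CompHaus \<and> extremally_disconnected_space V \<and> v \<in> Hom CompHaus V B' \<and>
      (\<exists>Y g k. (Y, g) \<in> F \<and> k \<in> Hom CompHaus V Y \<and> Comp CompHaus V B' B f v = Comp CompHaus V Y B g k)"
proof -
  define Q where "Q z V v \<longleftrightarrow> V \<in> Ob CompHaus \<and> extremally_disconnected_space V \<and> v \<in> Hom CompHaus V B' \<and>
     {b \<in> topspace B'. f b \<in> snd z ` topspace (fst z)} \<subseteq> v ` topspace V \<and>
     (\<exists>k\<in>Hom CompHaus V (fst z). Comp CompHaus V B' B f v = Comp CompHaus V (fst z) B (snd z) k)"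
    for z V v
  have "\<exists>V v. Q z V v"
    if z: "z \<in> F" for z
  proof -
    obtain Y g where z_eq: "z = (Y, g)" by (cases z)
    have Y: "Y \<in> Ob CompHaus" "g \<in> Hom CompHaus Y B" using Fin z z_eq by auto
    let ?A = "{b \<in> topspace B'. f b \<in> g ` topspace Y}"
    have "small ?A" using B' by (auto intro: small_subset)
    then obtain V \<eta> where V: "free_comphaus ?A V \<eta>" using free_comphaus_exists[OF u] by blast
    obtain v where v: "continuous_map V B' v" "\<And>a. a \<in> ?A \<Longrightarrow> v (\<eta> a) = a"
      by (rule free_comphaus_extend[OF V, of B' "\<lambda>x. x"]) (use B' in auto)
    have fv: "continuous_map V B (f \<circ> v)" using v(1) f by (auto intro: continuous_map_compose)
    obtain k where k: "k \<in> Hom CompHaus V Y" "\<And>x. x \<in> topspace V \<Longrightarrow> g (k x) = (f \<circ> v) x"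
      by (rule free_comphaus_lift[OF V Y(1) B _ fv, of g]) (use Y v(2) in auto)
    have "Comp CompHaus V B' B f (restrict v (topspace V)) = Comp CompHaus V Y B g k"
      using k(2) by (auto simp: compose_def fun_eq_iff)
    moreover have "?A \<subseteq> restrict v (topspace V) ` topspace V"
    proof
      fix a assume a: "a \<in> ?A"
      then have "\<eta> a \<in> topspace V" "a = restrict v (topspace V) (\<eta> a)"
        using v(2)[OF a] free_comphausD(5)[OF V a] by auto
      then show "a \<in> restrict v (topspace V) ` topspace V" by blast
    qed
    moreover have "V \<in> Ob CompHaus" "extremally_disconnected_space V" using V by (auto simp: free_comphausD)
    ultimately show ?thesis
      using CompHaus_restrict_in[OF v(1)] k(1) unfolding Q_def z_eq fst_conv snd_conv by blast
  qed
  then obtain V v where V: "\<And>z. z \<in> F \<Longrightarrow> Q z (V z) (v z)" by metis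
  note V = V[unfolded Q_def]
  let ?F' = "(\<lambda>z. (V z, v z)) ` F"
  have surj: "topspace B' \<subseteq> (\<Union>(Y, g)\<in>?F'. g ` topspace Y)"
  proof
    fix b assume b: "b \<in> topspace B'"
    then have "f b \<in> topspace B" using f continuous_map_funspace[of B' B f] by auto
    then obtain z where z: "z \<in> F" "f b \<in> snd z ` topspace (fst z)"
      using F unfolding jointly_surj_def by force
    then have "b \<in> v z ` topspace (V z)" using V[OF z(1)] b by blast
    then show "b \<in> (\<Union>(Y, g)\<in>?F'. g ` topspace Y)" using z(1) by auto
  qed
  show thesis
  proof (rule that)
    show "jointly_surj B' ?F'" using surj F by (simp add: jointly_surj_def)
    fix W w assume "(W, w) \<in> ?F'"
    then obtain z where z: "z \<in> F" and W: "W = V z" "w = v z" by auto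
    obtain k where "k \<in> Hom CompHaus W (fst z)"
      "Comp CompHaus W B' B f w = Comp CompHaus W (fst z) B (snd z) k"
      using V[OF z] unfolding W by blast
    moreover have "(fst z, snd z) \<in> F" using z by simp
    moreover have "W \<in> Ob CompHaus" "extremally_disconnected_space W" "w \<in> Hom CompHaus W B'"
      unfolding W using V[OF z, THEN conjunct1] V[OF z, THEN conjunct2, THEN conjunct1]
        V[OF z, THEN conjunct2, THEN conjunct2, THEN conjunct1] by blast+
    ultimately show "W \<in> Ob CompHaus \<and> extremally_disconnected_space W \<and> w \<in> Hom CompHaus W B' \<and>
      (\<exists>Y g k. (Y, g) \<in> F \<and> k \<in> Hom CompHaus W Y \<and> Comp CompHaus W B' B f w = Comp CompHaus W Y B g k)"
      by (intro conjI exI[of _ "fst z"] exI[of _ "snd z"] exI[of _ k])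
  qed
qed

section \<open>The coherent topology by finite jointly surjective families\<close>

lemma sieveI:
  assumes "\<And>Y g. (Y, g) \<in> R \<Longrightarrow> Y \<in> Ob C \<and> g \<in> Hom C Y B"
    and "\<And>Y g Z h. \<lbrakk>(Y, g) \<in> R; Z \<in> Ob C; h \<in> Hom C Z Y\<rbrakk> \<Longrightarrow> (Z, Comp C Z Y B g h) \<in> R"
  shows "sieve C B R"
  using assms unfolding sieve_def by blast

lemma sieve_maximal: "category C \<Longrightarrow> B \<in> Ob C \<Longrightarrow> sieve C B (maximal_sieve C B)"
  by (rule sieveI) (auto simp: maximal_sieve_def comp_in)

lemma sieve_generated:
  assumes C: "category C" and B: "B \<in> Ob C" and X: "\<And>i. i \<in> I \<Longrightarrow> X i \<in> Ob C \<and> f i \<in> Hom C (X i) B"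
  shows "sieve C B (generated_sieve C B I X f)"
proof (rule sieveI)
  fix Y g Z h assume g: "(Y, g) \<in> generated_sieve C B I X f" and h: "Z \<in> Ob C" "h \<in> Hom C Z Y"
  then obtain i k where i: "i \<in> I" "k \<in> Hom C Y (X i)" "g = Comp C Y (X i) B (f i) k" and Y: "Y \<in> Ob C"
    by (auto simp: generated_sieve_def)
  have "Comp C Z Y B g h = Comp C Z (X i) B (f i) (Comp C Z Y (X i) k h)"
    "Comp C Z Y (X i) k h \<in> Hom C Z (X i)"
    using i X[OF i(1)] Y h B by (simp_all add: category_rules[OF C])
  then show "(Z, Comp C Z Y B g h) \<in> generated_sieve C B I X f"
    using i(1) h(1) unfolding generated_sieve_def by blast
qed (use X B in \<open>auto simp: generated_sieve_def category_rules[OF C]\<close>)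

definition surj_sieves :: "('u topology \<Rightarrow> bool) \<Rightarrow> 'u topology \<Rightarrow> ('u topology \<times> ('u \<Rightarrow> 'u)) set set" where
  "surj_sieves P B = {R. sieve (full_subcat CompHaus P) B R \<and> (\<exists>F\<subseteq>R. jointly_surj B F)}"

lemma surj_sievesI:
  "\<lbrakk>sieve (full_subcat CompHaus P) B R; F \<subseteq> R; jointly_surj B F\<rbrakk> \<Longrightarrow> R \<in> surj_sieves P B"
  unfolding surj_sieves_def by blast

lemma surj_sievesD:
  assumes "R \<in> surj_sieves P B"
  shows "sieve (full_subcat CompHaus P) B R"
    and "(Y, g) \<in> R \<Longrightarrow> Y \<in> Ob CompHaus" "(Y, g) \<in> R \<Longrightarrow> P Y" "(Y, g) \<in> R \<Longrightarrow> g \<in> Hom CompHaus Y B"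
proof -
  show s: "sieve (full_subcat CompHaus P) B R" using assms by (simp add: surj_sieves_def)
  show "(Y, g) \<in> R \<Longrightarrow> Y \<in> Ob CompHaus" "(Y, g) \<in> R \<Longrightarrow> P Y" "(Y, g) \<in> R \<Longrightarrow> g \<in> Hom CompHaus Y B"
    using sieve_mem[OF s] unfolding full_subcat_sel by blast+
qed

lemma category_CompHaus_sub: "category (full_subcat CompHaus P)"
  by (rule category_full_subcat[OF category_CompHaus])

lemma jointly_surj_comp:
  assumes F: "jointly_surj B F" and G: "\<And>Y g. (Y, g) \<in> F \<Longrightarrow> jointly_surj Y (G Y g)"
  shows "jointly_surj B (\<Union>(Y, g)\<in>F. (\<lambda>(Z, h). (Z, Comp CompHaus Z Y B g h)) ` G Y g)"
  unfolding jointly_surj_def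
proof (intro conjI subsetI)
  show "finite (\<Union>(Y, g)\<in>F. (\<lambda>(Z, h). (Z, Comp CompHaus Z Y B g h)) ` G Y g)"
    using F G by (auto simp: jointly_surj_def)
  fix b assume "b \<in> topspace B"
  then obtain Y g y where Y: "(Y, g) \<in> F" "y \<in> topspace Y" "b = g y"
    using F by (auto simp: jointly_surj_def)
  then obtain Z h z where Z: "(Z, h) \<in> G Y g" "z \<in> topspace Z" "y = h z"
    using G[OF Y(1)] by (auto simp: jointly_surj_def)
  have "b = Comp CompHaus Z Y B g h z" using Y Z by (simp add: compose_eq)
  then have "b \<in> Comp CompHaus Z Y B g h ` topspace Z" using Z(2) by (rule image_eqI)
  moreover have "(Z, Comp CompHaus Z Y B g h) \<in> (\<lambda>(Z, h). (Z, Comp CompHaus Z Y B g h)) ` G Y g"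
    using Z(1) by (rule rev_image_eqI) simp
  ultimately show "b \<in> (\<Union>(Y, g)\<in>(\<Union>(Y, g)\<in>F. (\<lambda>(Z, h). (Z, Comp CompHaus Z Y B g h)) ` G Y g). g ` topspace Y)"
    using Y(1) by blast
qed

text \<open>
  This yields both the pullback stability of the topology on one subcategory, with \<open>P' = P\<close>, and the
  refinement of coverings among all compact Hausdorff spaces by objects of the subcategory, with \<open>P'\<close>
  everywhere true.
\<close>

lemma surj_sieves_refine:
  fixes B :: "'u topology"
  assumes u: "universe TYPE('u)" and ED: "\<And>X. X \<in> Ob CompHaus \<Longrightarrow> extremally_disconnected_space X \<Longrightarrow> P X"
    and R: "R \<in> surj_sieves P' B" and PP': "\<And>X. P X \<Longrightarrow> P' X"
    and B: "B \<in> Ob CompHaus" and W: "W \<in> Ob CompHaus" and f: "f \<in> Hom CompHaus W B"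
  shows "{(V, v). V \<in> Ob CompHaus \<and> P V \<and> v \<in> Hom CompHaus V W \<and> (V, Comp CompHaus V W B f v) \<in> R} \<in> surj_sieves P W"
    (is "?R \<in> _")
proof -
  note C = category_rules[OF category_CompHaus]
  have s: "sieve (full_subcat CompHaus P') B R" by (rule surj_sievesD[OF R])
  obtain F where F: "F \<subseteq> R" "jointly_surj B F" using R by (auto simp: surj_sieves_def)
  obtain F' where F': "jointly_surj W F'"
    "\<And>V v. (V, v) \<in> F' \<Longrightarrow> V \<in> Ob CompHaus \<and> extremally_disconnected_space V \<and> v \<in> Hom CompHaus V W \<and>
      (\<exists>Y g k. (Y, g) \<in> F \<and> k \<in> Hom CompHaus V Y \<and> Comp CompHaus V W B f v = Comp CompHaus V Y B g k)"
    by (rule jointly_surj_refine[OF u F(2) _ B W f]) (use surj_sievesD[OF R] F(1) in blast)+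
  have "F' \<subseteq> ?R"
  proof (intro subsetI, clarify)
    fix V v assume v: "(V, v) \<in> F'"
    then obtain Y g k where Y: "(Y, g) \<in> F" "k \<in> Hom CompHaus V Y" "Comp CompHaus V W B f v = Comp CompHaus V Y B g k"
      using F'(2) by blast
    have V: "V \<in> Ob CompHaus" "extremally_disconnected_space V" "v \<in> Hom CompHaus V W" using F'(2)[OF v] by blast+
    then have "(V, Comp CompHaus V Y B g k) \<in> R"
      using sieve_comp[OF s, of Y g V k] Y F(1) PP'[OF ED[of V]] by auto
    then show "V \<in> Ob CompHaus \<and> P V \<and> v \<in> Hom CompHaus V W \<and> (V, Comp CompHaus V W B f v) \<in> R"
      using V ED[OF V(1,2)] unfolding Y(3) by blast
  qed
  moreover have "sieve (full_subcat CompHaus P) W ?R"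
  proof (rule sieveI)
    fix Y g Z h assume g: "(Y, g) \<in> ?R" and "Z \<in> Ob (full_subcat CompHaus P)" "h \<in> Hom (full_subcat CompHaus P) Z Y"
    then have Z: "Z \<in> Ob CompHaus" "P Z" "h \<in> Hom CompHaus Z Y" by auto
    have Y: "Y \<in> Ob CompHaus" "g \<in> Hom CompHaus Y W" "(Y, Comp CompHaus Y W B f g) \<in> R" using g by blast+
    have "(Z, Comp CompHaus Z Y B (Comp CompHaus Y W B f g) h) \<in> R"
      using sieve_comp[OF s Y(3), of Z h] Z PP' by auto
    then have "(Z, Comp CompHaus Z W B f (Comp CompHaus Z Y W g h)) \<in> R"
      using C(5)[OF Z(1) Y(1) W B Z(3) Y(2) f] by simp
    moreover have "Comp CompHaus Z Y W g h \<in> Hom CompHaus Z W"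
      by (rule C(2)[OF Z(1) Y(1) W Z(3) Y(2)])
    ultimately show "(Z, Comp (full_subcat CompHaus P) Z Y W g h) \<in> ?R"
      using Z(1,2) unfolding full_subcat_sel by blast
  qed auto
  ultimately show ?thesis using F'(1) unfolding surj_sieves_def by blast
qed

lemma grothendieck_surj_sieves:
  assumes u: "universe TYPE('u)"
    and ED: "\<And>X :: 'u topology. X \<in> Ob CompHaus \<Longrightarrow> extremally_disconnected_space X \<Longrightarrow> P X"
  shows "grothendieck_topology (full_subcat CompHaus P) (surj_sieves P)"
  unfolding grothendieck_topology_def
proof (intro ballI conjI allI impI)
  note C = category_rules[OF category_CompHaus]
  fix B :: "'u topology" assume BO: "B \<in> Ob (full_subcat CompHaus P)"
  then have B: "B \<in> Ob CompHaus" "P B" by auto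
  show "sieve (full_subcat CompHaus P) B R" if "R \<in> surj_sieves P B" for R
    using that by (rule surj_sievesD)
  have "jointly_surj B {(B, Ide CompHaus B)}" by (auto simp: jointly_surj_def)
  moreover have "(B, Ide CompHaus B) \<in> maximal_sieve (full_subcat CompHaus P) B"
    unfolding maximal_sieve_def using B C(1)[OF B(1)] by simp
  ultimately show "maximal_sieve (full_subcat CompHaus P) B \<in> surj_sieves P B"
    unfolding surj_sieves_def using sieve_maximal[OF category_CompHaus_sub BO] by blast
  show "pullback_sieve (full_subcat CompHaus P) B' B f R \<in> surj_sieves P B'"
    if R: "R \<in> surj_sieves P B" and B': "B' \<in> Ob (full_subcat CompHaus P)"
      and f: "f \<in> Hom (full_subcat CompHaus P) B' B" for R B' f
  proof -
    have "pullback_sieve (full_subcat CompHaus P) B' B f R =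
      {(V, v). V \<in> Ob CompHaus \<and> P V \<and> v \<in> Hom CompHaus V B' \<and> (V, Comp CompHaus V B' B f v) \<in> R}"
      unfolding pullback_sieve_def full_subcat_sel by blast
    then show ?thesis
      by (simp only:) (rule surj_sieves_refine[OF u ED R _ B(1)], use B' f in simp_all)
  qed
  fix S R
  assume S: "S \<in> surj_sieves P B" and R: "sieve (full_subcat CompHaus P) B R \<and>
    (\<forall>(Y, g)\<in>S. pullback_sieve (full_subcat CompHaus P) Y B g R \<in> surj_sieves P Y)"
  obtain F where F: "F \<subseteq> S" "jointly_surj B F" using S by (auto simp: surj_sieves_def)
  have "\<exists>G. G \<subseteq> pullback_sieve (full_subcat CompHaus P) Y B g R \<and> jointly_surj Y G" if "(Y, g) \<in> F" for Y g
  proof -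
    have "(Y, g) \<in> S" using that F by blast
    then have "pullback_sieve (full_subcat CompHaus P) Y B g R \<in> surj_sieves P Y" using R by blast
    then show ?thesis unfolding surj_sieves_def by blast
  qed
  then obtain G where G: "\<And>Y g. (Y, g) \<in> F \<Longrightarrow>
    G Y g \<subseteq> pullback_sieve (full_subcat CompHaus P) Y B g R \<and> jointly_surj Y (G Y g)"
    by metis
  have "jointly_surj B (\<Union>(Y, g)\<in>F. (\<lambda>(Z, h). (Z, Comp CompHaus Z Y B g h)) ` G Y g)"
    using F(2) by (rule jointly_surj_comp) (use G in blast)
  moreover have "(\<Union>(Y, g)\<in>F. (\<lambda>(Z, h). (Z, Comp CompHaus Z Y B g h)) ` G Y g) \<subseteq> R"
  proof (intro UN_least subsetI)
    fix z w assume z: "z \<in> F" and "w \<in> (case z of (Y, g) \<Rightarrow> (\<lambda>(Z, h). (Z, Comp CompHaus Z Y B g h)) ` G Y g)"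
    then obtain Y g Z h where "z = (Y, g)" "(Z, h) \<in> G Y g" "w = (Z, Comp CompHaus Z Y B g h)"
      by (cases z) auto
    with z G[of Y g] show "w \<in> R" unfolding pullback_sieve_def full_subcat_sel by blast
  qed
  ultimately show "R \<in> surj_sieves P B" using R unfolding surj_sieves_def by blast
qed

lemma extremally_disconnected_discrete: "extremally_disconnected_space (discrete_topology U)"
  using closure_of_subset_topspace[of "discrete_topology U"]
  by (simp add: extremally_disconnected_space_def)

text \<open>
  A finite jointly surjective family is a quotient map, and compatibility of the \<open>e i\<close> on points is
  tested on the one-point space.
\<close>

lemma jointly_surj_imp_effective_epi:
  fixes B :: "'u topology"
  assumes u: "universe TYPE('u)"
    and ED: "\<And>X :: 'u topology. X \<in> Ob CompHaus \<Longrightarrow> extremally_disconnected_space X \<Longrightarrow> P X"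
    and I: "finite I" and B: "B \<in> Ob CompHaus" "P B"
    and X: "\<And>i. i \<in> I \<Longrightarrow> X i \<in> Ob CompHaus \<and> P (X i) \<and> f i \<in> Hom CompHaus (X i) B"
    and surj: "topspace B \<subseteq> (\<Union>i\<in>I. f i ` topspace (X i))"
  shows "effective_epi_family (full_subcat CompHaus P) B I X f"
  unfolding effective_epi_family_def
proof (intro conjI ballI allI impI)
  show "B \<in> Ob (full_subcat CompHaus P)" using B by simp
  show "X i \<in> Ob (full_subcat CompHaus P)" "f i \<in> Hom (full_subcat CompHaus P) (X i) B" if "i \<in> I" for i
    using X[OF that] by auto
  fix W :: "'u topology" and e assume WO: "W \<in> Ob (full_subcat CompHaus P)"
  assume E: "(\<forall>i\<in>I. e i \<in> Hom (full_subcat CompHaus P) (X i) W) \<and>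
    (\<forall>i\<in>I. \<forall>j\<in>I. \<forall>Z\<in>Ob (full_subcat CompHaus P).
      \<forall>g\<in>Hom (full_subcat CompHaus P) Z (X i). \<forall>h\<in>Hom (full_subcat CompHaus P) Z (X j).
      Comp (full_subcat CompHaus P) Z (X i) B (f i) g = Comp (full_subcat CompHaus P) Z (X j) B (f j) h \<longrightarrow>
      Comp (full_subcat CompHaus P) Z (X i) W (e i) g = Comp (full_subcat CompHaus P) Z (X j) W (e j) h)"
  have e: "e i \<in> Hom CompHaus (X i) W" if "i \<in> I" for i
    using E that by (simp del: CompHaus_sel)
  have ec: "continuous_map (X i) W (e i)" and fc: "continuous_map (X i) B (f i)" if "i \<in> I" for i
    using e[OF that] X[OF that] by auto
  have agree: "e i x = e j y"
    if i: "i \<in> I" "x \<in> topspace (X i)" and j: "j \<in> I" "y \<in> topspace (X j)" and xy: "f i x = f j y" for i j x y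
  proof -
    let ?Z = "discrete_topology {undefined} :: 'u topology"
    have ZC: "?Z \<in> Ob CompHaus" using small_finite[OF u, of "{undefined}"] by (simp add: compact_space_discrete_topology)
    moreover have "extremally_disconnected_space ?Z"
      by (rule extremally_disconnected_discrete)
    ultimately have Z: "?Z \<in> Ob (full_subcat CompHaus P)" using ED by simp
    have g: "(\<lambda>_\<in>{undefined}. x) \<in> Hom (full_subcat CompHaus P) ?Z (X i)"
      and h: "(\<lambda>_\<in>{undefined}. y) \<in> Hom (full_subcat CompHaus P) ?Z (X j)"
      using i j by (auto simp: continuous_map_from_discrete_topology)
    have "Comp (full_subcat CompHaus P) ?Z (X i) B (f i) (\<lambda>_\<in>{undefined}. x) =
      Comp (full_subcat CompHaus P) ?Z (X j) B (f j) (\<lambda>_\<in>{undefined}. y)"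
      using xy by (auto simp: compose_def fun_eq_iff)
    then have "Comp (full_subcat CompHaus P) ?Z (X i) W (e i) (\<lambda>_\<in>{undefined}. x) =
      Comp (full_subcat CompHaus P) ?Z (X j) W (e j) (\<lambda>_\<in>{undefined}. y)"
      using E[THEN conjunct2, THEN bspec, OF i(1), THEN bspec, OF j(1), THEN bspec, OF Z, THEN bspec, OF g, THEN bspec, OF h]
      by blast
    then have "compose {undefined :: 'u} (e i) (\<lambda>_\<in>{undefined}. x) =
      compose {undefined} (e j) (\<lambda>_\<in>{undefined}. y)"
      by simp
    from fun_cong[OF this, of undefined] show ?thesis by (simp add: compose_def)
  qed
  have "\<exists>i x. b \<in> topspace B \<longrightarrow> i \<in> I \<and> x \<in> topspace (X i) \<and> f i x = b" for b
    using surj by force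
  then obtain i0 x0 where ix: "\<And>b. b \<in> topspace B \<Longrightarrow> i0 b \<in> I \<and> x0 b \<in> topspace (X (i0 b)) \<and> f (i0 b) (x0 b) = b"
    by metis
  define d where "d = (\<lambda>b\<in>topspace B. e (i0 b) (x0 b))"
  have fB: "f i x \<in> topspace B" if "i \<in> I" "x \<in> topspace (X i)" for i x
    using continuous_map_funspace[OF fc[OF that(1)]] that(2) by blast
  have d: "d (f i x) = e i x" if "i \<in> I" "x \<in> topspace (X i)" for i x
    unfolding d_def using ix[OF fB[OF that]] fB[OF that] that by (auto intro: agree)
  have "continuous_map B W d"
    unfolding continuous_map_closedin
  proof (intro conjI allI impI)
    show "d \<in> topspace B \<rightarrow> topspace W"
    proof
      fix b assume "b \<in> topspace B"
      then show "d b \<in> topspace W"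
        using d[of "i0 b" "x0 b"] ix[of b] continuous_map_funspace[OF ec[of "i0 b"]] by auto
    qed
    fix K assume K: "closedin W K"
    have "{b \<in> topspace B. d b \<in> K} = (\<Union>i\<in>I. f i ` {x \<in> topspace (X i). e i x \<in> K})"
    proof (intro subset_antisym subsetI)
      fix b assume b: "b \<in> {b \<in> topspace B. d b \<in> K}"
      then have i: "i0 b \<in> I" "x0 b \<in> topspace (X (i0 b))" "f (i0 b) (x0 b) = b" using ix by auto
      then have "e (i0 b) (x0 b) \<in> K" using d[of "i0 b" "x0 b"] b by simp
      then have "b \<in> f (i0 b) ` {x \<in> topspace (X (i0 b)). e (i0 b) x \<in> K}"
        using i by (intro rev_image_eqI[of "x0 b"]) auto
      then show "b \<in> (\<Union>i\<in>I. f i ` {x \<in> topspace (X i). e i x \<in> K})" using i(1) by blast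
    qed (use d fB in auto)
    moreover have "closedin B (f i ` {x \<in> topspace (X i). e i x \<in> K})" if i: "i \<in> I" for i
    proof (rule compactin_imp_closedin)
      show "Hausdorff_space B" using B by simp
      have "closedin (X i) {x \<in> topspace (X i). e i x \<in> K}"
        by (rule closedin_continuous_map_preimage[OF ec[OF i] K])
      then have "compactin (X i) {x \<in> topspace (X i). e i x \<in> K}"
        using X[OF i] by (auto intro: closedin_compact_space)
      then show "compactin B (f i ` {x \<in> topspace (X i). e i x \<in> K})"
        using fc[OF i] by (rule image_compactin)
    qed
    ultimately show "closedin B {b \<in> topspace B. d b \<in> K}"
      using I by (auto intro!: closedin_Union)
  qed
  then have dH: "d \<in> Hom CompHaus B W" by (simp add: d_def)
  show "\<exists>!d. d \<in> Hom (full_subcat CompHaus P) B W \<and>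
    (\<forall>i\<in>I. Comp (full_subcat CompHaus P) (X i) B W d (f i) = e i)"
  proof (rule ex1I[of _ d], intro conjI ballI)
    show "d \<in> Hom (full_subcat CompHaus P) B W" using dH by simp
    show "Comp (full_subcat CompHaus P) (X i) B W d (f i) = e i" if "i \<in> I" for i
      using d[OF that] e[OF that] by (auto simp: compose_def extensional_def fun_eq_iff)
    fix d' assume d': "d' \<in> Hom (full_subcat CompHaus P) B W \<and>
      (\<forall>i\<in>I. Comp (full_subcat CompHaus P) (X i) B W d' (f i) = e i)"
    have "d' (f i x) = e i x" if "i \<in> I" "x \<in> topspace (X i)" for i x
    proof -
      have "compose (topspace (X i)) d' (f i) x = e i x" using d' that(1) by simp
      then show ?thesis using that(2) by (simp add: compose_eq)
    qed
    then have "d' b = d b" if "b \<in> topspace B" for b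
      using ix[OF that] d by metis
    moreover have "d' \<in> extensional (topspace B)" using d' by simp
    ultimately show "d' = d"
      unfolding d_def by (auto simp: extensional_def fun_eq_iff)
  qed
qed

lemma effective_epiD:
  assumes "effective_epi_family C B I X f"
  shows "B \<in> Ob C" "i \<in> I \<Longrightarrow> X i \<in> Ob C" "i \<in> I \<Longrightarrow> f i \<in> Hom C (X i) B"
  using assms unfolding effective_epi_family_def by blast+

text \<open>
  The arrows \<open>d \<circ> f i\<close> form a compatible family, and both \<open>d\<close> and \<open>d'\<close> are factorizations of it.
\<close>

lemma effective_epi_unique:
  assumes E: "effective_epi_family C B I X f" and C: "category C" and W: "W \<in> Ob C"
    and d: "d \<in> Hom C B W" "d' \<in> Hom C B W"
    and eq: "\<And>i. i \<in> I \<Longrightarrow> Comp C (X i) B W d (f i) = Comp C (X i) B W d' (f i)"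
  shows "d = d'"
proof -
  note ED = effective_epiD[OF E] and CR = category_rules[OF C]
  let ?e = "\<lambda>i. Comp C (X i) B W d (f i)"
  have "\<exists>!d. d \<in> Hom C B W \<and> (\<forall>i\<in>I. Comp C (X i) B W d (f i) = ?e i)"
  proof (rule E[unfolded effective_epi_family_def, THEN conjunct2, THEN conjunct2, THEN bspec, OF W,
        THEN spec, THEN mp], intro conjI ballI impI)
    show "?e i \<in> Hom C (X i) W" if "i \<in> I" for i using that d W by (simp add: ED CR)
    show "Comp C Z (X i) W (?e i) g = Comp C Z (X j) W (?e j) h"
      if "i \<in> I" "j \<in> I" "Z \<in> Ob C" "g \<in> Hom C Z (X i)" "h \<in> Hom C Z (X j)"
        "Comp C Z (X i) B (f i) g = Comp C Z (X j) B (f j) h" for i j Z g h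
      using that d W by (simp add: ED CR)
  qed
  moreover define Q where "Q d \<longleftrightarrow> d \<in> Hom C B W \<and> (\<forall>i\<in>I. Comp C (X i) B W d (f i) = ?e i)" for d
  ultimately have "\<exists>!d. Q d" by simp
  moreover have "Q d" "Q d'" using d eq by (simp_all add: Q_def)
  ultimately show ?thesis by blast
qed

lemma effective_epi_image_closed:
  assumes E: "effective_epi_family (full_subcat CompHaus P) B I X f" and I: "finite I"
  shows "closedin B (\<Union>i\<in>I. f i ` topspace (X i))"
proof -
  have "closedin B (f i ` topspace (X i))" if "i \<in> I" for i
  proof (rule compactin_imp_closedin)
    show "Hausdorff_space B" using effective_epiD[OF E] by simp
    have "compactin (X i) (topspace (X i))" "continuous_map (X i) B (f i)"
      using effective_epiD(2,3)[OF E that] by (auto simp: compact_space_def)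
    then show "compactin B (f i ` topspace (X i))" by (rule image_compactin)
  qed
  then show ?thesis using I by (auto intro!: closedin_Union)
qed

text \<open>
  If the image \<open>K\<close> of the family is itself an object, then the family factors through the inclusion
  of \<open>K\<close>, which thereby has a section.
\<close>

lemma effective_epi_surj_if_closed_hereditary:
  assumes her: "\<And>X K. X \<in> Ob CompHaus \<Longrightarrow> P X \<Longrightarrow> closedin X K \<Longrightarrow> P (subtopology X K)"
    and E: "effective_epi_family (full_subcat CompHaus P) B I X f" and I: "finite I"
  shows "topspace B \<subseteq> (\<Union>i\<in>I. f i ` topspace (X i))"
proof
  let ?C = "full_subcat CompHaus P"
  let ?K = "\<Union>i\<in>I. f i ` topspace (X i)"
  let ?W = "subtopology B ?K"
  note ED = effective_epiD[OF E]
  have cl: "closedin B ?K" using E I by (rule effective_epi_image_closed)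
  have B: "B \<in> Ob CompHaus" "P B" using ED(1) by auto
  have f: "f i \<in> extensional (topspace (X i))" "continuous_map (X i) B (f i)" if "i \<in> I" for i
    using ED(3)[OF that] by auto
  have "small (topspace ?W)" using B by (auto intro: small_subset)
  moreover have "compact_space ?W"
    using B cl by (auto intro!: compact_space_subtopology closedin_compact_space)
  ultimately have W: "?W \<in> Ob ?C" using her[OF B cl] B by (simp add: Hausdorff_space_subtopology)
  have fW: "f i \<in> Hom ?C (X i) ?W" if "i \<in> I" for i
    using f[OF that] that by (auto simp: continuous_map_in_subtopology)
  have "\<exists>!d. d \<in> Hom ?C B ?W \<and> (\<forall>i\<in>I. Comp ?C (X i) B ?W d (f i) = f i)"
    by (rule E[unfolded effective_epi_family_def, THEN conjunct2, THEN conjunct2, THEN bspec, OF W,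
        THEN spec, THEN mp], intro conjI ballI impI) (use fW in \<open>simp_all add: CompHaus_def\<close>)
  then obtain d where d: "d \<in> Hom ?C B ?W" and df: "\<And>i. i \<in> I \<Longrightarrow> Comp ?C (X i) B ?W d (f i) = f i" by blast
  have dc: "continuous_map B ?W d" "d \<in> extensional (topspace B)" using d by auto
  have "d = Ide ?C B"
  proof (rule effective_epi_unique[OF E category_CompHaus_sub ED(1)])
    show "d \<in> Hom ?C B B" using dc by (auto simp: continuous_map_in_subtopology)
    show "Ide ?C B \<in> Hom ?C B B" by (rule ide_in[OF category_CompHaus_sub ED(1)])
    show "Comp ?C (X i) B B d (f i) = Comp ?C (X i) B B (Ide ?C B) (f i)" if "i \<in> I" for i
      using df[OF that] comp_ide_left[OF category_CompHaus_sub ED(2)[OF that] ED(1) ED(3)[OF that]]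
      by (simp add: CompHaus_def)
  qed
  fix b assume b: "b \<in> topspace B"
  then have "d b = b" using \<open>d = _\<close> by simp
  then show "b \<in> ?K" using funcset_mem[OF continuous_map_funspace[OF dc(1)] b] by simp
qed

text \<open>
  A point outside the image is separated from it by a clopen set, that is, by a map to the
  two-point space.
\<close>

lemma effective_epi_surj_if_extremally_disconnected:
  fixes B :: "'u topology"
  assumes u: "universe TYPE('u)"
    and E: "effective_epi_family (full_subcat CompHaus extremally_disconnected_space) B I X f" and I: "finite I"
  shows "topspace B \<subseteq> (\<Union>i\<in>I. f i ` topspace (X i))"
proof (rule ccontr)
  let ?C = "full_subcat CompHaus extremally_disconnected_space :: ('u topology, 'u \<Rightarrow> 'u) cat"
  let ?K = "\<Union>i\<in>I. f i ` topspace (X i)"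
  note ED = effective_epiD[OF E]
  have cl: "closedin B ?K" using E I by (rule effective_epi_image_closed)
  have B: "B \<in> Ob CompHaus" "extremally_disconnected_space B" using ED(1) by auto
  assume "\<not> topspace B \<subseteq> ?K"
  then obtain b where b: "b \<in> topspace B - ?K" by blast
  have "neighbourhood_base_of (closedin B) B"
    using compact_Hausdorff_imp_regular_space[of B] B by (simp add: neighbourhood_base_of_closedin)
  moreover have "openin B (topspace B - ?K)" using cl by blast
  ultimately obtain U L where U: "openin B U" "closedin B L" "b \<in> U" "U \<subseteq> L" "L \<subseteq> topspace B - ?K"
    using b unfolding neighbourhood_base_of by meson
  let ?V = "B closure_of U"
  have V: "openin B ?V" "closedin B ?V" using B(2) U(1) by (auto simp: extremally_disconnected_space_def)
  have VL: "?V \<subseteq> L" using U by (simp add: closure_of_minimal)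
  have bV: "b \<in> ?V" using closure_of_subset[OF openin_subset[OF U(1)]] U(3) by blast
  have "infinite (UNIV :: 'u set)" using u by (simp add: universe_def)
  then obtain p q :: 'u where pq: "p \<noteq> q"
    by (metis (full_types) UNIV_I finite.emptyI finite_insert finite_subset insertI1 subsetI)
  let ?W = "discrete_topology {p, q}"
  have W: "?W \<in> Ob ?C"
    using small_finite[OF u, of "{p, q}"]
    by (simp add: compact_space_discrete_topology extremally_disconnected_discrete)
  define d1 where "d1 = (\<lambda>x\<in>topspace B. if x \<in> ?V then p else q)"
  define d2 where "d2 = (\<lambda>x\<in>topspace B. q)"
  have "continuous_map B ?W d1"
    unfolding continuous_map_def
  proof (intro conjI allI impI)
    show "d1 \<in> topspace B \<rightarrow> topspace ?W" by (auto simp: d1_def)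
    fix T assume "openin ?W T"
    have "{x \<in> topspace B. d1 x \<in> T} = (if p \<in> T then ?V else {}) \<union> (if q \<in> T then topspace B - ?V else {})"
      using closure_of_subset_topspace[of B U] by (auto simp: d1_def)
    then show "openin B {x \<in> topspace B. d1 x \<in> T}" using V by auto
  qed
  then have d1: "d1 \<in> Hom ?C B ?W" by (simp add: d1_def)
  have d2: "d2 \<in> Hom ?C B ?W" by (auto simp: d2_def)
  have "d1 = d2"
  proof (rule effective_epi_unique[OF E category_CompHaus_sub W d1 d2])
    fix i assume i: "i \<in> I"
    have "continuous_map (X i) B (f i)" using ED(3)[OF i] by simp
    moreover have "f i x \<in> ?K" if "x \<in> topspace (X i)" for x using i that by blast
    ultimately have "f i x \<in> topspace B" "f i x \<notin> ?V" if "x \<in> topspace (X i)" for x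
      using that continuous_map_funspace[of "X i" B "f i"] VL U(5) by blast+
    then show "Comp ?C (X i) B ?W d1 (f i) = Comp ?C (X i) B ?W d2 (f i)"
      by (auto simp: compose_def fun_eq_iff d1_def d2_def)
  qed
  then have "d1 b = d2 b" by simp
  then show False using b bV pq by (simp add: d1_def d2_def)
qed

text \<open>
  The sieves with a finite jointly surjective subfamily form a Grothendieck topology that contains the
  generators of the coherent one. Conversely, such a subfamily is effective epimorphic, so the sieve
  that it generates is coherent, and so is every larger sieve.
\<close>

lemma coherent_topology_eq_surj_sieves:
  assumes u: "universe TYPE('u)"
    and ED: "\<And>X :: 'u topology. X \<in> Ob CompHaus \<Longrightarrow> extremally_disconnected_space X \<Longrightarrow> P X"
    and epi: "\<And>B (I :: nat set) X f. finite I \<Longrightarrow> effective_epi_family (full_subcat CompHaus P) B I X f \<Longrightarrow>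
      topspace B \<subseteq> (\<Union>i\<in>I. f i ` topspace (X i))"
    and B: "B \<in> Ob CompHaus" "P B"
  shows "coherent_topology (full_subcat CompHaus P) B = surj_sieves P B"
proof (intro subset_antisym subsetI)
  let ?C = "full_subcat CompHaus P"
  note CR = category_rules[OF category_CompHaus_sub[where P = P]]
  have BO: "B \<in> Ob ?C" using B by simp
  fix R assume R: "R \<in> coherent_topology ?C B"
  have gen: "generated_sieve ?C B' I X f \<in> surj_sieves P B'"
    if I: "finite I" and E: "effective_epi_family ?C B' I X f" for B' and I :: "nat set" and X f
  proof -
    note ED = effective_epiD[OF E]
    let ?F = "(\<lambda>i. (X i, f i)) ` I"
    have "jointly_surj B' ?F" using epi[OF I E] I by (auto simp: jointly_surj_def)
    moreover have in_gen: "(X i, f i) \<in> generated_sieve ?C B' I X f" if i: "i \<in> I" for i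
    proof -
      have "Ide ?C (X i) \<in> Hom ?C (X i) (X i)" "f i = Comp ?C (X i) (X i) B' (f i) (Ide ?C (X i))"
        using CR(1)[OF ED(2)[OF i]] CR(3)[OF ED(2)[OF i] ED(1) ED(3)[OF i]] by simp_all
      then show ?thesis using i ED(2)[OF i] unfolding generated_sieve_def by blast
    qed
    moreover have "?F \<subseteq> generated_sieve ?C B' I X f" using in_gen by (rule image_subsetI)
    moreover have "sieve ?C B' (generated_sieve ?C B' I X f)"
      by (rule sieve_generated[OF category_CompHaus_sub ED(1)]) (use ED(2,3) in blast)
    ultimately show ?thesis by (intro surj_sievesI[of P B' _ ?F])
  qed
  have imp: "grothendieck_topology ?C (surj_sieves P) \<and>
          (\<forall>B'. \<forall>I :: nat set. \<forall>X f. finite I \<and> effective_epi_family ?C B' I X f \<longrightarrow>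
             generated_sieve ?C B' I X f \<in> surj_sieves P B')"
    using grothendieck_surj_sieves[of P, OF u ED] gen by blast
  note R = R[unfolded coherent_topology_def mem_Collect_eq, THEN conjunct2]
  from R[THEN spec, THEN mp, OF imp] show "R \<in> surj_sieves P B" .
next
  let ?C = "full_subcat CompHaus P"
  note CR = category_rules[OF category_CompHaus_sub[where P = P]]
  have BO: "B \<in> Ob ?C" using B by simp
  fix R assume R: "R \<in> surj_sieves P B"
  note Rs = surj_sievesD(1)[OF R]
  have "R \<in> J B" if J: "grothendieck_topology ?C J" and
    gen: "\<forall>B'. \<forall>I :: nat set. \<forall>X f. finite I \<and> effective_epi_family ?C B' I X f \<longrightarrow>
             generated_sieve ?C B' I X f \<in> J B'" for J
  proof -
    obtain F where F: "F \<subseteq> R" "jointly_surj B F" using R by (auto simp: surj_sieves_def)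
    then obtain n and z :: "nat \<Rightarrow> _" where z: "F = z ` {i. i < n}"
      using finite_imp_nat_seg_image_inj_on[of F] by (auto simp: jointly_surj_def)
    let ?I = "{i. i < n}"
    have zR: "(fst (z i), snd (z i)) \<in> R" if "i \<in> ?I" for i using F(1) z that by auto
    have Bs: "topspace B \<subseteq> (\<Union>i\<in>?I. snd (z i) ` topspace (fst (z i)))"
    proof
      fix b assume "b \<in> topspace B"
      then obtain Y g where "(Y, g) \<in> F" "b \<in> g ` topspace Y" using F(2) by (auto simp: jointly_surj_def)
      moreover from this obtain i where i: "i \<in> ?I" "z i = (Y, g)" unfolding z by auto
      ultimately have "b \<in> snd (z i) ` topspace (fst (z i))" by simp
      then show "b \<in> (\<Union>i\<in>?I. snd (z i) ` topspace (fst (z i)))" using i(1) by blast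
    qed
    have "effective_epi_family ?C B ?I (\<lambda>i. fst (z i)) (\<lambda>i. snd (z i))"
    proof (rule jointly_surj_imp_effective_epi[where P = P, OF u _ _ B])
      show "fst (z i) \<in> Ob CompHaus \<and> P (fst (z i)) \<and> snd (z i) \<in> Hom CompHaus (fst (z i)) B" if "i \<in> ?I" for i
        using surj_sievesD(2-4)[OF R zR[OF that]] by blast
      show "finite ?I" by simp
    qed (fact ED, fact Bs)
    then have G: "generated_sieve ?C B ?I (\<lambda>i. fst (z i)) (\<lambda>i. snd (z i)) \<in> J B" (is "?G \<in> _")
      using gen by blast
    have GR: "(Y, g) \<in> R" if "(Y, g) \<in> ?G" for Y g
      using that sieve_comp[OF Rs zR] unfolding generated_sieve_def by blast
    note JB = J[unfolded grothendieck_topology_def, THEN bspec]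
    have "pullback_sieve ?C Y B g R \<in> J Y" if g: "(Y, g) \<in> ?G" for Y g
    proof -
      note gR = GR[OF g]
      have Y: "Y \<in> Ob ?C" "g \<in> Hom ?C Y B" using sieve_mem[OF Rs gR] by blast+
      have "(Z, Comp ?C Z Y B g h) \<in> R" if "Z \<in> Ob ?C" "h \<in> Hom ?C Z Y" for Z h
        by (rule sieve_comp[OF Rs gR that])
      then have "pullback_sieve ?C Y B g R = maximal_sieve ?C Y"
        unfolding pullback_sieve_def maximal_sieve_def by blast
      then show ?thesis using JB[OF Y(1)] by simp
    qed
    then show ?thesis
      using JB[OF BO, THEN conjunct2, THEN conjunct2, THEN conjunct2, THEN bspec, OF G, THEN spec, THEN mp, of R] Rs
      by blast
  qed
  then show "R \<in> coherent_topology ?C B"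
    unfolding coherent_topology_def using Rs by blast
qed

section \<open>Comparison for subcategories of compact Hausdorff spaces\<close>

lemma CompHaus_full: "full_subcat CompHaus (\<lambda>_. True) = CompHaus"
  by (simp add: full_subcat_def CompHaus_def)

lemma covered_site_coherent:
  assumes ED: "\<And>X :: 'u topology. X \<in> Ob CompHaus \<Longrightarrow> extremally_disconnected_space X \<Longrightarrow> P X"
    and J: "\<And>B. B \<in> Ob CompHaus \<Longrightarrow> P B \<Longrightarrow> J B = surj_sieves P B"
    and q: "\<And>X :: 'u topology. X \<in> Ob CompHaus \<Longrightarrow> cover_pair X (S X) (q X)"
  shows "covered_site (full_subcat CompHaus P) J S q"
proof
  let ?C = "full_subcat CompHaus P"
  note CR = category_rules[OF category_CompHaus_sub[where P = P]]
  show "category ?C" by (rule category_CompHaus_sub)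
  show "sieve ?C B R" if "B \<in> Ob ?C" "R \<in> J B" for B R
    using that J[of B] surj_sievesD(1)[of R P B] by (simp del: CompHaus_sel)
  fix X assume XO: "X \<in> Ob ?C"
  then have X: "X \<in> Ob CompHaus" "P X" by (simp_all del: CompHaus_sel)
  note qX = cover_pairD[OF q[OF X(1)]]
  show S: "S X \<in> Ob ?C" using qX ED by (simp del: CompHaus_sel)
  show qH: "q X \<in> Hom ?C (S X) X" using qX by (simp del: CompHaus_sel)
  let ?R = "{(Z, h). Z \<in> Ob ?C \<and> (\<exists>k\<in>Hom ?C Z (S X). h = Comp ?C Z (S X) X (q X) k)}"
  have eq: "?R = generated_sieve ?C X {()} (\<lambda>_. S X) (\<lambda>_. q X)"
    by (simp add: generated_sieve_def)
  have "sieve ?C X ?R" unfolding eq by (rule sieve_generated[OF category_CompHaus_sub XO]) (use S qH in blast)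
  moreover have "{(S X, q X)} \<subseteq> ?R"
  proof -
    have "Ide ?C (S X) \<in> Hom ?C (S X) (S X)" "q X = Comp ?C (S X) (S X) X (q X) (Ide ?C (S X))"
      using CR(1)[OF S] CR(3)[OF S XO qH] by simp_all
    then show ?thesis using S by blast
  qed
  moreover have "jointly_surj X {(S X, q X)}" using qX(4) by (simp add: jointly_surj_def)
  ultimately show "?R \<in> J X" unfolding J[OF X] by (rule surj_sievesI)
qed

lemma comparison_CompHaus:
  assumes u: "universe TYPE('u)"
    and ED: "\<And>X :: 'u topology. X \<in> Ob CompHaus \<Longrightarrow> extremally_disconnected_space X \<Longrightarrow> P X"
    and epi: "\<And>B (I :: nat set) X f. finite I \<Longrightarrow> effective_epi_family (full_subcat CompHaus P) B I X f \<Longrightarrow>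
      topspace B \<subseteq> (\<Union>i\<in>I. f i ` topspace (X i))"
  obtains S q where "comparison (CompHaus :: ('u topology, 'u \<Rightarrow> 'u) cat) P
    (coherent_topology CompHaus) (coherent_topology (full_subcat CompHaus P)) S q"
proof -
  have "\<forall>X :: 'u topology. \<exists>S q. X \<in> Ob CompHaus \<longrightarrow> cover_pair X S q"
    using cover_pair_exists[OF u] by blast
  then obtain S q where q: "\<And>X :: 'u topology. X \<in> Ob CompHaus \<Longrightarrow> cover_pair X (S X) (q X)" by metis
  have "coherent_topology (full_subcat CompHaus (\<lambda>_. True)) B = surj_sieves (\<lambda>_. True) B"
    if "B \<in> Ob CompHaus" for B :: "'u topology"
    by (rule coherent_topology_eq_surj_sieves[OF u])
      (use that effective_epi_surj_if_closed_hereditary[of "\<lambda>_. True"] in blast)+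
  then have JC: "coherent_topology CompHaus B = surj_sieves (\<lambda>_. True) B" if "B \<in> Ob CompHaus" for B :: "'u topology"
    using that by (simp only: CompHaus_full)
  have JD: "coherent_topology (full_subcat CompHaus P) B = surj_sieves P B" if "B \<in> Ob CompHaus" "P B" for B
    using coherent_topology_eq_surj_sieves[of P B, OF u ED epi] that by blast
  note C = category_rules[OF category_CompHaus]
  have "comparison (CompHaus :: ('u topology, 'u \<Rightarrow> 'u) cat) P
    (coherent_topology CompHaus) (coherent_topology (full_subcat CompHaus P)) S q"
  proof (intro comparison.intro comparison_axioms.intro)
    show "covered_site CompHaus (coherent_topology CompHaus) S q"
      using covered_site_coherent[of "\<lambda>_. True" "coherent_topology CompHaus" S q, OF _ JC q]
      by (simp add: CompHaus_full del: CompHaus_sel)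
    show "covered_site (full_subcat CompHaus P) (coherent_topology (full_subcat CompHaus P)) S q"
      using covered_site_coherent[of P _ S q, OF ED JD q] by blast
    show "P (S X)" if "X \<in> Ob CompHaus" for X
      using cover_pairD(1,2)[OF q[OF that]] by (rule ED)
    show "\<exists>l\<in>Hom CompHaus (S X) (S Y). Comp CompHaus (S X) (S Y) Y (q Y) l = h"
      if "X \<in> Ob CompHaus" "Y \<in> Ob CompHaus" "h \<in> Hom CompHaus (S X) Y" for X Y h
      by (rule cover_pair_lift[OF q[OF that(1)] q[OF that(2)] that(2,3)])
    show "{(V, v). V \<in> Ob CompHaus \<and> P V \<and> v \<in> Hom CompHaus V W \<and> (V, Comp CompHaus V W B f v) \<in> R}
        \<in> coherent_topology (full_subcat CompHaus P) W"
      if "B \<in> Ob CompHaus" "R \<in> coherent_topology CompHaus B" "W \<in> Ob CompHaus" "P W" "f \<in> Hom CompHaus W B" for B R W f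
      unfolding JD[OF that(3,4)]
      using surj_sieves_refine[of P R "\<lambda>_. True" B W f, OF u ED] that JC[OF that(1)] by blast
    show "{(Z, h). Z \<in> Ob CompHaus \<and> (\<exists>Y g k. (Y, g) \<in> R \<and> k \<in> Hom CompHaus Z Y \<and> h = Comp CompHaus Z Y B g k)}
        \<in> coherent_topology CompHaus B" (is "?R \<in> _")
      if B: "B \<in> Ob CompHaus" "P B" and R: "R \<in> coherent_topology (full_subcat CompHaus P) B" for B R
    proof -
      have R: "R \<in> surj_sieves P B" using R JD[OF B] by simp
      note m = surj_sievesD(2,4)[OF R]
      obtain F where F: "F \<subseteq> R" "jointly_surj B F" using R by (auto simp: surj_sieves_def)
      have "F \<subseteq> ?R"
      proof (intro subsetI, clarify)
        fix Y g assume "(Y, g) \<in> F"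
        then have g: "(Y, g) \<in> R" using F(1) by blast
        have "Ide CompHaus Y \<in> Hom CompHaus Y Y" "g = Comp CompHaus Y Y B g (Ide CompHaus Y)"
          using C(1)[OF m(1)[OF g]] C(3)[OF m(1)[OF g] B(1) m(2)[OF g]] by simp_all
        then show "Y \<in> Ob CompHaus \<and> (\<exists>Y' g' k. (Y', g') \<in> R \<and> k \<in> Hom CompHaus Y Y' \<and> g = Comp CompHaus Y Y' B g' k)"
          using g m(1)[OF g] by blast
      qed
      moreover have "?R = generated_sieve CompHaus B R fst snd"
        by (simp only: generated_sieve_def Bex_def split_paired_Ex fst_conv snd_conv) blast
      moreover have "sieve CompHaus B (generated_sieve CompHaus B R fst snd)"
        by (rule sieve_generated[OF category_CompHaus B(1)]) (use m in force)
      ultimately show ?thesis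
        unfolding JC[OF B(1)] surj_sieves_def CompHaus_full using F(2) by auto
    qed
  qed
  then show thesis by (rule that)
qed

lemma restriction_coherent_sheaves_is_equivalence:
  assumes u: "universe TYPE('u)"
    and ED: "\<And>X :: 'u topology. X \<in> Ob CompHaus \<Longrightarrow> extremally_disconnected_space X \<Longrightarrow> P X"
    and epi: "\<And>B (I :: nat set) X f. finite I \<Longrightarrow> effective_epi_family (full_subcat CompHaus P) B I X f \<Longrightarrow>
      topspace B \<subseteq> (\<Union>i\<in>I. f i ` topspace (X i))"
  shows "is_equivalence
           (coherent_sheaves CompHaus :: ('u topology, 'u \<Rightarrow> 'u, 'v) sheaf_cat)
           (coherent_sheaves (full_subcat CompHaus P))
           (precomp_func (full_subcat CompHaus P) CompHaus (inclusion_func (full_subcat CompHaus P)))"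
proof -
  let ?D = "full_subcat CompHaus P :: ('u topology, 'u \<Rightarrow> 'u) cat"
  obtain S q where c: "comparison (CompHaus :: ('u topology, 'u \<Rightarrow> 'u) cat) P
    (coherent_topology CompHaus) (coherent_topology ?D) S q"
    using comparison_CompHaus[of P, OF u ED epi] by blast
  have eq: "(precomp_func ?D CompHaus (inclusion_func ?D) ::
      (('u topology, 'u \<Rightarrow> 'u, 'v) presheaf, 'u topology \<Rightarrow> 'v \<Rightarrow> 'v, ('u topology, 'u \<Rightarrow> 'u, 'v) presheaf,
       'u topology \<Rightarrow> 'v \<Rightarrow> 'v) func) =
    make_func (coherent_sheaves CompHaus) (comparison.res CompHaus P) (\<lambda>F G \<alpha>. \<lambda>X\<in>Ob ?D. \<alpha> X)"
    unfolding precomp_func_def comparison.res_def[OF c, abs_def]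
    by (intro arg_cong[of _ _ "make_func _ _"] ext restrict_ext) (simp del: full_subcat_sel)
  show ?thesis
    unfolding eq unfolding coherent_sheaves_def by (rule comparison.restriction_is_equivalence[OF c])
qed

section \<open>Profinite and Stonean spaces\<close>

text \<open>
  If \<open>x\<close> and \<open>y\<close> have disjoint neighbourhoods, the closure of the one of \<open>x\<close> is clopen and omits \<open>y\<close>.
\<close>

lemma totally_disconnected_if_extremally_disconnected:
  assumes X: "Hausdorff_space X" "extremally_disconnected_space X"
  shows "totally_disconnected_space X"
  unfolding totally_disconnected_space_def
proof (intro ballI subset_antisym subsetI)
  fix x y assume x: "x \<in> topspace X" and y: "y \<in> connected_component_of_set X x"
  show "y \<in> {x}"
  proof (rule ccontr)
    assume "y \<notin> {x}"
    obtain T where T: "connectedin X T" "x \<in> T" "y \<in> T"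
      using y by (auto simp: connected_component_of_def)
    then have "y \<in> topspace X" using connectedin_subset_topspace by blast
    then obtain U V where U: "openin X U" "openin X V" "x \<in> U" "y \<in> V" "disjnt U V"
      using X(1) x \<open>y \<notin> {x}\<close> unfolding Hausdorff_space_def by (metis singletonI)
    have "y \<notin> X closure_of U" using U by (auto simp: in_closure_of disjnt_iff)
    moreover have "x \<in> X closure_of U"
      using closure_of_subset[OF openin_subset[OF U(1)]] U(3) by blast
    moreover have "openin X (X closure_of U)" using X(2) U(1) by (simp add: extremally_disconnected_space_def)
    ultimately show False
      using connectedin_clopen_cases[OF T(1), of "X closure_of U"] T(2,3) by (auto simp: disjnt_iff)
  qed
qed (auto simp: connected_component_of_refl)

lemma totally_disconnected_subtopology:
  assumes "totally_disconnected_space X"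
  shows "totally_disconnected_space (subtopology X K)"
  unfolding totally_disconnected_space_def
proof (intro ballI subset_antisym subsetI)
  fix x y assume x: "x \<in> topspace (subtopology X K)" and "y \<in> connected_component_of_set (subtopology X K) x"
  then have "y \<in> connected_component_of_set X x"
    by (auto simp: connected_component_of_def connectedin_subtopology)
  moreover have "connected_component_of_set X x = {x}"
    using assms x by (simp add: totally_disconnected_space_def)
  ultimately show "y \<in> {x}" by simp
qed (auto simp: connected_component_of_refl)

theorem theorem7p7:
  assumes "universe TYPE('u)"
  shows "is_equivalence
           (coherent_sheaves CompHaus :: ('u topology, 'u \<Rightarrow> 'u, 'v) sheaf_cat)
           (coherent_sheaves Profinite :: ('u topology, 'u \<Rightarrow> 'u, 'v) sheaf_cat)
           (precomp_func Profinite CompHaus (inclusion_func Profinite)) \<and>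
         is_equivalence
           (coherent_sheaves CompHaus :: ('u topology, 'u \<Rightarrow> 'u, 'v) sheaf_cat)
           (coherent_sheaves Stonean :: ('u topology, 'u \<Rightarrow> 'u, 'v) sheaf_cat)
           (precomp_func Stonean CompHaus (inclusion_func Stonean))"
proof
  show "is_equivalence
           (coherent_sheaves CompHaus :: ('u topology, 'u \<Rightarrow> 'u, 'v) sheaf_cat)
           (coherent_sheaves Profinite :: ('u topology, 'u \<Rightarrow> 'u, 'v) sheaf_cat)
           (precomp_func Profinite CompHaus (inclusion_func Profinite))"
    unfolding Profinite_def
  proof (rule restriction_coherent_sheaves_is_equivalence[OF assms])
    show "totally_disconnected_space X"
      if "X \<in> Ob CompHaus" "extremally_disconnected_space X" for X :: "'u topology"
      using that by (simp add: totally_disconnected_if_extremally_disconnected)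
    show "topspace B \<subseteq> (\<Union>i\<in>I. f i ` topspace (X i))"
      if "finite I" "effective_epi_family (full_subcat CompHaus totally_disconnected_space) B I X f"
      for B :: "'u topology" and I :: "nat set" and X f
      by (rule effective_epi_surj_if_closed_hereditary[OF totally_disconnected_subtopology that(2,1)])
  qed
  show "is_equivalence
           (coherent_sheaves CompHaus :: ('u topology, 'u \<Rightarrow> 'u, 'v) sheaf_cat)
           (coherent_sheaves Stonean :: ('u topology, 'u \<Rightarrow> 'u, 'v) sheaf_cat)
           (precomp_func Stonean CompHaus (inclusion_func Stonean))"
    unfolding Stonean_def
    using assms
    by (rule restriction_coherent_sheaves_is_equivalence)
      (use effective_epi_surj_if_extremally_disconnected[OF assms] in blast)+
qed

end
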